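(* Let $M$ be a smooth manifold, $\pi\in\mathfrak{X}^2(M)$ a bivector field and $r\in\Omega^1(M,TM)$ a $(1,1)$-tensor field. The pair $(\pi,r)$ is compatible if and only if $$T\pi^\sharp\circ r^{cotg}=r^{tg}\circ T\pi^\sharp .$$
   Context: $\pi^\sharp:T^*M\to TM$ is $\alpha\mapsto i_\alpha\pi$, with tangent map $T\pi^\sharp:T(T^*M)\to T(TM)$. View $r$ as a bundle map $r:TM\to TM$, with dual $r^*:T^*M\to T^*M$. The pair $(\pi,r)$ is compatible if (1) $\pi^\sharp\circ r^*=r\circ\pi^\sharp$, and (2) for all $X\in\mathfrak{X}(M)$, $\alpha\in\Omega^1(M)$, $\pi^\sharp(\mathcal{L}_Xr^*(\alpha)-\mathcal{L}_{r(X)}\alpha)-(\mathcal{L}_{\pi^\sharp(\alpha)}r)(X)=0$. The tangent lift $r^{tg}:T(TM)\to T(TM)$ is $r^{tg}=J_M\circ Tr\circ J_M$, where $J_M:T(TM)\to T(TM)$ is the canonical involution of the double tangent bundle and $Tr$ is the tangent map of $r:TM\to TM$. The cotangent lift $r^{cotg}:T(T^*M)\to T(T^*M)$ is determined by $i_{r^{cotg}(U)}\omega_{\mathrm{can}}=i_U(\phi_r^*\omega_{\mathrm{can}})$, where $\omega_{\mathrm{can}}$ is the canonical symplectic form on $T^*M$ and $\phi_r=r^*:T^*M\to T^*M$. *)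

theory Defs
  imports "HOL-Analysis.Analysis" "HOL-Library.Function_Algebras"
begin

text \<open>Real-valued and vector-valued functions form a real vector space under pointwise
  operations.\<close>

instantiation "fun" :: (type, real_vector) real_vector
begin

definition scaleR_fun :: "real \<Rightarrow> ('a \<Rightarrow> 'b) \<Rightarrow> 'a \<Rightarrow> 'b" where
  "scaleR_fun a f = (\<lambda>x. a *\<^sub>R f x)"

instance
  by standard (auto simp: scaleR_fun_def fun_eq_iff scaleR_add_right scaleR_add_left)

end

definition linear_between :: "'v::real_vector set \<Rightarrow> 'w::real_vector set \<Rightarrow> ('v \<Rightarrow> 'w) \<Rightarrow> bool" where
  "linear_between V W f \<longleftrightarrow>
     (\<forall>v\<in>V. f v \<in> W) \<and>
     (\<forall>u\<in>V. \<forall>v\<in>V. \<forall>a b. f (a *\<^sub>R u + b *\<^sub>R v) = a *\<^sub>R f u + b *\<^sub>R f v)"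

section \<open>Smooth functions and smooth manifolds\<close>

text \<open>\<open>C\<^sup>k\<close> and \<open>C\<^sup>\<infinity>\<close> on an open subset of a finite-dimensional space, with the derivative tested
  on each constant direction \<open>v\<close>.\<close>

primrec Ck_on :: "nat \<Rightarrow> 'e::real_normed_vector set \<Rightarrow> ('e \<Rightarrow> 'f::real_normed_vector) \<Rightarrow> bool" where
  "Ck_on 0 S f \<longleftrightarrow> continuous_on S f"
| "Ck_on (Suc k) S f \<longleftrightarrow>
     (\<forall>x\<in>S. f differentiable (at x)) \<and> (\<forall>v. Ck_on k S (\<lambda>x. frechet_derivative f (at x) v))"

definition smooth_on :: "'e::real_normed_vector set \<Rightarrow> ('e \<Rightarrow> 'f::real_normed_vector) \<Rightarrow> bool" where
  "smooth_on S f \<longleftrightarrow> (\<forall>k. Ck_on k S f)"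

text \<open>A chart is a pair of its domain and a map; values of the map off the domain are irrelevant.\<close>

type_synonym ('a, 'e) chart = "'a set \<times> ('a \<Rightarrow> 'e)"

abbreviation chart_inv :: "('a, 'e) chart \<Rightarrow> 'e \<Rightarrow> 'a" where
  "chart_inv c \<equiv> inv_into (fst c) (snd c)"

abbreviation chart_image :: "('a, 'e) chart \<Rightarrow> 'e set" where
  "chart_image c \<equiv> snd c ` fst c"

definition carrier :: "('a, 'e) chart set \<Rightarrow> 'a set" where
  "carrier A = (\<Union>c\<in>A. fst c)"

text \<open>The model space is a finite-dimensional real inner product space; class
  \<open>euclidean_space\<close> would in addition exclude dimension 0.\<close>

definition smooth_manifold :: "'a topology \<Rightarrow> ('a, 'e::real_inner) chart set \<Rightarrow> bool" where
  "smooth_manifold T A \<longleftrightarrow>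
     (\<exists>B::'e set. finite B \<and> span B = UNIV) \<and>
     Hausdorff_space T \<and>
     (\<exists>\<B>. countable \<B> \<and> (\<forall>U\<in>\<B>. openin T U) \<and>
        (\<forall>U. openin T U \<longrightarrow> (\<exists>\<U>. \<U> \<subseteq> \<B> \<and> U = \<Union>\<U>))) \<and>
     topspace T = carrier A \<and>
     (\<forall>c\<in>A. openin T (fst c) \<and> open (chart_image c) \<and>
        homeomorphic_map (subtopology T (fst c)) (top_of_set (chart_image c)) (snd c)) \<and>
     (\<forall>c\<in>A. \<forall>d\<in>A. smooth_on (snd c ` (fst c \<inter> fst d)) (snd d \<circ> chart_inv c))"

text \<open>Some chart around a point; used only where the result does not depend on the choice.\<close>

definition chart_at :: "('a, 'e) chart set \<Rightarrow> 'a \<Rightarrow> ('a, 'e) chart" where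
  "chart_at A p = (SOME c. c \<in> A \<and> p \<in> fst c)"

section \<open>Tangent and cotangent bundle\<close>

text \<open>A tangent vector at \<open>p\<close> is the family of its coordinate vectors with respect to all charts
  around \<open>p\<close>; these transform by the derivatives of the chart changes.  Entries at all other
  indices are set to 0.\<close>

type_synonym ('a, 'e) tvec = "('a, 'e) chart \<Rightarrow> 'e"
type_synonym ('a, 'e) cotvec = "('a, 'e) tvec \<Rightarrow> real"

definition tangent_space ::
    "('a, 'e::real_normed_vector) chart set \<Rightarrow> 'a \<Rightarrow> ('a, 'e) tvec set" where
  "tangent_space A p = {v.
     (\<forall>c\<in>A. \<forall>d\<in>A. p \<in> fst c \<and> p \<in> fst d \<longrightarrow>
        v d = frechet_derivative (snd d \<circ> chart_inv c) (at (snd c p)) (v c)) \<and>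
     (\<forall>c. \<not> (c \<in> A \<and> p \<in> fst c) \<longrightarrow> v c = 0)}"

definition cotangent_space ::
    "('a, 'e::real_normed_vector) chart set \<Rightarrow> 'a \<Rightarrow> ('a, 'e) cotvec set" where
  "cotangent_space A p = {\<alpha>.
     linear_between (tangent_space A p) UNIV \<alpha> \<and> (\<forall>v. v \<notin> tangent_space A p \<longrightarrow> \<alpha> v = 0)}"

text \<open>The tangent vector at \<open>p\<close> with coordinates \<open>e\<close> in the chart \<open>c\<close>, that is
  \<open>\<Sum>i. e\<^sub>i \<partial>/\<partial>x\<^sub>i\<close>, and the covector \<open>\<Sum>i. a\<^sub>i dx\<^sub>i\<close>.\<close>

definition coord_vec ::
    "('a, 'e::real_normed_vector) chart set \<Rightarrow> ('a, 'e) chart \<Rightarrow> 'a \<Rightarrow> 'e \<Rightarrow> ('a, 'e) tvec" where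
  "coord_vec A c p e = (\<lambda>d.
     if d \<in> A \<and> p \<in> fst d then frechet_derivative (snd d \<circ> chart_inv c) (at (snd c p)) e else 0)"

definition coord_covec ::
    "('a, 'e::real_normed_vector) chart set \<Rightarrow> ('a, 'e) chart \<Rightarrow> 'a \<Rightarrow> ('e \<Rightarrow>\<^sub>L real)
      \<Rightarrow> ('a, 'e) cotvec" where
  "coord_covec A c p a = (\<lambda>v. if v \<in> tangent_space A p then blinfun_apply a (v c) else 0)"

text \<open>Points of \<open>TM\<close> and \<open>T\<^sup>*M\<close> are pairs of a base point and a (co)vector.  The bundles are given by
  the atlases induced from \<open>M\<close>, so the constructions can be iterated.\<close>

definition tangent_chart ::
    "('a, 'e::real_normed_vector) chart set \<Rightarrow> ('a, 'e) chart
      \<Rightarrow> ('a \<times> ('a, 'e) tvec, 'e \<times> 'e) chart" where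
  "tangent_chart A c =
     ({(p, v). p \<in> fst c \<and> v \<in> tangent_space A p}, \<lambda>(p, v). (snd c p, v c))"

definition tangent_atlas ::
    "('a, 'e::real_normed_vector) chart set \<Rightarrow> ('a \<times> ('a, 'e) tvec, 'e \<times> 'e) chart set" where
  "tangent_atlas A = tangent_chart A ` A"

definition cotangent_chart ::
    "('a, 'e::real_normed_vector) chart set \<Rightarrow> ('a, 'e) chart
      \<Rightarrow> ('a \<times> ('a, 'e) cotvec, 'e \<times> ('e \<Rightarrow>\<^sub>L real)) chart" where
  "cotangent_chart A c =
     ({(p, \<alpha>). p \<in> fst c \<and> \<alpha> \<in> cotangent_space A p},
      \<lambda>(p, \<alpha>). (snd c p, Blinfun (\<lambda>e. \<alpha> (coord_vec A c p e))))"

definition cotangent_atlas ::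
    "('a, 'e::real_normed_vector) chart set
      \<Rightarrow> ('a \<times> ('a, 'e) cotvec, 'e \<times> ('e \<Rightarrow>\<^sub>L real)) chart set" where
  "cotangent_atlas A = cotangent_chart A ` A"

definition tangent_map ::
    "('a, 'e::real_normed_vector) chart set \<Rightarrow> ('b, 'f::real_normed_vector) chart set
      \<Rightarrow> ('a \<Rightarrow> 'b) \<Rightarrow> 'a \<times> ('a, 'e) tvec \<Rightarrow> 'b \<times> ('b, 'f) tvec" where
  "tangent_map A B f = (\<lambda>(p, v).
     let c = chart_at A p in
     (f p, \<lambda>d. if d \<in> B \<and> f p \<in> fst d
               then frechet_derivative (snd d \<circ> f \<circ> chart_inv c) (at (snd c p)) (v c) else 0))"

section \<open>Tensor fields\<close>

text \<open>Smoothness of tensor fields is smoothness of their components in every chart of the atlas.\<close>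

definition vector_field ::
    "('a, 'e::real_normed_vector) chart set \<Rightarrow> ('a \<Rightarrow> ('a, 'e) tvec) \<Rightarrow> bool" where
  "vector_field A X \<longleftrightarrow>
     (\<forall>p\<in>carrier A. X p \<in> tangent_space A p) \<and>
     (\<forall>c\<in>A. smooth_on (chart_image c) (\<lambda>x. X (chart_inv c x) c))"

definition one_form ::
    "('a, 'e::real_normed_vector) chart set \<Rightarrow> ('a \<Rightarrow> ('a, 'e) cotvec) \<Rightarrow> bool" where
  "one_form A \<alpha> \<longleftrightarrow>
     (\<forall>p\<in>carrier A. \<alpha> p \<in> cotangent_space A p) \<and>
     (\<forall>c\<in>A. \<forall>e. smooth_on (chart_image c)
        (\<lambda>x. \<alpha> (chart_inv c x) (coord_vec A c (chart_inv c x) e)))"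

text \<open>A bivector at \<open>p\<close> is a skew-symmetric bilinear form on the cotangent space.\<close>

definition bivector_field ::
    "('a, 'e::real_normed_vector) chart set
      \<Rightarrow> ('a \<Rightarrow> ('a, 'e) cotvec \<Rightarrow> ('a, 'e) cotvec \<Rightarrow> real) \<Rightarrow> bool" where
  "bivector_field A \<pi> \<longleftrightarrow>
     (\<forall>p\<in>carrier A. \<forall>\<alpha>\<in>cotangent_space A p.
        linear_between (cotangent_space A p) UNIV (\<pi> p \<alpha>) \<and>
        (\<forall>\<beta>\<in>cotangent_space A p. \<pi> p \<alpha> \<beta> = - \<pi> p \<beta> \<alpha>)) \<and>
     (\<forall>c\<in>A. \<forall>a b. smooth_on (chart_image c)
        (\<lambda>x. \<pi> (chart_inv c x) (coord_covec A c (chart_inv c x) a)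
                               (coord_covec A c (chart_inv c x) b)))"

definition tensor_field_1_1 ::
    "('a, 'e::real_normed_vector) chart set \<Rightarrow> ('a \<Rightarrow> ('a, 'e) tvec \<Rightarrow> ('a, 'e) tvec) \<Rightarrow> bool" where
  "tensor_field_1_1 A r \<longleftrightarrow>
     (\<forall>p\<in>carrier A. linear_between (tangent_space A p) (tangent_space A p) (r p)) \<and>
     (\<forall>c\<in>A. \<forall>e. smooth_on (chart_image c)
        (\<lambda>x. r (chart_inv c x) (coord_vec A c (chart_inv c x) e) c))"

text \<open>The contraction of \<open>\<alpha>\<close> with \<open>\<pi>\<close>, i.e. the vector \<open>v\<close> with \<open>\<langle>\<beta>, v\<rangle> = \<pi>(\<alpha>, \<beta>)\<close>.\<close>

definition sharp ::
    "('a, 'e::real_normed_vector) chart set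
      \<Rightarrow> ('a \<Rightarrow> ('a, 'e) cotvec \<Rightarrow> ('a, 'e) cotvec \<Rightarrow> real)
      \<Rightarrow> 'a \<Rightarrow> ('a, 'e) cotvec \<Rightarrow> ('a, 'e) tvec" where
  "sharp A \<pi> p \<alpha> =
     (THE v. v \<in> tangent_space A p \<and> (\<forall>\<beta>\<in>cotangent_space A p. \<beta> v = \<pi> p \<alpha> \<beta>))"

definition dual ::
    "('a, 'e::real_normed_vector) chart set \<Rightarrow> ('a \<Rightarrow> ('a, 'e) tvec \<Rightarrow> ('a, 'e) tvec)
      \<Rightarrow> 'a \<Rightarrow> ('a, 'e) cotvec \<Rightarrow> ('a, 'e) cotvec" where
  "dual A r p \<alpha> = (\<lambda>v. if v \<in> tangent_space A p then \<alpha> (r p v) else 0)"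

text \<open>A field of maps between fibres, as a map between the total spaces over the identity.\<close>

definition bundle_map :: "('a \<Rightarrow> 'v \<Rightarrow> 'w) \<Rightarrow> 'a \<times> 'v \<Rightarrow> 'a \<times> 'w" where
  "bundle_map F = (\<lambda>(p, v). (p, F p v))"

section \<open>Exterior and Lie derivatives\<close>

definition differential ::
    "('a, 'e::real_normed_vector) chart set \<Rightarrow> ('a \<Rightarrow> real) \<Rightarrow> 'a \<Rightarrow> ('a, 'e) cotvec" where
  "differential A f p = (\<lambda>v.
     let c = chart_at A p in
     if v \<in> tangent_space A p
     then frechet_derivative (f \<circ> chart_inv c) (at (snd c p)) (v c) else 0)"

text \<open>\<open>(d\<omega>)(u, v) = \<Sum>i j. (\<partial>\<^sub>i \<omega>\<^sub>j - \<partial>\<^sub>j \<omega>\<^sub>i) u\<^sub>i v\<^sub>j\<close> in coordinates; \<open>w e\<close> is the component of \<open>\<omega>\<close> in the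
  constant direction \<open>e\<close>.\<close>

definition ext_deriv ::
    "('a, 'e::real_normed_vector) chart set \<Rightarrow> ('a \<Rightarrow> ('a, 'e) cotvec)
      \<Rightarrow> 'a \<Rightarrow> ('a, 'e) tvec \<Rightarrow> ('a, 'e) tvec \<Rightarrow> real" where
  "ext_deriv A \<omega> p u v =
     (let c = chart_at A p;
          w = (\<lambda>e x. \<omega> (chart_inv c x) (coord_vec A c (chart_inv c x) e))
      in frechet_derivative (w (v c)) (at (snd c p)) (u c)
         - frechet_derivative (w (u c)) (at (snd c p)) (v c))"

text \<open>\<open>[X, Y]\<^sub>j = \<Sum>i. X\<^sub>i \<partial>\<^sub>i Y\<^sub>j - Y\<^sub>i \<partial>\<^sub>i X\<^sub>j\<close> in every chart \<open>c\<close> around \<open>p\<close>.\<close>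

definition lie_bracket ::
    "('a, 'e::real_normed_vector) chart set \<Rightarrow> ('a \<Rightarrow> ('a, 'e) tvec) \<Rightarrow> ('a \<Rightarrow> ('a, 'e) tvec)
      \<Rightarrow> 'a \<Rightarrow> ('a, 'e) tvec" where
  "lie_bracket A X Y p = (\<lambda>c.
     if c \<in> A \<and> p \<in> fst c
     then frechet_derivative (\<lambda>x. Y (chart_inv c x) c) (at (snd c p)) (X p c)
          - frechet_derivative (\<lambda>x. X (chart_inv c x) c) (at (snd c p)) (Y p c)
     else 0)"

text \<open>Cartan's formula \<open>\<L>\<^sub>X \<alpha> = i\<^sub>X d\<alpha> + d i\<^sub>X \<alpha>\<close>.\<close>

definition lie_deriv_form ::
    "('a, 'e::real_normed_vector) chart set \<Rightarrow> ('a \<Rightarrow> ('a, 'e) tvec) \<Rightarrow> ('a \<Rightarrow> ('a, 'e) cotvec)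
      \<Rightarrow> 'a \<Rightarrow> ('a, 'e) cotvec" where
  "lie_deriv_form A X \<alpha> p = (\<lambda>v.
     if v \<in> tangent_space A p
     then ext_deriv A \<alpha> p (X p) v + differential A (\<lambda>q. \<alpha> q (X q)) p v else 0)"

text \<open>\<open>(\<L>\<^sub>Y r)(X) = [Y, r(X)] - r([Y, X])\<close>.\<close>

definition lie_deriv_endo ::
    "('a, 'e::real_normed_vector) chart set \<Rightarrow> ('a \<Rightarrow> ('a, 'e) tvec)
      \<Rightarrow> ('a \<Rightarrow> ('a, 'e) tvec \<Rightarrow> ('a, 'e) tvec) \<Rightarrow> ('a \<Rightarrow> ('a, 'e) tvec)
      \<Rightarrow> 'a \<Rightarrow> ('a, 'e) tvec" where
  "lie_deriv_endo A Y r X p =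
     lie_bracket A Y (\<lambda>q. r q (X q)) p - r p (lie_bracket A Y X p)"

definition compatible ::
    "('a, 'e::real_normed_vector) chart set
      \<Rightarrow> ('a \<Rightarrow> ('a, 'e) cotvec \<Rightarrow> ('a, 'e) cotvec \<Rightarrow> real)
      \<Rightarrow> ('a \<Rightarrow> ('a, 'e) tvec \<Rightarrow> ('a, 'e) tvec) \<Rightarrow> bool" where
  "compatible A \<pi> r \<longleftrightarrow>
     (\<forall>p\<in>carrier A. \<forall>\<alpha>\<in>cotangent_space A p.
        sharp A \<pi> p (dual A r p \<alpha>) = r p (sharp A \<pi> p \<alpha>)) \<and>
     (\<forall>X \<alpha>. vector_field A X \<longrightarrow> one_form A \<alpha> \<longrightarrow>
        (\<forall>p\<in>carrier A.
           sharp A \<pi> p (lie_deriv_form A X (\<lambda>q. dual A r q (\<alpha> q)) p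
                        - lie_deriv_form A (\<lambda>q. r q (X q)) \<alpha> p)
           - lie_deriv_endo A (\<lambda>q. sharp A \<pi> q (\<alpha> q)) r X p = 0))"

section \<open>Tangent and cotangent lifts\<close>

text \<open>The canonical involution: \<open>(x, v, x', v') \<mapsto> (x, x', v, v')\<close> in the coordinates of \<open>T(TM)\<close> induced
  by a chart of \<open>M\<close>.\<close>

definition canonical_involution ::
    "('a, 'e::real_normed_vector) chart set
      \<Rightarrow> ('a \<times> ('a, 'e) tvec) \<times> ('a \<times> ('a, 'e) tvec, 'e \<times> 'e) tvec
      \<Rightarrow> ('a \<times> ('a, 'e) tvec) \<times> ('a \<times> ('a, 'e) tvec, 'e \<times> 'e) tvec" where
  "canonical_involution A z =
     (let C = tangent_chart (tangent_atlas A) (tangent_chart A (chart_at A (fst (fst z))));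
          ((x, v), (x', v')) = snd C z
      in chart_inv C ((x, x'), (v, v')))"

definition tangent_lift ::
    "('a, 'e::real_normed_vector) chart set \<Rightarrow> ('a \<Rightarrow> ('a, 'e) tvec \<Rightarrow> ('a, 'e) tvec)
      \<Rightarrow> ('a \<times> ('a, 'e) tvec) \<times> ('a \<times> ('a, 'e) tvec, 'e \<times> 'e) tvec
      \<Rightarrow> ('a \<times> ('a, 'e) tvec) \<times> ('a \<times> ('a, 'e) tvec, 'e \<times> 'e) tvec" where
  "tangent_lift A r =
     canonical_involution A \<circ> tangent_map (tangent_atlas A) (tangent_atlas A) (bundle_map r)
       \<circ> canonical_involution A"

text \<open>The tautological 1-form \<open>\<theta>\<^sub>(\<^sub>p\<^sub>,\<^sub>\<alpha>\<^sub>)(w) = \<alpha>(T\<tau> w)\<close>, where \<open>\<tau> = fst\<close> is the projection of \<open>T\<^sup>*M\<close>, and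
  the canonical symplectic form \<open>\<omega> = - d\<theta> = \<Sum>i. dq\<^sub>i \<and> dp\<^sub>i\<close>.\<close>

definition tautological_form ::
    "('a, 'e::real_normed_vector) chart set
      \<Rightarrow> 'a \<times> ('a, 'e) cotvec \<Rightarrow> ('a \<times> ('a, 'e) cotvec, 'e \<times> ('e \<Rightarrow>\<^sub>L real)) cotvec" where
  "tautological_form A z = (\<lambda>w.
     if w \<in> tangent_space (cotangent_atlas A) z
     then snd z (snd (tangent_map (cotangent_atlas A) A fst (z, w))) else 0)"

definition canonical_symplectic ::
    "('a, 'e::real_normed_vector) chart set \<Rightarrow> 'a \<times> ('a, 'e) cotvec
      \<Rightarrow> ('a \<times> ('a, 'e) cotvec, 'e \<times> ('e \<Rightarrow>\<^sub>L real)) tvec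
      \<Rightarrow> ('a \<times> ('a, 'e) cotvec, 'e \<times> ('e \<Rightarrow>\<^sub>L real)) tvec \<Rightarrow> real" where
  "canonical_symplectic A z u v = - ext_deriv (cotangent_atlas A) (tautological_form A) z u v"

definition pullback_2form ::
    "('a, 'e::real_normed_vector) chart set \<Rightarrow> ('b, 'f::real_normed_vector) chart set \<Rightarrow> ('a \<Rightarrow> 'b)
      \<Rightarrow> ('b \<Rightarrow> ('b, 'f) tvec \<Rightarrow> ('b, 'f) tvec \<Rightarrow> real)
      \<Rightarrow> 'a \<Rightarrow> ('a, 'e) tvec \<Rightarrow> ('a, 'e) tvec \<Rightarrow> real" where
  "pullback_2form A B f \<omega> p u v =
     \<omega> (f p) (snd (tangent_map A B f (p, u))) (snd (tangent_map A B f (p, v)))"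

definition cotangent_lift ::
    "('a, 'e::real_normed_vector) chart set \<Rightarrow> ('a \<Rightarrow> ('a, 'e) tvec \<Rightarrow> ('a, 'e) tvec)
      \<Rightarrow> ('a \<times> ('a, 'e) cotvec) \<times> ('a \<times> ('a, 'e) cotvec, 'e \<times> ('e \<Rightarrow>\<^sub>L real)) tvec
      \<Rightarrow> ('a \<times> ('a, 'e) cotvec) \<times> ('a \<times> ('a, 'e) cotvec, 'e \<times> ('e \<Rightarrow>\<^sub>L real)) tvec" where
  "cotangent_lift A r = (\<lambda>(z, u).
     (z, THE w. w \<in> tangent_space (cotangent_atlas A) z \<and>
           (\<forall>v\<in>tangent_space (cotangent_atlas A) z.
              canonical_symplectic A z w v =
              pullback_2form (cotangent_atlas A) (cotangent_atlas A) (bundle_map (dual A r))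
                (canonical_symplectic A) z u v)))"

end

(*
  In a chart, a point of T(T*M) over (x, a) is a pair (h, k) of a vector and a covector.  Write P and R
  for the coordinate expressions of the maps induced by pi and r, and DP, DR for their derivatives in x.
  Then the cotangent lift sends (h, k) to (R h, b) with
  b(e) = a(DR e h) - a(DR h e) + k(R e), where DR e h is the derivative of x |-> R_x e along h, the
  tangent lift at (x, v) sends (h, k) to (R h, DR h v + R k), and the tangent map of the sharp map sends
  (h, k) to (h, DP a h + P k).  So the two compositions agree if and only if
    DP a (R h) + P b = DR h (P a) + R (DP a h + P k)   for all a, h, k.
  For h = 0 this is the first compatibility condition P R* = R P, and the rest is an identity in (a, h).
  Given P R* = R P, the derivatives of X and alpha drop out of the second compatibility condition, which
  becomes the same identity at h = X(x), a = alpha(x); bump functions realise all a and h.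
*)

theory Submission
  imports Defs "HOL-Real_Asymp.Real_Asymp"
begin

text \<open>Several definitions compute in \<open>chart_at\<close>, an unspecified chart. Tangent
  maps between bundles choose a chart of the bundle, which need not be induced by
  \<open>chart_at A p\<close>; the chain rule removes this choice. For
  \<open>canonical_symplectic\<close> more is needed: the two sides of the equation defining the
  cotangent lift evaluate it at different points of the same fibre, possibly in different charts.
  Its coordinate formula is therefore proved in every chart, and there symmetry of second
  derivatives enters. It enters again for the Lie bracket, which must be a tangent vector before
  \<open>r\<close> can be evaluated on it in coordinates.

  The comparison of charts works with two derivatives of the transition maps, and passing to a
  bundle costs one of them; hence the two atlas locales below. Full smoothness enters when fields
  with prescribed value at a point are constructed. There the Hausdorff property makes the support
  of a bump function closed, so that extension by 0 is smooth in every other chart.\<close>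

section \<open>Finite frames\<close>

text \<open>Substitute for \<open>Basis\<close>: the model space is only known to be a \<open>real_inner\<close> space with a finite
  spanning set, and its dual is not an inner product space.\<close>

definition finite_frame ::
    "'i set \<Rightarrow> ('i \<Rightarrow> 'v::real_normed_vector \<Rightarrow> real) \<Rightarrow> ('i \<Rightarrow> 'v) \<Rightarrow> bool" where
  "finite_frame I \<phi> b \<longleftrightarrow>
     finite I \<and> (\<forall>i\<in>I. bounded_linear (\<phi> i)) \<and> (\<forall>v. (\<Sum>i\<in>I. \<phi> i v *\<^sub>R b i) = v)"

lemma finite_frameD:
  assumes "finite_frame I \<phi> b"
  shows "finite I" "\<And>i. i \<in> I \<Longrightarrow> bounded_linear (\<phi> i)" "(\<Sum>i\<in>I. \<phi> i v *\<^sub>R b i) = v"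
  using assms by (auto simp: finite_frame_def)

text \<open>\<open>basis_orthogonal\<close> yields a finite orthogonal spanning set that may contain
  0; dropping 0 and normalising makes it orthonormal. In dimension 0 the frame is empty and the
  empty sum is the expansion.\<close>

lemma finite_frame_exists:
  fixes B :: "'e::real_inner set"
  assumes "finite B" "span B = UNIV"
  obtains E :: "'e set" where "finite_frame E (\<lambda>b v. v \<bullet> b) (\<lambda>b. b)"
proof -
  obtain C where C: "finite C" "span C = span B" "pairwise orthogonal C"
    using basis_orthogonal[OF assms(1)] by blast
  define E where "E = (\<lambda>b. b /\<^sub>R norm b) ` (C - {0})"
  \<comment> \<open>Allows sums over \<open>E\<close> to be reindexed by \<open>C - {0}\<close>:
    vectors with the same normalisation have nonzero inner product, so orthogonality forces them to
    be equal.\<close>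
  have inj: "inj_on (\<lambda>b. b /\<^sub>R norm b) (C - {0})"
  proof (rule inj_onI)
    fix x y assume xy: "x \<in> C - {0}" "y \<in> C - {0}" "x /\<^sub>R norm x = y /\<^sub>R norm y"
    have "(x /\<^sub>R norm x) \<bullet> (y /\<^sub>R norm y) = (x /\<^sub>R norm x) \<bullet> (x /\<^sub>R norm x)"
      using xy by simp
    also have "\<dots> \<noteq> 0" using xy by simp
    finally have "x \<bullet> y \<noteq> 0" by auto
    then show "x = y" using C(3) xy by (auto simp: pairwise_def orthogonal_def)
  qed
  have exp: "(\<Sum>b\<in>E. (v \<bullet> b) *\<^sub>R b) = v" if "v \<in> span C" for v
    using that
  proof (induction rule: span_induct_alt)
    case base
    show ?case by simp
  next
    case (step a x y)
    have "(\<Sum>b\<in>E. (x \<bullet> b) *\<^sub>R b) = x"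
    proof (cases "x = 0")
      case False
      have "(\<Sum>b\<in>E. (x \<bullet> b) *\<^sub>R b)
        = (\<Sum>c\<in>C - {0}. (x \<bullet> (c /\<^sub>R norm c)) *\<^sub>R (c /\<^sub>R norm c))"
        unfolding E_def by (subst sum.reindex[OF inj]) simp
      also have "\<dots> = (\<Sum>c\<in>{x}. (x \<bullet> (c /\<^sub>R norm c)) *\<^sub>R (c /\<^sub>R norm c))"
        using C step(1) False
        by (intro sum.mono_neutral_right) (auto simp: pairwise_def orthogonal_def)
      also have "\<dots> = x"
        using False by (simp add: dot_square_norm power2_eq_square field_simps)
      finally show ?thesis .
    qed simp
    with step(2) show ?case
      by (simp add: inner_add_left scaleR_add_left sum.distrib flip: scaleR_scaleR scaleR_sum_right)
  qed
  have "finite_frame E (\<lambda>b v. v \<bullet> b) (\<lambda>b. b)"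
    unfolding finite_frame_def
    using C exp assms(2) by (auto simp: E_def bounded_linear_inner_left)
  then show thesis by (rule that)
qed

text \<open>The frame writes \<open>f\<close> as a finite sum of bounded functionals times constant
  vectors, so linearity alone gives continuity.\<close>

lemma finite_frame_bounded_linear:
  fixes f :: "'v::real_normed_vector \<Rightarrow> 'w::real_normed_vector"
  assumes "finite_frame I \<phi> (b :: 'i \<Rightarrow> 'v)" "linear f"
  shows "bounded_linear f"
proof -
  have "f = (\<lambda>v. \<Sum>i\<in>I. \<phi> i v *\<^sub>R f (b i))"
  proof
    fix v
    have "f v = f (\<Sum>i\<in>I. \<phi> i v *\<^sub>R b i)" using finite_frameD(3)[OF assms(1)] by simp
    then show "f v = (\<Sum>i\<in>I. \<phi> i v *\<^sub>R f (b i))"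
      by (simp add: linear_sum[OF assms(2)] linear_scale[OF assms(2)])
  qed
  moreover have "bounded_linear (\<lambda>v. \<Sum>i\<in>I. \<phi> i v *\<^sub>R f (b i))"
    using finite_frameD(2)[OF assms(1)]
    by (intro bounded_linear_sum bounded_linear_scaleR_const)
  ultimately show ?thesis by simp
qed

text \<open>The dual frame: the coordinates of a covector are its values on the orthonormal set
  \<open>E\<close>. It provides frames for the fibres of the cotangent bundle.\<close>

lemma finite_frame_blinfun:
  assumes "finite_frame E (\<lambda>b v. v \<bullet> b) (\<lambda>b. b :: 'e::real_inner)"
  shows "finite_frame E (\<lambda>b (a :: 'e \<Rightarrow>\<^sub>L real). blinfun_apply a b) blinfun_inner_left"
  unfolding finite_frame_def
proof (intro conjI ballI allI)
  show "finite E" using assms by (rule finite_frameD)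
  show "bounded_linear (\<lambda>a :: 'e \<Rightarrow>\<^sub>L real. blinfun_apply a b)" for b
    by (rule bounded_linear_intros) (rule bounded_linear_ident)
  fix a :: "'e \<Rightarrow>\<^sub>L real"
  show "(\<Sum>b\<in>E. blinfun_apply a b *\<^sub>R blinfun_inner_left b) = a"
  proof (rule blinfun_eqI)
    fix v
    have "blinfun_apply a v = blinfun_apply a (\<Sum>b\<in>E. (v \<bullet> b) *\<^sub>R b)"
      using finite_frameD(3)[OF assms] by simp
    also have "\<dots> = (\<Sum>b\<in>E. (v \<bullet> b) * blinfun_apply a b)"
      by (simp add: blinfun.sum_right blinfun.scaleR_right)
    finally show "blinfun_apply (\<Sum>b\<in>E. blinfun_apply a b *\<^sub>R blinfun_inner_left b) v
        = blinfun_apply a v"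
      by (simp add: blinfun.sum_left blinfun.scaleR_left inner_commute mult.commute)
  qed
qed

text \<open>Product rule for a family of linear maps that is only known to be differentiable for
  each fixed vector, which is how the smoothness of tensor fields is stated. Expanding the vector in
  the frame turns the expression into a finite sum of products of differentiable functions. It
  serves for Jacobians, bundle maps and tensor fields applied to sections.\<close>

lemma has_derivative_fibrewise_linear:
  fixes F :: "'x::real_normed_vector \<Rightarrow> 'v::real_normed_vector \<Rightarrow> 'w::real_normed_vector"
    and f :: "'y::real_normed_vector \<Rightarrow> 'x"
  assumes fr: "finite_frame I \<phi> (b :: 'i \<Rightarrow> 'v)"
    and S: "open S" "f y \<in> S"
    and lin: "\<And>x. x \<in> S \<Longrightarrow> linear (F x)"
    and D: "\<And>v. (\<lambda>x. F x v) differentiable (at (f y))"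
    and f: "(f has_derivative f') (at y)"
    and g: "(g has_derivative g') (at y)"
  shows "((\<lambda>y. F (f y) (g y)) has_derivative
     (\<lambda>k. frechet_derivative (\<lambda>x. F x (g y)) (at (f y)) (f' k) + F (f y) (g' k))) (at y)"
proof -
  have expand: "F x v = (\<Sum>i\<in>I. \<phi> i v *\<^sub>R F x (b i))" if "x \<in> S" for x v
  proof -
    have "F x v = F x (\<Sum>i\<in>I. \<phi> i v *\<^sub>R b i)" using finite_frameD(3)[OF fr] by simp
    then show ?thesis by (simp add: linear_sum[OF lin[OF that]] linear_scale[OF lin[OF that]])
  qed
  have Dv: "((\<lambda>x. F x v) has_derivative frechet_derivative (\<lambda>x. F x v) (at (f y))) (at (f y))"
    for v using D frechet_derivative_works by blast
  \<comment> \<open>The derivative in the base point expands with the same coefficients, so the sum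
    obtained from the product rule can be folded back into one derivative with the vector frozen at
    \<open>g y\<close>.\<close>
  have expandD: "frechet_derivative (\<lambda>x. F x v) (at (f y))
     = (\<lambda>h. \<Sum>i\<in>I. \<phi> i v *\<^sub>R frechet_derivative (\<lambda>x. F x (b i)) (at (f y)) h)" for v
  proof (rule frechet_derivative_at[symmetric])
    have "((\<lambda>x. \<Sum>i\<in>I. \<phi> i v *\<^sub>R F x (b i)) has_derivative
       (\<lambda>h. \<Sum>i\<in>I. \<phi> i v *\<^sub>R frechet_derivative (\<lambda>x. F x (b i)) (at (f y)) h)) (at (f y))"
      by (intro has_derivative_sum has_derivative_scaleR_right Dv)
    then show "((\<lambda>x. F x v) has_derivative
       (\<lambda>h. \<Sum>i\<in>I. \<phi> i v *\<^sub>R frechet_derivative (\<lambda>x. F x (b i)) (at (f y)) h)) (at (f y))"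
      by (rule has_derivative_transform_within_open[OF _ S]) (simp add: expand[symmetric])
  qed
  have F: "((\<lambda>y. F (f y) v) has_derivative
      (\<lambda>k. frechet_derivative (\<lambda>x. F x v) (at (f y)) (f' k))) (at y)" for v
    using has_derivative_compose[OF f Dv] .
  have ph: "((\<lambda>y. \<phi> i (g y)) has_derivative (\<lambda>k. \<phi> i (g' k))) (at y)" if "i \<in> I" for i
    using bounded_linear.has_derivative[OF finite_frameD(2)[OF fr that] g] .
  have main: "((\<lambda>y. \<Sum>i\<in>I. \<phi> i (g y) *\<^sub>R F (f y) (b i)) has_derivative
     (\<lambda>k. \<Sum>i\<in>I. \<phi> i (g y) *\<^sub>R frechet_derivative (\<lambda>x. F x (b i)) (at (f y)) (f' k)
        + \<phi> i (g' k) *\<^sub>R F (f y) (b i))) (at y)"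
    by (intro has_derivative_sum has_derivative_scaleR ph F)
  \<comment> \<open>The expansion is available only over \<open>S\<close>, where \<open>F x\<close>
    is linear; continuity of \<open>f\<close> at \<open>y\<close> keeps nearby base points
    there.\<close>
  have "eventually (\<lambda>z. f z \<in> S) (nhds y)"
    using has_derivative_continuous[OF f] S
    by (simp add: continuous_within topological_tendstoD at_within_open_NO_MATCH
      eventually_nhds_conv_at)
  then obtain N where N: "open N" "y \<in> N" "\<And>z. z \<in> N \<Longrightarrow> f z \<in> S"
    by (auto simp: eventually_nhds)
  have "((\<lambda>y. F (f y) (g y)) has_derivative
     (\<lambda>k. \<Sum>i\<in>I. \<phi> i (g y) *\<^sub>R frechet_derivative (\<lambda>x. F x (b i)) (at (f y)) (f' k)
        + \<phi> i (g' k) *\<^sub>R F (f y) (b i))) (at y)"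
    using main by (rule has_derivative_transform_within_open[OF _ N(1,2)])
      (simp add: N(3) expand[symmetric])
  moreover have "frechet_derivative (\<lambda>x. F x (g y)) (at (f y)) (f' k) + F (f y) (g' k)
     = (\<Sum>i\<in>I. \<phi> i (g y) *\<^sub>R frechet_derivative (\<lambda>x. F x (b i)) (at (f y)) (f' k)
        + \<phi> i (g' k) *\<^sub>R F (f y) (b i))" for k
    by (subst expandD) (simp add: expand[OF S(2), of "g' k"] sum.distrib)
  ultimately show ?thesis by simp
qed

text \<open>A covector depends linearly on its finitely many values on the frame, so pointwise
  derivatives assemble to a derivative in the operator norm. The map \<open>G'\<close> is built from
  the frame directions alone; for other \<open>e\<close>, uniqueness of derivatives identifies its
  value.\<close>

lemma has_derivative_blinfunI:
  fixes G :: "'x::real_normed_vector \<Rightarrow> 'e::real_inner \<Rightarrow>\<^sub>L real"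
  assumes fr: "finite_frame E (\<lambda>b v. v \<bullet> b) (\<lambda>b. b :: 'e)"
    and G: "\<And>e. ((\<lambda>x. blinfun_apply (G x) e) has_derivative D e) (at x)"
  obtains G' where "(G has_derivative G') (at x)" "\<And>h e. blinfun_apply (G' h) e = D e h"
proof -
  note fb = finite_frameD(3)[OF finite_frame_blinfun[OF fr]]
  define G' where "G' = (\<lambda>h. \<Sum>b\<in>E. D b h *\<^sub>R blinfun_inner_left b)"
  have "((\<lambda>x. \<Sum>b\<in>E. blinfun_apply (G x) b *\<^sub>R blinfun_inner_left b) has_derivative G') (at x)"
    unfolding G'_def by (intro has_derivative_sum has_derivative_scaleR_left G)
  then have GG: "(G has_derivative G') (at x)" by (simp add: fb)
  moreover have "blinfun_apply (G' h) e = D e h" for h e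
  proof -
    have "((\<lambda>x. blinfun_apply (G x) e) has_derivative (\<lambda>h. blinfun_apply (G' h) e)) (at x)"
      by (rule bounded_linear.has_derivative[OF _ GG])
        (rule bounded_linear_intros, rule bounded_linear_ident)
    from has_derivative_unique[OF this G] show ?thesis by (rule fun_cong)
  qed
  ultimately show thesis by (rule that)
qed

section \<open>Symmetry of second derivatives\<close>

text \<open>The mean value theorem in the direction \<open>u\<close> turns the second difference
  into \<open>t\<close> times the increment of the first derivative along
  \<open>t *\<^sub>R v\<close>; differentiability of that derivative at \<open>x\<close> then gives
  \<open>t * L v\<close> up to a small error.\<close>

lemma second_difference_tendsto:
  fixes f :: "'e::real_normed_vector \<Rightarrow> real"
  assumes S: "open S" "x \<in> S"
    and f: "\<And>y. y \<in> S \<Longrightarrow> f differentiable (at y)"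
    and L: "((\<lambda>y. frechet_derivative f (at y) u) has_derivative L) (at x)"
  shows "((\<lambda>t. (f (x + t *\<^sub>R u + t *\<^sub>R v) - f (x + t *\<^sub>R u) - f (x + t *\<^sub>R v) + f x) / t\<^sup>2)
     \<longlongrightarrow> L v) (at_right 0)"
proof (rule tendstoI)
  fix \<epsilon> :: real assume "\<epsilon> > 0"
  \<comment> \<open>The displacements \<open>s *\<^sub>R u + t *\<^sub>R v\<close> and
    \<open>s *\<^sub>R u\<close> together have norm at most \<open>t * K\<close> for
    \<open>0 \<le> s \<le> t\<close>; the summand 1 makes \<open>K\<close> positive. The errors then
    add up to at most \<open>\<eta> * K\<close>, half of \<open>\<epsilon>\<close>.\<close>
  define K where "K = 2 * norm u + norm v + 1"
  have K: "K > 0" by (simp add: K_def add_nonneg_pos)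
  define \<eta> where "\<eta> = \<epsilon> / (2 * K)"
  have \<eta>: "\<eta> > 0" using K \<open>\<epsilon> > 0\<close> by (simp add: \<eta>_def)
  interpret L: bounded_linear L using L by (rule has_derivative_bounded_linear)
  let ?F = "\<lambda>y. frechet_derivative f (at y) u"
  obtain d where d: "d > 0"
    and dL: "\<And>y. norm (y - x) < d \<Longrightarrow> \<bar>?F y - ?F x - L (y - x)\<bar> \<le> \<eta> * norm (y - x)"
    using L \<eta> unfolding has_derivative_at_alt by (metis real_norm_def)
  obtain d' where d': "d' > 0" "ball x d' \<subseteq> S" using S openE by blast
  \<comment> \<open>For \<open>t < e\<close> both displacements stay inside the ball in
    \<open>S\<close> and inside the range of the linear approximation.\<close>
  define e where "e = min d d' / K"
  have e: "e > 0" using d d' K by (simp add: e_def)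
  have "\<bar>(f (x + t *\<^sub>R u + t *\<^sub>R v) - f (x + t *\<^sub>R u) - f (x + t *\<^sub>R v) + f x) / t\<^sup>2 - L v\<bar> < \<epsilon>"
    if t: "0 < t" "t < e" for t
  proof -
    have tK: "t * K < min d d'" using t K by (simp add: e_def field_simps)
    have bd: "norm (s *\<^sub>R u + r *\<^sub>R v) \<le> t * (norm u + norm v)" if "0 \<le> s" "s \<le> t" "0 \<le> r" "r \<le> t"
      for s r
    proof -
      have "norm (s *\<^sub>R u + r *\<^sub>R v) \<le> s * norm u + r * norm v"
        using norm_triangle_ineq[of "s *\<^sub>R u" "r *\<^sub>R v"] that by simp
      also have "\<dots> \<le> t * norm u + t * norm v"
        using that by (intro add_mono mult_right_mono) auto
      finally show ?thesis by (simp add: algebra_simps)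
    qed
    have le: "t * (norm u + norm v) \<le> t * K" using t by (simp add: K_def)
    have inS: "x + s *\<^sub>R u + r *\<^sub>R v \<in> S" if "0 \<le> s" "s \<le> t" "0 \<le> r" "r \<le> t" for s r
    proof -
      have "dist x (x + (s *\<^sub>R u + r *\<^sub>R v)) = norm (s *\<^sub>R u + r *\<^sub>R v)"
        unfolding dist_norm by (subst norm_minus_commute) simp
      then have "x + (s *\<^sub>R u + r *\<^sub>R v) \<in> ball x d'"
        using bd[OF that] le tK by simp
      then show ?thesis using d'(2) by (auto simp: add.assoc)
    qed
    define g where "g = (\<lambda>s. f (x + s *\<^sub>R u + t *\<^sub>R v) - f (x + s *\<^sub>R u))"
    have fd: "((\<lambda>s. f (x + s *\<^sub>R u + r *\<^sub>R v)) has_real_derivative ?F (x + s *\<^sub>R u + r *\<^sub>R v))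
      (at s)"
      if "0 \<le> s" "s \<le> t" "0 \<le> r" "r \<le> t" for s r
    proof -
      have 1: "((\<lambda>s. x + s *\<^sub>R u + r *\<^sub>R v) has_derivative (\<lambda>k. k *\<^sub>R u)) (at s)"
        by (auto intro!: derivative_eq_intros)
      have fdi: "(f has_derivative frechet_derivative f (at (x + s *\<^sub>R u + r *\<^sub>R v)))
        (at (x + s *\<^sub>R u + r *\<^sub>R v))"
        using f[OF inS[OF that]] frechet_derivative_works by blast
      from has_derivative_compose[OF 1 fdi]
      show ?thesis
        unfolding has_field_derivative_def
        by (simp add: linear_scale[OF has_derivative_linear[OF fdi]] mult.commute[of _ "?F _"])
    qed
    have gd: "(g has_real_derivative (?F (x + s *\<^sub>R u + t *\<^sub>R v) - ?F (x + s *\<^sub>R u))) (at s)"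
      if "0 \<le> s" "s \<le> t" for s
      unfolding g_def using fd[OF that, of t] fd[OF that, of 0] t
      by (auto intro!: DERIV_diff)
    obtain s where s: "0 < s" "s < t" and gs: "g t - g 0 = (t - 0) * (?F (x + s *\<^sub>R u + t *\<^sub>R v)
      - ?F (x + s *\<^sub>R u))"
      using MVT2[of 0 t g "\<lambda>s. ?F (x + s *\<^sub>R u + t *\<^sub>R v) - ?F (x + s *\<^sub>R u)"] gd t(1) by auto
    have s': "0 \<le> s" "s \<le> t" using s by auto
    let ?p = "s *\<^sub>R u + t *\<^sub>R v"
    have n1: "norm ?p \<le> t * (norm u + norm v)" using bd[of s t] s t by simp
    have n2: "norm (s *\<^sub>R u) \<le> t * norm u" using s by (simp add: mult_right_mono)
    have n2': "t * norm u \<le> t * K" using t by (simp add: K_def)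
    have 1: "\<bar>?F (x + ?p) - ?F x - L ?p\<bar> \<le> \<eta> * norm ?p"
      using dL[of "x + ?p"] n1 le tK by simp
    have 2: "\<bar>?F (x + s *\<^sub>R u) - ?F x - L (s *\<^sub>R u)\<bar> \<le> \<eta> * norm (s *\<^sub>R u)"
      using dL[of "x + s *\<^sub>R u"] n2 n2' tK by simp
    have "L ?p - L (s *\<^sub>R u) = t * L v" by (simp add: L.add L.scaleR)
    then have "\<bar>?F (x + ?p) - ?F (x + s *\<^sub>R u) - t * L v\<bar> \<le> \<eta> * norm ?p + \<eta> * norm (s *\<^sub>R u)"
      using 1 2 by linarith
    also have "\<dots> \<le> \<eta> * (t * (norm u + norm v)) + \<eta> * (t * norm u)"
      using n1 n2 \<eta> by (intro add_mono mult_left_mono) auto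
    also have "\<dots> \<le> t * (\<eta> * K)" using \<eta> t by (simp add: K_def algebra_simps)
    finally have 3: "\<bar>?F (x + ?p) - ?F (x + s *\<^sub>R u) - t * L v\<bar> \<le> t * (\<eta> * K)" .
    have "(f (x + t *\<^sub>R u + t *\<^sub>R v) - f (x + t *\<^sub>R u) - f (x + t *\<^sub>R v) + f x) / t\<^sup>2 - L v
       = (?F (x + ?p) - ?F (x + s *\<^sub>R u) - t * L v) / t"
    proof -
      have "f (x + t *\<^sub>R u + t *\<^sub>R v) - f (x + t *\<^sub>R u) - f (x + t *\<^sub>R v) + f x
          = t * (?F (x + ?p) - ?F (x + s *\<^sub>R u))"
        using gs by (simp add: g_def add.assoc)
      then show ?thesis
        using t by (simp add: power2_eq_square diff_divide_distrib)
    qed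
    also have "\<bar>\<dots>\<bar> \<le> \<eta> * K" using 3 t by (simp add: abs_divide field_simps)
    also have "\<dots> < \<epsilon>" using K \<open>\<epsilon> > 0\<close> by (simp add: \<eta>_def)
    finally show ?thesis .
  qed
  then show "eventually (\<lambda>t. dist ((f (x + t *\<^sub>R u + t *\<^sub>R v) - f (x + t *\<^sub>R u) - f (x + t *\<^sub>R v)
    + f x) / t\<^sup>2) (L v) < \<epsilon>)
     (at_right 0)"
    using e by (auto simp: eventually_at_right_field dist_real_def)
qed

text \<open>The second difference is invariant under exchanging \<open>u\<close> and
  \<open>v\<close>, so both iterated derivatives are limits of the same quotient. Pairing with an
  arbitrary \<open>w\<close> reduces to real-valued functions.\<close>

lemma second_derivative_symmetric:
  fixes f :: "'e::real_normed_vector \<Rightarrow> 'f::real_inner"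
  assumes S: "open S" "x \<in> S"
    and f: "\<And>y. y \<in> S \<Longrightarrow> f differentiable (at y)"
    and D: "\<And>v. (\<lambda>y. frechet_derivative f (at y) v) differentiable (at x)"
  shows "frechet_derivative (\<lambda>y. frechet_derivative f (at y) u) (at x) v
       = frechet_derivative (\<lambda>y. frechet_derivative f (at y) v) (at x) u"
proof -
  have eq: "frechet_derivative (\<lambda>y. frechet_derivative f (at y) u) (at x) v \<bullet> w
       = frechet_derivative (\<lambda>y. frechet_derivative f (at y) v) (at x) u \<bullet> w" for w
  proof -
    let ?g = "\<lambda>y. f y \<bullet> w"
    have g1: "(?g has_derivative (\<lambda>h. frechet_derivative f (at y) h \<bullet> w)) (at y)" if "y \<in> S" for y
      using f[OF that] frechet_derivative_works has_derivative_inner_left by blast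
    have g: "?g differentiable (at y)" if "y \<in> S" for y
      using g1[OF that] differentiable_def by blast
    have gD: "((\<lambda>y. frechet_derivative ?g (at y) a) has_derivative
        (\<lambda>h. frechet_derivative (\<lambda>y. frechet_derivative f (at y) a) (at x) h \<bullet> w)) (at x)" for a
    proof (rule has_derivative_transform_within_open[OF _ S])
      show "((\<lambda>y. frechet_derivative f (at y) a \<bullet> w) has_derivative
        (\<lambda>h. frechet_derivative (\<lambda>y. frechet_derivative f (at y) a) (at x) h \<bullet> w)) (at x)"
        using D frechet_derivative_works has_derivative_inner_left by blast
    qed (simp add: frechet_derivative_at[OF g1, symmetric])
    have l1: "((\<lambda>t. (?g (x + t *\<^sub>R u + t *\<^sub>R v) - ?g (x + t *\<^sub>R u) - ?g (x + t *\<^sub>R v) + ?g x) / t\<^sup>2)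
       \<longlongrightarrow> frechet_derivative (\<lambda>y. frechet_derivative f (at y) u) (at x) v \<bullet> w) (at_right 0)"
      by (rule second_difference_tendsto[OF S g gD])
    have eq: "(\<lambda>t. (?g (x + t *\<^sub>R u + t *\<^sub>R v) - ?g (x + t *\<^sub>R u) - ?g (x + t *\<^sub>R v) + ?g x) / t\<^sup>2)
       = (\<lambda>t. (?g (x + t *\<^sub>R v + t *\<^sub>R u) - ?g (x + t *\<^sub>R v) - ?g (x + t *\<^sub>R u) + ?g x) / t\<^sup>2)"
      by (simp add: fun_eq_iff add.commute add.left_commute algebra_simps)
    have l2: "((\<lambda>t. (?g (x + t *\<^sub>R u + t *\<^sub>R v) - ?g (x + t *\<^sub>R u) - ?g (x + t *\<^sub>R v) + ?g x) / t\<^sup>2)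
       \<longlongrightarrow> frechet_derivative (\<lambda>y. frechet_derivative f (at y) v) (at x) u \<bullet> w) (at_right 0)"
      unfolding eq by (rule second_difference_tendsto[OF S g gD])
    show ?thesis
      using l1 l2 by (rule tendsto_unique[OF trivial_limit_at_right_real])
  qed
  show ?thesis
    using eq vector_eq_rdot by blast
qed

section \<open>Calculus of smooth functions\<close>

lemma Ck_on_cong:
  assumes "open S" "\<And>x. x \<in> S \<Longrightarrow> f x = g x" "Ck_on k S f"
  shows "Ck_on k S g"
  using assms(2,3)
proof (induction k arbitrary: f g)
  case 0
  then show ?case using continuous_on_cong[of S S f g] by simp
next
  case (Suc k)
  have D: "(g has_derivative frechet_derivative f (at x)) (at x)" if "x \<in> S" for x
  proof (rule has_derivative_transform_within_open[OF _ assms(1) that])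
    show "(f has_derivative frechet_derivative f (at x)) (at x)"
      using that Suc.prems(2) frechet_derivative_works by auto
  qed (rule Suc.prems(1))
  have "Ck_on k S (\<lambda>x. frechet_derivative g (at x) v)" for v
  proof (rule Suc.IH)
    show "Ck_on k S (\<lambda>x. frechet_derivative f (at x) v)" using Suc.prems(2) by simp
  qed (simp add: frechet_derivative_at[OF D, symmetric])
  then show ?case using D by (auto intro: differentiableI)
qed

lemma Ck_on_Un:
  assumes "open S" "open T" "Ck_on k S f" "Ck_on k T f"
  shows "Ck_on k (S \<union> T) f"
  using assms(3,4) by (induction k arbitrary: f) (auto intro: continuous_on_open_Un assms)

text \<open>Lets the closure proofs below work with explicit derivatives supplied by the sum,
  product and chain rules instead of \<open>frechet_derivative\<close>.\<close>

lemma Ck_on_SucI: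
  assumes "open S" "\<And>x. x \<in> S \<Longrightarrow> (f has_derivative D x) (at x)" "\<And>v. Ck_on k S (\<lambda>x. D x v)"
  shows "Ck_on (Suc k) S f"
proof -
  have "Ck_on k S (\<lambda>x. frechet_derivative f (at x) v)" for v
    by (rule Ck_on_cong[OF assms(1) _ assms(3)[of v]])
      (simp add: frechet_derivative_at[OF assms(2), symmetric])
  then show ?thesis using assms(2) by (auto simp: differentiable_def)
qed

lemma Ck_on_SucD:
  assumes "Ck_on (Suc k) S f"
  shows "x \<in> S \<Longrightarrow> (f has_derivative frechet_derivative f (at x)) (at x)"
    "Ck_on k S (\<lambda>x. frechet_derivative f (at x) v)"
  using assms frechet_derivative_works by auto

lemma Ck_on_Suc_imp: "Ck_on (Suc k) S f \<Longrightarrow> Ck_on k S f"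
proof (induction k arbitrary: f)
  case 0
  then show ?case
    by (auto intro!: continuous_at_imp_continuous_on differentiable_imp_continuous_within)
next
  case (Suc k)
  have "\<forall>x\<in>S. f differentiable (at x)" "\<forall>v. Ck_on (Suc k) S (\<lambda>x. frechet_derivative f (at x) v)"
    using Suc.prems Ck_on.simps(2)[of "Suc k"] by blast+
  then show ?case using Suc.IH Ck_on.simps(2)[of k] by blast
qed

lemma Ck_on_const [intro]: "Ck_on k S (\<lambda>x. c)"
  by (induction k arbitrary: c) auto

lemma Ck_on_bounded_linear:
  assumes "bounded_linear h"
  shows "Ck_on k S h"
proof (cases k)
  case 0
  then show ?thesis using assms linear_continuous_on by auto
next
  case (Suc n)
  have "(h has_derivative h) (at x)" for x
    using assms by (rule bounded_linear_imp_has_derivative)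
  then show ?thesis
    using frechet_derivative_at[of h h] by (auto simp: Suc differentiable_def)
qed

lemma Ck_on_bounded_linear_compose:
  assumes h: "bounded_linear h" and "open S" and "Ck_on k S f"
  shows "Ck_on k S (\<lambda>x. h (f x))"
  using assms(3)
proof (induction k arbitrary: f)
  case 0
  then show ?case using bounded_linear.continuous_on[OF h] by auto
next
  case (Suc k)
  show ?case
    by (rule Ck_on_SucI[OF \<open>open S\<close> bounded_linear.has_derivative[OF h Ck_on_SucD(1)[OF Suc.prems]]
          Suc.IH[OF Ck_on_SucD(2)[OF Suc.prems]]])
qed

lemma Ck_on_add:
  assumes "open S" "Ck_on k S f" "Ck_on k S g"
  shows "Ck_on k S (\<lambda>x. f x + g x)"
  using assms(2,3)
proof (induction k arbitrary: f g)
  case 0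
  then show ?case by (auto intro: continuous_on_add)
next
  case (Suc k)
  note f = Ck_on_SucD[OF Suc.prems(1)] and g = Ck_on_SucD[OF Suc.prems(2)]
  show ?case
    by (rule Ck_on_SucI[OF \<open>open S\<close> has_derivative_add[OF f(1) g(1)] Suc.IH[OF f(2) g(2)]])
qed

lemma Ck_on_sum:
  assumes "open S" "\<And>i. i \<in> I \<Longrightarrow> Ck_on k S (f i)"
  shows "Ck_on k S (\<lambda>x. \<Sum>i\<in>I. f i x)"
  using assms(2)
  by (induction I rule: infinite_finite_induct) (auto intro: Ck_on_add[OF \<open>open S\<close>])

lemma Ck_on_bilinear:
  fixes m :: "'a::real_normed_vector \<Rightarrow> 'b::real_normed_vector \<Rightarrow> 'c::real_normed_vector"
  assumes m: "bounded_bilinear m" and "open S" "Ck_on k S f" "Ck_on k S g"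
  shows "Ck_on k S (\<lambda>x. m (f x) (g x))"
  using assms(3,4)
proof (induction k arbitrary: f g)
  case 0
  then show ?case by (auto intro: bounded_bilinear.continuous_on[OF m])
next
  case (Suc k)
  note f = Ck_on_SucD[OF Suc.prems(1)] and g = Ck_on_SucD[OF Suc.prems(2)]
  note f' = Ck_on_Suc_imp[OF Suc.prems(1)] and g' = Ck_on_Suc_imp[OF Suc.prems(2)]
  show ?case
    by (rule Ck_on_SucI[OF \<open>open S\<close> bounded_bilinear.FDERIV[OF m f(1) g(1)]
          Ck_on_add[OF \<open>open S\<close> Suc.IH[OF f' g(2)] Suc.IH[OF f(2) g']]])
qed

text \<open>In the chain rule the direction in which \<open>g\<close> is differentiated varies with
  \<open>x\<close>, while \<open>Ck_on\<close> controls derivatives in constant directions. The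
  frame of the intermediate space rewrites the derivative as a finite sum of products, whose second
  factors are compositions again and fall under the induction hypothesis.\<close>

lemma Ck_on_compose:
  fixes f :: "'x::real_normed_vector \<Rightarrow> 'y::real_normed_vector"
    and g :: "'y \<Rightarrow> 'z::real_normed_vector"
  assumes fr: "finite_frame I \<phi> (b :: 'i \<Rightarrow> 'y)" and "open S"
    and "f ` S \<subseteq> T" "Ck_on k S f" "Ck_on k T g"
  shows "Ck_on k S (\<lambda>x. g (f x))"
  using assms(4,5)
proof (induction k arbitrary: g)
  case 0
  then show ?case using continuous_on_compose2[of T g S f] assms(3) by auto
next
  case (Suc k)
  note f = Ck_on_SucD[OF Suc.prems(1)] and g = Ck_on_SucD[OF Suc.prems(2)]
  have gD: "(g has_derivative frechet_derivative g (at (f x))) (at (f x))" if "x \<in> S" for x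
    using that g(1) assms(3) by auto
  have expand: "frechet_derivative g (at (f x)) w
      = (\<Sum>i\<in>I. \<phi> i w *\<^sub>R frechet_derivative g (at (f x)) (b i))" if "x \<in> S" for x w
  proof -
    have l: "linear (frechet_derivative g (at (f x)))"
      using gD[OF that] by (rule has_derivative_linear)
    have "frechet_derivative g (at (f x)) w
        = frechet_derivative g (at (f x)) (\<Sum>i\<in>I. \<phi> i w *\<^sub>R b i)"
      using finite_frameD(3)[OF fr] by simp
    then show ?thesis by (simp add: linear_sum[OF l] linear_scale[OF l])
  qed
  show ?case
  proof (rule Ck_on_SucI[OF \<open>open S\<close>])
    show "((\<lambda>x. g (f x)) has_derivative (\<lambda>v. \<Sum>i\<in>I. \<phi> i (frechet_derivative f (at x) v)
        *\<^sub>R frechet_derivative g (at (f x)) (b i))) (at x)" if "x \<in> S" for x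
      using has_derivative_compose[OF f(1)[OF that] gD[OF that]] that
      by (simp add: expand[symmetric])
    show "Ck_on k S (\<lambda>x. \<Sum>i\<in>I. \<phi> i (frechet_derivative f (at x) v)
        *\<^sub>R frechet_derivative g (at (f x)) (b i))" for v
    proof (rule Ck_on_sum[OF \<open>open S\<close>], rule Ck_on_bilinear[OF bounded_bilinear_scaleR \<open>open S\<close>])
      fix i assume "i \<in> I"
      show "Ck_on k S (\<lambda>x. \<phi> i (frechet_derivative f (at x) v))"
        using finite_frameD(2)[OF fr \<open>i \<in> I\<close>] \<open>open S\<close> f(2) by (rule Ck_on_bounded_linear_compose)
      show "Ck_on k S (\<lambda>x. frechet_derivative g (at (f x)) (b i))"
        using Ck_on_Suc_imp[OF Suc.prems(1)] g(2) by (rule Suc.IH)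
    qed
  qed
qed

section \<open>Bump functions\<close>

lemma Ck_on_real:
  assumes "\<And>t. (f has_real_derivative f' t) (at t)" "Ck_on k UNIV f'"
  shows "Ck_on (Suc k) UNIV f"
proof (rule Ck_on_SucI)
  show "(f has_derivative (\<lambda>v. f' t * v)) (at t)" for t
    using assms(1)[of t] by (simp add: has_field_derivative_def)
  show "Ck_on k UNIV (\<lambda>t. f' t * v)" for v
    using Ck_on_bounded_linear_compose[OF bounded_linear_mult_left _ assms(2)] by simp
qed simp

text \<open>The derivatives of \<open>exp (-1/t)\<close>, extended by 0 to \<open>t \<le> 0\<close>, are combinations of these.\<close>

definition flat_exp :: "nat \<Rightarrow> real \<Rightarrow> real" where
  "flat_exp n t = (if t > 0 then exp (- inverse t) * inverse t ^ n else 0)"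

text \<open>For positive \<open>t\<close> this is the product rule, for negative \<open>t\<close>
  everything is 0. At 0 the claimed derivative is 0, and the right-hand difference quotient tends to
  it because the exponential beats every power of \<open>inverse t\<close>.\<close>

lemma flat_exp_derivative:
  "(flat_exp n has_real_derivative (flat_exp (n + 2) t - n * flat_exp (n + 1) t)) (at t)"
proof -
  consider "t > 0" | "t < 0" | "t = 0" by linarith
  then show ?thesis
  proof cases
    case 1
    have i: "(inverse has_real_derivative - (inverse t * inverse t)) (at t)"
      using DERIV_inverse[of t] 1 by (simp add: power2_eq_square)
    have e: "((\<lambda>t. exp (- inverse t)) has_real_derivative exp (- inverse t) * (inverse t *
      inverse t)) (at t)"
      using 1 by (auto intro!: derivative_eq_intros)
    have p: "((\<lambda>t. inverse t ^ n) has_real_derivative - (n * inverse t ^ (n + 1))) (at t)"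
      by (cases n) (use DERIV_power_Suc[OF i] in \<open>auto simp: algebra_simps\<close>)
    have "((\<lambda>t. exp (- inverse t) * inverse t ^ n) has_real_derivative
       (flat_exp (n + 2) t - n * flat_exp (n + 1) t)) (at t)"
      using 1 DERIV_mult[OF e p] by (simp add: flat_exp_def algebra_simps)
    then show ?thesis
      by (rule has_field_derivative_transform_within_open[where S = "{0<..}"])
        (use 1 in \<open>auto simp: flat_exp_def\<close>)
  next
    case 2
    have "((\<lambda>t::real. 0) has_real_derivative (flat_exp (n + 2) t - n * flat_exp (n + 1) t)) (at t)"
      using 2 by (simp add: flat_exp_def)
    then show ?thesis
      by (rule has_field_derivative_transform_within_open[where S = "{..<0}"])
        (use 2 in \<open>auto simp: flat_exp_def\<close>)
  next
    case 3
    have "((\<lambda>h. (flat_exp n (0 + h) - flat_exp n 0) / h) \<longlongrightarrow> 0) (at 0)"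
      unfolding filterlim_at_split
    proof
      have "((\<lambda>h::real. 0 :: real) \<longlongrightarrow> 0) (at_left 0)" by simp
      then show "((\<lambda>h. (flat_exp n (0 + h) - flat_exp n 0) / h) \<longlongrightarrow> 0) (at_left 0)"
        by (rule Lim_transform_eventually)
          (auto simp: eventually_at_left_field flat_exp_def intro!: exI[of _ "-1"])
      have "((\<lambda>h::real. (exp (- inverse h) * inverse h ^ n) / h) \<longlongrightarrow> 0) (at_right 0)"
        by real_asymp
      then show "((\<lambda>h. (flat_exp n (0 + h) - flat_exp n 0) / h) \<longlongrightarrow> 0) (at_right 0)"
        by (rule Lim_transform_eventually)
          (auto simp: eventually_at_right_field flat_exp_def intro!: exI[of _ 1])
    qed
    then have "(flat_exp n has_real_derivative 0) (at 0)"
      by (simp add: DERIV_def)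
    then show ?thesis using 3 by (simp add: flat_exp_def)
  qed
qed

lemma Ck_on_flat_exp: "Ck_on k UNIV (flat_exp n)"
proof (induction k arbitrary: n)
  case 0
  show ?case
    using flat_exp_derivative[of n] DERIV_isCont by (auto intro!: continuous_at_imp_continuous_on)
next
  case (Suc k)
  have "Ck_on k UNIV (\<lambda>t. flat_exp (n + 2) t + - (real n) * flat_exp (n + 1) t)"
    by (rule Ck_on_add[OF open_UNIV Suc Ck_on_bounded_linear_compose[OF bounded_linear_mult_right
      open_UNIV Suc]])
  then show ?case
    by (intro Ck_on_real[OF flat_exp_derivative]) simp
qed

text \<open>For \<open>Ck_on_compose\<close> with the reals as intermediate space.\<close>

lemma finite_frame_real: "finite_frame {()} (\<lambda>_ v. v) (\<lambda>_. 1 :: real)"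
  by (simp add: finite_frame_def bounded_linear_ident)

text \<open>\<open>flat_exp 0\<close> of \<open>\<epsilon>\<^sup>2\<close> minus the squared
  distance to \<open>x0\<close>, divided by its value at the centre. The squared distance is used
  because it is smooth at \<open>x0\<close> too.\<close>

lemma bump_function:
  fixes x0 :: "'e::real_inner"
  assumes "\<epsilon> > 0"
  obtains \<rho> :: "'e \<Rightarrow> real" where "\<And>k. Ck_on k UNIV \<rho>" "\<rho> x0 = 1" "\<And>x. x \<notin> cball x0 \<epsilon> \<Longrightarrow> \<rho> x = 0"
proof
  \<comment> \<open>Differences are written as sums with negatives and the square as an inner
    product, so that \<open>Ck_on_add\<close> and \<open>Ck_on_bilinear\<close> cover the whole
    expression.\<close>
  let ?q = "\<lambda>x. \<epsilon>\<^sup>2 + - ((x + - x0) \<bullet> (x + - x0))"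
  define h where "h = flat_exp 0 (\<epsilon>\<^sup>2)"
  have h: "h > 0" using assms by (simp add: h_def flat_exp_def)
  show "Ck_on k UNIV (\<lambda>x. flat_exp 0 (?q x) * inverse h)" for k
  proof (rule Ck_on_bounded_linear_compose[OF bounded_linear_mult_left open_UNIV],
      rule Ck_on_compose[OF finite_frame_real open_UNIV _ _ Ck_on_flat_exp])
    have d: "Ck_on k UNIV (\<lambda>x::'e. x + - x0)"
      by (rule Ck_on_add[OF open_UNIV Ck_on_bounded_linear[OF bounded_linear_ident] Ck_on_const])
    show "Ck_on k UNIV ?q"
      by (rule Ck_on_add[OF open_UNIV Ck_on_const Ck_on_bounded_linear_compose[OF
              bounded_linear_minus[OF bounded_linear_ident] open_UNIV
              Ck_on_bilinear[OF bounded_bilinear_inner open_UNIV d d]]])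
  qed simp
  show "flat_exp 0 (?q x0) * inverse h = 1" using h by (simp add: h_def)
  fix x assume "x \<notin> cball x0 \<epsilon>"
  then have "\<epsilon>\<^sup>2 < (norm (x - x0))\<^sup>2"
    using assms by (intro power_strict_mono) (auto simp: dist_norm norm_minus_commute)
  then show "flat_exp 0 (?q x) * inverse h = 0"
    by (simp add: flat_exp_def power2_norm_eq_inner)
qed

text \<open>Heine-Borel from the frame: the coordinates of a bounded set are bounded, so the ball is
  a closed subset of a finite sum of compact segments.\<close>

lemma finite_frame_compact_cball:
  assumes fr: "finite_frame I \<phi> (b :: 'i \<Rightarrow> 'v::real_normed_vector)"
  shows "compact (cball (x::'v) \<epsilon>)"
proof -
  have bdd: "bounded (\<phi> i ` cball x \<epsilon>)" if "i \<in> I" for i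
    using bounded_linear_image[OF bounded_cball finite_frameD(2)[OF fr that]] .
  have comp: "\<exists>K. compact K \<and> (\<forall>v\<in>cball x \<epsilon>. (\<Sum>i\<in>J. \<phi> i v *\<^sub>R b i) \<in> K)" if "finite J" "J \<subseteq> I" for J
    using that
  proof (induction J)
    case empty
    show ?case by (intro exI[of _ "{0}"]) simp
  next
    case (insert i J)
    then obtain K where K: "compact K" "\<forall>v\<in>cball x \<epsilon>. (\<Sum>i\<in>J. \<phi> i v *\<^sub>R b i) \<in> K" by auto
    obtain R where R: "\<forall>t\<in>\<phi> i ` cball x \<epsilon>. norm t \<le> R"
      using bdd[of i] insert.prems by (auto simp: bounded_iff)
    let ?L = "(\<lambda>t. t *\<^sub>R b i) ` {-R..R}"
    have L: "compact ?L" by (intro compact_continuous_image continuous_intros compact_Icc)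
    have "(\<Sum>i\<in>insert i J. \<phi> i v *\<^sub>R b i) \<in> {y + z | y z. y \<in> ?L \<and> z \<in> K}" if "v \<in> cball x \<epsilon>" for v
      using insert.hyps that K(2) R by (force simp: abs_le_iff)
    then show ?case using compact_sums[OF L K(1)] by blast
  qed
  obtain K where K: "compact K" "\<forall>v\<in>cball x \<epsilon>. (\<Sum>i\<in>I. \<phi> i v *\<^sub>R b i) \<in> K"
    using comp[OF finite_frameD(1)[OF fr]] by blast
  then have "cball x \<epsilon> \<subseteq> K" using finite_frameD(3)[OF fr] by auto
  then have "cball x \<epsilon> = K \<inter> cball x \<epsilon>" by blast
  then show ?thesis using compact_Int_closed[OF K(1) closed_cball] by metis
qed

section \<open>Charts and tangent vectors\<close>

lemma scaleR_fun_apply [simp]: "(a *\<^sub>R f) x = a *\<^sub>R f x"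
  by (simp add: scaleR_fun_def)

definition transition :: "('a, 'e) chart \<Rightarrow> ('a, 'e) chart \<Rightarrow> 'e \<Rightarrow> 'e" where
  "transition c d = snd d \<circ> chart_inv c"

definition jacobian ::
    "('a, 'e::real_normed_vector) chart \<Rightarrow> ('a, 'e) chart \<Rightarrow> 'a \<Rightarrow> 'e \<Rightarrow> 'e" where
  "jacobian c d p = frechet_derivative (transition c d) (at (snd c p))"

lemma chart_at_in:
  assumes "p \<in> carrier A"
  shows "chart_at A p \<in> A" "p \<in> fst (chart_at A p)"
proof -
  have "\<exists>c. c \<in> A \<and> p \<in> fst c" using assms unfolding carrier_def by blast
  from someI_ex[OF this] show "chart_at A p \<in> A" "p \<in> fst (chart_at A p)"
    by (simp_all add: chart_at_def)
qed

lemma carrierI: "c \<in> A \<Longrightarrow> p \<in> fst c \<Longrightarrow> p \<in> carrier A"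
  by (auto simp: carrier_def)

text \<open>The regularity is kept this low so that the locale also applies to the tangent and
  cotangent atlases, whose transition maps contain first derivatives of those of
  \<open>A\<close>.\<close>

locale c1_atlas =
  fixes A :: "('a, 'e::real_normed_vector) chart set"
  assumes inj: "c \<in> A \<Longrightarrow> inj_on (snd c) (fst c)"
    and open_overlap: "c \<in> A \<Longrightarrow> d \<in> A \<Longrightarrow> open (snd c ` (fst c \<inter> fst d))"
    and transition_differentiable:
      "c \<in> A \<Longrightarrow> d \<in> A \<Longrightarrow> p \<in> fst c \<Longrightarrow> p \<in> fst d \<Longrightarrow>
        transition c d differentiable (at (snd c p))"
begin

lemma chart_inv_snd [simp]: "c \<in> A \<Longrightarrow> p \<in> fst c \<Longrightarrow> chart_inv c (snd c p) = p"
  using inj by simp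

lemma transition_snd [simp]: "c \<in> A \<Longrightarrow> p \<in> fst c \<Longrightarrow> transition c d (snd c p) = snd d p"
  by (simp add: transition_def)

lemma overlapE:
  assumes "x \<in> snd c ` (fst c \<inter> fst d)"
  obtains p where "p \<in> fst c" "p \<in> fst d" "x = snd c p"
  using assms by blast

lemma open_chart_image: "c \<in> A \<Longrightarrow> open (chart_image c)"
  using open_overlap[of c c] by simp

lemma transition_has_derivative:
  "c \<in> A \<Longrightarrow> d \<in> A \<Longrightarrow> p \<in> fst c \<Longrightarrow> p \<in> fst d \<Longrightarrow>
    (transition c d has_derivative jacobian c d p) (at (snd c p))"
  unfolding jacobian_def using transition_differentiable frechet_derivative_works by blast

lemma linear_jacobian:
  "c \<in> A \<Longrightarrow> d \<in> A \<Longrightarrow> p \<in> fst c \<Longrightarrow> p \<in> fst d \<Longrightarrow> linear (jacobian c d p)"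
  using transition_has_derivative has_derivative_linear by blast

text \<open>Chain rule for the composite of two transition maps. The composite and
  \<open>transition c e\<close> agree on the whole overlap of \<open>c\<close> and \<open>d\<close>:
  outside the domain of \<open>e\<close> both return the same junk value of
  \<open>snd e\<close>.\<close>

lemma jacobian_cocycle:
  assumes "c \<in> A" "d \<in> A" "e \<in> A" "p \<in> fst c" "p \<in> fst d" "p \<in> fst e"
  shows "jacobian d e p (jacobian c d p v) = jacobian c e p v"
proof -
  have "((\<lambda>x. transition d e (transition c d x)) has_derivative (\<lambda>v. jacobian d e p (jacobian c d p
    v))) (at (snd c p))"
    by (rule has_derivative_compose[OF transition_has_derivative])
      (use assms transition_has_derivative in simp_all)
  then have "(transition c e has_derivative (\<lambda>v. jacobian d e p (jacobian c d p v))) (at (snd c p))"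
    by (rule has_derivative_transform_within_open[where s = "snd c ` (fst c \<inter> fst d)"])
      (use assms open_overlap[of c d] in \<open>auto elim!: overlapE\<close>)
  from frechet_derivative_at[OF this] show ?thesis
    unfolding jacobian_def by (simp add: fun_eq_iff)
qed

lemma jacobian_self [simp]:
  assumes "c \<in> A" "p \<in> fst c"
  shows "jacobian c c p v = v"
proof -
  have "(transition c c has_derivative (\<lambda>v. v)) (at (snd c p))"
    by (rule has_derivative_transform_within_open[OF has_derivative_ident open_chart_image[OF
      assms(1)]])
      (use assms in \<open>auto simp: transition_def\<close>)
  from frechet_derivative_at[OF this] show ?thesis
    unfolding jacobian_def by (simp add: fun_eq_iff)
qed

lemma tangent_space_transform:
  "v \<in> tangent_space A p \<Longrightarrow> c \<in> A \<Longrightarrow> d \<in> A \<Longrightarrow> p \<in> fst c \<Longrightarrow> p \<in> fst d \<Longrightarrow> v d = jacobian c d p (v c)"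
  unfolding tangent_space_def jacobian_def transition_def by blast

lemma tangent_space_off: "v \<in> tangent_space A p \<Longrightarrow> \<not> (c \<in> A \<and> p \<in> fst c) \<Longrightarrow> v c = 0"
  unfolding tangent_space_def jacobian_def transition_def by blast

text \<open>By the cocycle identity, the transformation rule out of one chart implies it between all
  pairs of charts.\<close>

lemma tangent_spaceI:
  assumes "c \<in> A" "p \<in> fst c"
    and "\<And>d. d \<in> A \<Longrightarrow> p \<in> fst d \<Longrightarrow> v d = jacobian c d p (v c)"
    and "\<And>d. \<not> (d \<in> A \<and> p \<in> fst d) \<Longrightarrow> v d = 0"
  shows "v \<in> tangent_space A p"
  unfolding tangent_space_def jacobian_def[unfolded transition_def, symmetric]
proof (intro CollectI conjI ballI allI impI; (elim conjE)?)
  fix d e assume de: "d \<in> A" "e \<in> A" "p \<in> fst d" "p \<in> fst e"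
  show "v e = jacobian d e p (v d)"
    unfolding assms(3)[OF de(1,3)] assms(3)[OF de(2,4)]
    using assms(1,2) de by (intro jacobian_cocycle[symmetric])
qed (rule assms(4))

lemma tangent_space_eqI:
  assumes "v \<in> tangent_space A p" "w \<in> tangent_space A p" "c \<in> A" "p \<in> fst c" "v c = w c"
  shows "v = w"
proof
  fix d
  show "v d = w d"
  proof (cases "d \<in> A \<and> p \<in> fst d")
    case True
    then show ?thesis
      using tangent_space_transform[of v p c d] tangent_space_transform[of w p c d] assms by simp
  next
    case False
    then show ?thesis
      using tangent_space_off[of v p d] tangent_space_off[of w p d] assms by simp
  qed
qed

lemma tangent_space_linear:
  assumes "v \<in> tangent_space A p" "w \<in> tangent_space A p"
  shows "a *\<^sub>R v + b *\<^sub>R w \<in> tangent_space A p"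
  unfolding tangent_space_def jacobian_def[unfolded transition_def, symmetric]
proof (intro CollectI conjI ballI allI impI; (elim conjE)?)
  fix c d assume cd: "c \<in> A" "d \<in> A" "p \<in> fst c" "p \<in> fst d"
  then have lin: "linear (jacobian c d p)" by (rule linear_jacobian)
  show "(a *\<^sub>R v + b *\<^sub>R w) d = jacobian c d p ((a *\<^sub>R v + b *\<^sub>R w) c)"
    using tangent_space_transform[OF assms(1) cd] tangent_space_transform[OF assms(2) cd]
    by (simp add: linear_add[OF lin] linear_scale[OF lin])
next
  fix c assume "\<not> (c \<in> A \<and> p \<in> fst c)"
  then show "(a *\<^sub>R v + b *\<^sub>R w) c = 0"
    using assms[THEN tangent_space_off] by simp
qed

lemma tangent_space_diff:
  "v \<in> tangent_space A p \<Longrightarrow> w \<in> tangent_space A p \<Longrightarrow> v - w \<in> tangent_space A p"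
  using tangent_space_linear[of v p w 1 "-1"] by simp

lemma coord_vec_apply: "d \<in> A \<Longrightarrow> p \<in> fst d \<Longrightarrow> coord_vec A c p e d = jacobian c d p e"
  by (simp add: coord_vec_def jacobian_def transition_def)

lemma coord_vec_same [simp]: "c \<in> A \<Longrightarrow> p \<in> fst c \<Longrightarrow> coord_vec A c p e c = e"
  by (simp add: coord_vec_apply)

lemma coord_vec_in [simp]: "c \<in> A \<Longrightarrow> p \<in> fst c \<Longrightarrow> coord_vec A c p e \<in> tangent_space A p"
  by (rule tangent_spaceI[of c]) (simp add: coord_vec_apply, simp add: coord_vec_apply,
      simp add: coord_vec_apply, simp add: coord_vec_def del: de_Morgan_conj)

lemma coord_vec_of [simp]:
  "v \<in> tangent_space A p \<Longrightarrow> c \<in> A \<Longrightarrow> p \<in> fst c \<Longrightarrow> coord_vec A c p (v c) = v"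
  by (rule tangent_space_eqI[of _ p _ c]) simp_all

lemma coord_vec_linear:
  assumes "c \<in> A" "p \<in> fst c"
  shows "coord_vec A c p (a *\<^sub>R e + b *\<^sub>R f) = a *\<^sub>R coord_vec A c p e + b *\<^sub>R coord_vec A c p f"
  using assms by (intro tangent_space_eqI[of _ p _ c] tangent_space_linear) simp_all

text \<open>Frees \<open>tangent_map\<close> from its unspecified chart: passing from
  \<open>chart_at A p\<close> to \<open>c\<close> inserts a Jacobian, which the transformation rule
  of \<open>v\<close> absorbs.\<close>

lemma tangent_map_apply:
  assumes c: "c \<in> A" "p \<in> fst c" "v \<in> tangent_space A p"
    and d: "d \<in> B" "f p \<in> fst d"
    and D: "((\<lambda>x. snd d (f (chart_inv c x))) has_derivative D) (at (snd c p))"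
  shows "snd (tangent_map A B f (p, v)) d = D (v c)"
proof -
  define c' where "c' = chart_at A p"
  have c': "c' \<in> A" "p \<in> fst c'"
    using chart_at_in[OF carrierI[OF c(1,2)]] by (auto simp: c'_def)
  have "((\<lambda>x. snd d (f (chart_inv c (transition c' c x))))
    has_derivative (\<lambda>h. D (jacobian c' c p h))) (at (snd c' p))"
    by (rule has_derivative_compose[OF transition_has_derivative]) (use c c' D in simp_all)
  then have "((snd d \<circ> f \<circ> chart_inv c') has_derivative (\<lambda>h. D (jacobian c' c p h)))
    (at (snd c' p))"
    by (rule has_derivative_transform_within_open[where s = "snd c' ` (fst c' \<inter> fst c)"])
      (use c c' open_overlap[of c' c] in \<open>auto elim!: overlapE\<close>)
  then have "frechet_derivative (snd d \<circ> f \<circ> chart_inv c') (at (snd c' p))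
    = (\<lambda>h. D (jacobian c' c p h))"
    by (rule frechet_derivative_at[symmetric])
  then show ?thesis
    using d tangent_space_transform[OF c(3) c'(1) c(1) c'(2) c(2)]
    by (simp add: tangent_map_def c'_def[symmetric])
qed

text \<open>The premise \<open>stable\<close> stands in for continuity of \<open>f\<close>, as the
  locale carries no topology on the manifold: near the point, \<open>f\<close> must stay in both
  charts so that \<open>transition d e\<close> relates the two coordinate expressions.\<close>

lemma tangent_map_in:
  assumes B: "c1_atlas B"
    and c: "c \<in> A" "p \<in> fst c" "v \<in> tangent_space A p"
    and d: "d \<in> B" "f p \<in> fst d"
    and D: "((\<lambda>x. snd d (f (chart_inv c x))) has_derivative D) (at (snd c p))"
    and stable: "\<And>e. e \<in> B \<Longrightarrow> f p \<in> fst e \<Longrightarrow>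
      \<exists>N. open N \<and> snd c p \<in> N \<and> (\<forall>x\<in>N. f (chart_inv c x) \<in> fst e \<inter> fst d)"
  shows "snd (tangent_map A B f (p, v)) \<in> tangent_space B (f p)"
proof (rule c1_atlas.tangent_spaceI[OF B d])
  fix e assume e: "e \<in> B" "f p \<in> fst e"
  obtain N where N: "open N" "snd c p \<in> N" "\<And>x. x \<in> N \<Longrightarrow> f (chart_inv c x) \<in> fst e \<inter> fst d"
    using stable[OF e] by blast
  have s: "snd d (f (chart_inv c (snd c p))) = snd d (f p)" using c by simp
  have "((\<lambda>x. transition d e (snd d (f (chart_inv c x)))) has_derivative (\<lambda>h. jacobian d e (f p)
    (D h))) (at (snd c p))"
    by (rule has_derivative_compose[OF D])
      (unfold s, rule c1_atlas.transition_has_derivative[OF B d(1) e(1) d(2) e(2)])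
  then have "((\<lambda>x. snd e (f (chart_inv c x))) has_derivative (\<lambda>h. jacobian d e (f p) (D h)))
    (at (snd c p))"
    by (rule has_derivative_transform_within_open[OF _ N(1,2)])
      (use N(3) d c1_atlas.transition_snd[OF B d(1)] in auto)
  from tangent_map_apply[where f = f, OF c e this] tangent_map_apply[where f = f, OF c d D]
  show "snd (tangent_map A B f (p, v)) e = jacobian d e (f p) (snd (tangent_map A B f (p, v)) d)"
    by simp
next
  fix e assume "\<not> (e \<in> B \<and> f p \<in> fst e)"
  then show "snd (tangent_map A B f (p, v)) e = 0" by (auto simp: tangent_map_def Let_def)
qed

lemma mem_tangent_chart [simp]: "(p, v) \<in> fst (tangent_chart A c) \<longleftrightarrow> p \<in> fst c
  \<and> v \<in> tangent_space A p"
  by (simp add: tangent_chart_def)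

lemma snd_tangent_chart [simp]: "snd (tangent_chart A c) (p, v) = (snd c p, v c)"
  by (simp add: tangent_chart_def)

lemma inj_tangent_chart: "c \<in> A \<Longrightarrow> inj_on (snd (tangent_chart A c)) (fst (tangent_chart A c))"
  by (rule inj_onI) (clarsimp, metis inj inj_on_eq_iff tangent_space_eqI)

lemma chart_inv_tangent_chart [simp]:
  assumes "c \<in> A" "p \<in> fst c"
  shows "chart_inv (tangent_chart A c) (snd c p, e) = (p, coord_vec A c p e)"
  by (rule inv_into_f_eq[OF inj_tangent_chart]) (use assms in auto)

lemma image_tangent_chart_overlap:
  assumes "c \<in> A"
  shows "snd (tangent_chart A c) ` (fst (tangent_chart A c) \<inter> fst (tangent_chart A d))
    = snd c ` (fst c \<inter> fst d) \<times> (UNIV :: 'e set)"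
proof (intro equalityI subsetI)
  fix y assume "y \<in> snd c ` (fst c \<inter> fst d) \<times> (UNIV :: 'e set)"
  then obtain p e where "p \<in> fst c" "p \<in> fst d" "y = (snd c p, e :: 'e)" by auto
  then have "y = snd (tangent_chart A c) (p, coord_vec A c p e)" "(p, coord_vec A c p e) \<in> fst
    (tangent_chart A c) \<inter> fst (tangent_chart A d)"
    using assms by auto
  then show "y \<in> snd (tangent_chart A c) ` (fst (tangent_chart A c) \<inter> fst (tangent_chart A d))"
    by blast
qed auto

end

section \<open>The tangent and cotangent bundles\<close>

definition covec_coords ::
    "('a, 'e::real_normed_vector) chart set \<Rightarrow> ('a, 'e) chart \<Rightarrow> 'a \<Rightarrow> ('a, 'e) cotvec \<Rightarrow> ('e \<Rightarrow>\<^sub>L real)"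
      where
  "covec_coords A c p \<alpha> = Blinfun (\<lambda>e. \<alpha> (coord_vec A c p e))"

definition hessian ::
    "('a, 'e::real_normed_vector) chart \<Rightarrow> ('a, 'e) chart \<Rightarrow> 'a \<Rightarrow> 'e \<Rightarrow> 'e \<Rightarrow> 'e" where
  "hessian c d p v =
     frechet_derivative (\<lambda>x. frechet_derivative (transition c d) (at x) v) (at (snd c p))"

text \<open>The transition maps of both bundles contain a Jacobian in the fibre component, so
  differentiable transitions there require differentiable Jacobians here.\<close>

locale c2_atlas = c1_atlas A for A :: "('a, 'e::real_inner) chart set" +
  fixes E :: "'e set"
  assumes frame: "finite_frame E (\<lambda>b v. v \<bullet> b) (\<lambda>b. b)"
    and jacobian_differentiable:
      "c \<in> A \<Longrightarrow> d \<in> A \<Longrightarrow> p \<in> fst c \<Longrightarrow> p \<in> fst d \<Longrightarrow>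
        (\<lambda>x. frechet_derivative (transition c d) (at x) v) differentiable (at (snd c p))"
begin

text \<open>The source of every cancellation under a change of chart: for the canonical symplectic
  form and for the Lie bracket.\<close>

lemma hessian_symmetric:
  assumes "c \<in> A" "d \<in> A" "p \<in> fst c" "p \<in> fst d"
  shows "hessian c d p v w = hessian c d p w v"
  unfolding hessian_def
proof (rule second_derivative_symmetric)
  show "open (snd c ` (fst c \<inter> fst d))" using assms open_overlap by blast
  show "snd c p \<in> snd c ` (fst c \<inter> fst d)" using assms by blast
  show "transition c d differentiable (at x)" if "x \<in> snd c ` (fst c \<inter> fst d)" for x
    using that assms transition_differentiable by blast
  show "(\<lambda>x. frechet_derivative (transition c d) (at x) v) differentiable (at (snd c p))" for v
    using assms by (rule jacobian_differentiable)
qed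

lemma jacobian_has_derivative:
  assumes "c \<in> A" "d \<in> A" "p \<in> fst c" "p \<in> fst d"
  shows "((\<lambda>x. frechet_derivative (transition c d) (at x) v) has_derivative hessian c d p v)
    (at (snd c p))"
  unfolding hessian_def using jacobian_differentiable[OF assms] frechet_derivative_works by blast

text \<open>The fibre component is the Jacobian applied to the fibre coordinate, linear in the
  fibre, so the fibrewise product rule yields one Hessian and one Jacobian term.\<close>

lemma tangent_transition_has_derivative:
  assumes "c \<in> A" "d \<in> A" "p \<in> fst c" "p \<in> fst d"
  shows "(transition (tangent_chart A c) (tangent_chart A d) has_derivative
     (\<lambda>(h, k). (jacobian c d p h, hessian c d p e h + jacobian c d p k))) (at (snd c p, e))"
proof -
  have "((\<lambda>z. (transition c d (fst z), frechet_derivative (transition c d) (at (fst z)) (snd z)))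
    has_derivative
      (\<lambda>k. (jacobian c d p (fst k), hessian c d p e (fst k) + jacobian c d p (snd k))))
        (at (snd c p, e))"
  proof (rule has_derivative_Pair)
    show "((\<lambda>z. transition c d (fst z)) has_derivative (\<lambda>k. jacobian c d p (fst k)))
      (at (snd c p, e))"
      by (rule has_derivative_compose[OF has_derivative_fst[OF has_derivative_ident]])
        (use assms transition_has_derivative in simp)
    have "((\<lambda>z. frechet_derivative (transition c d) (at (fst z)) (snd z)) has_derivative
       (\<lambda>k. frechet_derivative (\<lambda>x. frechet_derivative (transition c d) (at x) (snd (snd c p, e)))
         (at (fst (snd c p, e))) (fst k)
          + frechet_derivative (transition c d) (at (fst (snd c p, e))) (snd k))) (at (snd c p, e))"
      by (rule has_derivative_fibrewise_linear[OF frame, where S = "snd c ` (fst c \<inter> fst d)"])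
        (use assms open_overlap[of c d] linear_jacobian[unfolded jacobian_def, of c d]
            jacobian_differentiable[of c d] in \<open>auto elim!: overlapE intro: has_derivative_fst
              has_derivative_snd has_derivative_ident\<close>)
    then show "((\<lambda>z. frechet_derivative (transition c d) (at (fst z)) (snd z)) has_derivative
       (\<lambda>k. hessian c d p e (fst k) + jacobian c d p (snd k))) (at (snd c p, e))"
      by (simp add: hessian_def jacobian_def)
  qed
  then have "(transition (tangent_chart A c) (tangent_chart A d) has_derivative
      (\<lambda>k. (jacobian c d p (fst k), hessian c d p e (fst k) + jacobian c d p (snd k))))
        (at (snd c p, e))"
    by (rule has_derivative_transform_within_open[where s = "snd c ` (fst c \<inter> fst d) \<times> UNIV"])
      (use assms open_overlap[of c d] in \<open>auto simp: coord_vec_apply jacobian_def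
        transition_def[of "tangent_chart A c"] elim!: overlapE intro: open_Times\<close>)
  then show ?thesis by (simp add: case_prod_beta')
qed

lemma c1_tangent_atlas: "c1_atlas (tangent_atlas A)"
proof
  fix C D assume C: "C \<in> tangent_atlas A" then obtain c where c: "c \<in> A" "C = tangent_chart A c"
    by (auto simp: tangent_atlas_def)
  show "inj_on (snd C) (fst C)" using inj_tangent_chart c by simp
  assume "D \<in> tangent_atlas A" then obtain d where d: "d \<in> A" "D = tangent_chart A d"
    by (auto simp: tangent_atlas_def)
  show "open (snd C ` (fst C \<inter> fst D))"
    using c d open_overlap by (simp add: image_tangent_chart_overlap open_Times)
  fix z assume "z \<in> fst C" "z \<in> fst D"
  then show "transition C D differentiable (at (snd C z))"
    using tangent_transition_has_derivative[of c d "fst z"] c d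
    by (cases z) (auto intro: differentiableI)
qed

lemma cotangent_linear:
  assumes "\<alpha> \<in> cotangent_space A p" "u \<in> tangent_space A p" "v \<in> tangent_space A p"
  shows "\<alpha> (a *\<^sub>R u + b *\<^sub>R v) = a * \<alpha> u + b * \<alpha> v"
  using assms unfolding cotangent_space_def linear_between_def by simp

lemma cotangent_off: "\<alpha> \<in> cotangent_space A p \<Longrightarrow> v \<notin> tangent_space A p \<Longrightarrow> \<alpha> v = 0"
  unfolding cotangent_space_def by blast

lemma bounded_linear_frame: "linear f \<Longrightarrow> bounded_linear (f :: 'e \<Rightarrow> 'f::real_normed_vector)"
  by (rule finite_frame_bounded_linear[OF frame])

text \<open>\<open>Blinfun\<close> is meaningful only on bounded linear maps; boundedness comes from
  the frame.\<close>

lemma covec_coords_apply [simp]: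
  assumes "\<alpha> \<in> cotangent_space A p" "c \<in> A" "p \<in> fst c"
  shows "blinfun_apply (covec_coords A c p \<alpha>) e = \<alpha> (coord_vec A c p e)"
proof -
  have "linear (\<lambda>e. \<alpha> (coord_vec A c p e))"
  proof
    fix x y show "\<alpha> (coord_vec A c p (x + y)) = \<alpha> (coord_vec A c p x) + \<alpha> (coord_vec A c p y)"
      using assms coord_vec_linear[of c p 1 x 1 y]
        cotangent_linear[of \<alpha> p "coord_vec A c p x" "coord_vec A c p y" 1 1] by simp
  next
    fix t x show "\<alpha> (coord_vec A c p (t *\<^sub>R x)) = t *\<^sub>R \<alpha> (coord_vec A c p x)"
      using assms coord_vec_linear[of c p t x 0 x]
        cotangent_linear[of \<alpha> p "coord_vec A c p x" "coord_vec A c p x" t 0] by simp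
  qed
  then show ?thesis
    by (simp add: covec_coords_def bounded_linear_Blinfun_apply bounded_linear_frame)
qed

lemma cotangent_apply:
  assumes "\<alpha> \<in> cotangent_space A p" "c \<in> A" "p \<in> fst c" "v \<in> tangent_space A p"
  shows "\<alpha> v = blinfun_apply (covec_coords A c p \<alpha>) (v c)"
  using assms by simp

lemma cotangent_spaceI:
  assumes "c \<in> A" "p \<in> fst c"
    and "\<And>v. v \<in> tangent_space A p \<Longrightarrow> \<alpha> v = f (v c)" "linear f"
    and "\<And>v. v \<notin> tangent_space A p \<Longrightarrow> \<alpha> v = 0"
  shows "\<alpha> \<in> cotangent_space A p"
  unfolding cotangent_space_def linear_between_def
  using assms(3,5)
  by (simp add: tangent_space_linear linear_add[OF assms(4)] linear_scale[OF assms(4)])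

lemma cotangent_space_eqI:
  assumes "\<alpha> \<in> cotangent_space A p" "\<beta> \<in> cotangent_space A p" "c \<in> A" "p \<in> fst c"
    and "covec_coords A c p \<alpha> = covec_coords A c p \<beta>"
  shows "\<alpha> = \<beta>"
proof
  fix v show "\<alpha> v = \<beta> v"
  proof (cases "v \<in> tangent_space A p")
    case True
    show ?thesis
      unfolding cotangent_apply[OF assms(1,3,4) True] cotangent_apply[OF assms(2,3,4) True] assms(5)
        ..
  next
    case False
    then show ?thesis using assms(1,2) by (simp add: cotangent_off)
  qed
qed

lemma coord_covec_in [simp]: "c \<in> A \<Longrightarrow> p \<in> fst c \<Longrightarrow> coord_covec A c p a \<in> cotangent_space A p"
  by (rule cotangent_spaceI[of c p _ "blinfun_apply a"])
    (simp_all add: coord_covec_def bounded_linear.linear blinfun.bounded_linear_right)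

lemma coord_covec_apply: "v \<in> tangent_space A p \<Longrightarrow> coord_covec A c p a v = blinfun_apply a (v c)"
  by (simp add: coord_covec_def)

lemma covec_coords_coord_covec [simp]:
  "c \<in> A \<Longrightarrow> p \<in> fst c \<Longrightarrow> covec_coords A c p (coord_covec A c p a) = a"
  by (rule blinfun_eqI) (simp add: coord_covec_apply)

lemma coord_covec_of [simp]:
  "\<alpha> \<in> cotangent_space A p \<Longrightarrow> c \<in> A \<Longrightarrow> p \<in> fst c \<Longrightarrow> coord_covec A c p (covec_coords A c p \<alpha>) = \<alpha>"
  by (rule cotangent_space_eqI) auto

lemma mem_cotangent_chart [simp]:
  "(p, \<alpha>) \<in> fst (cotangent_chart A c) \<longleftrightarrow> p \<in> fst c \<and> \<alpha> \<in> cotangent_space A p"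
  by (simp add: cotangent_chart_def)

lemma snd_cotangent_chart [simp]: "snd (cotangent_chart A c) (p, \<alpha>)
  = (snd c p, covec_coords A c p \<alpha>)"
  by (simp add: cotangent_chart_def covec_coords_def)

lemma inj_cotangent_chart: "c \<in> A \<Longrightarrow> inj_on (snd (cotangent_chart A c)) (fst (cotangent_chart A c))"
  by (rule inj_onI) (clarsimp, metis inj inj_on_eq_iff cotangent_space_eqI)

lemma chart_inv_cotangent_chart [simp]:
  assumes "c \<in> A" "p \<in> fst c"
  shows "chart_inv (cotangent_chart A c) (snd c p, a) = (p, coord_covec A c p a)"
  by (rule inv_into_f_eq[OF inj_cotangent_chart]) (use assms in auto)

lemma image_cotangent_chart_overlap:
  assumes "c \<in> A"
  shows "snd (cotangent_chart A c) ` (fst (cotangent_chart A c) \<inter> fst (cotangent_chart A d))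
    = snd c ` (fst c \<inter> fst d) \<times> (UNIV :: ('e \<Rightarrow>\<^sub>L real) set)"
proof (intro equalityI subsetI)
  fix y assume "y \<in> snd c ` (fst c \<inter> fst d) \<times> (UNIV :: ('e \<Rightarrow>\<^sub>L real) set)"
  then obtain p a where "p \<in> fst c" "p \<in> fst d" "y = (snd c p, a :: 'e \<Rightarrow>\<^sub>L real)" by auto
  then have "y = snd (cotangent_chart A c) (p, coord_covec A c p a)"
    "(p, coord_covec A c p a) \<in> fst (cotangent_chart A c) \<inter> fst (cotangent_chart A d)"
    using assms by auto
  then show "y \<in> snd (cotangent_chart A c) ` (fst (cotangent_chart A c) \<inter> fst (cotangent_chart A
    d))"
    by blast
qed auto

text \<open>Covectors are pulled back along the inverse change of chart, so the Jacobian of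
  \<open>transition d c\<close> is evaluated at the transformed base point. Differentiating it puts
  \<open>jacobian c d p h\<close> into the Hessian. The derivative is found for each fixed
  \<open>e\<close> and then assembled in the dual space.\<close>

lemma cotangent_transition_has_derivative:
  assumes "c \<in> A" "d \<in> A" "p \<in> fst c" "p \<in> fst d"
  obtains D where
    "(transition (cotangent_chart A c) (cotangent_chart A d) has_derivative D) (at (snd c p, a))"
    "\<And>h k. fst (D (h, k)) = jacobian c d p h"
    "\<And>h k e. blinfun_apply (snd (D (h, k))) e
       = blinfun_apply a (hessian d c p e (jacobian c d p h)) + blinfun_apply k (jacobian d c p e)"
proof -
  let ?O = "snd c ` (fst c \<inter> fst d) \<times> (UNIV :: ('e \<Rightarrow>\<^sub>L real) set)"
  let ?G = "\<lambda>z. snd (transition (cotangent_chart A c) (cotangent_chart A d) z)"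
  have O: "open ?O" "(snd c p, a) \<in> ?O"
    using assms open_overlap[of c d] by (auto intro: open_Times)
  have G: "((\<lambda>z. blinfun_apply (?G z) e) has_derivative
      (\<lambda>k. blinfun_apply a (hessian d c p e (jacobian c d p (fst k)))
        + blinfun_apply (snd k) (jacobian d c p e)))
      (at (snd c p, a))" for e
  proof (rule has_derivative_transform_within_open[OF _ O])
    have 1: "((\<lambda>z. transition c d (fst z)) has_derivative (\<lambda>k. jacobian c d p (fst k)))
      (at (snd c p, a))"
      by (rule has_derivative_compose[OF has_derivative_fst[OF has_derivative_ident]])
        (use assms transition_has_derivative in simp)
    have 2: "((\<lambda>z. frechet_derivative (transition d c) (at (transition c d (fst z))) e)
      has_derivative
       (\<lambda>k. hessian d c p e (jacobian c d p (fst k)))) (at (snd c p, a))"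
      by (rule has_derivative_compose[OF 1]) (use assms jacobian_has_derivative in simp)
    have "((\<lambda>z. blinfun_apply (snd z) (frechet_derivative (transition d c)
      (at (transition c d (fst z))) e)) has_derivative
      (\<lambda>k. blinfun_apply (snd (snd c p, a)) (hessian d c p e (jacobian c d p (fst k)))
        + blinfun_apply (snd k) (frechet_derivative (transition d c)
          (at (transition c d (fst (snd c p, a)))) e)))
      (at (snd c p, a))"
      by (rule blinfun.FDERIV[OF has_derivative_snd[OF has_derivative_ident] 2])
    then show "((\<lambda>z. blinfun_apply (snd z) (frechet_derivative (transition d c)
      (at (transition c d (fst z))) e)) has_derivative
      (\<lambda>k. blinfun_apply a (hessian d c p e (jacobian c d p (fst k)))
        + blinfun_apply (snd k) (jacobian d c p e)))
      (at (snd c p, a))"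
      using assms by (simp add: jacobian_def)
    show "blinfun_apply (snd z) (frechet_derivative (transition d c) (at (transition c d (fst z)))
      e)
      = blinfun_apply (?G z) e" if "z \<in> ?O" for z
      using that assms by (auto simp: coord_covec_apply coord_vec_apply jacobian_def
        transition_def[of "cotangent_chart A c"] elim!: overlapE)
  qed
  obtain G' where G': "(?G has_derivative G') (at (snd c p, a))"
    "\<And>k e. blinfun_apply (G' k) e
       = blinfun_apply a (hessian d c p e (jacobian c d p (fst k)))
         + blinfun_apply (snd k) (jacobian d c p e)"
    using has_derivative_blinfunI[OF frame G] by blast
  have "((\<lambda>z. (transition c d (fst z), ?G z)) has_derivative (\<lambda>k. (jacobian c d p (fst k), G' k)))
    (at (snd c p, a))"
  proof (rule has_derivative_Pair[OF _ G'(1)])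
    show "((\<lambda>z. transition c d (fst z)) has_derivative (\<lambda>k. jacobian c d p (fst k)))
      (at (snd c p, a))"
      by (rule has_derivative_compose[OF has_derivative_fst[OF has_derivative_ident]])
        (use assms transition_has_derivative in simp)
  qed
  then have "(transition (cotangent_chart A c) (cotangent_chart A d) has_derivative
      (\<lambda>k. (jacobian c d p (fst k), G' k))) (at (snd c p, a))"
    by (rule has_derivative_transform_within_open[OF _ O])
      (use assms in \<open>auto simp: transition_def[of "cotangent_chart A c"] elim!: overlapE\<close>)
  then show thesis by (rule that) (simp_all add: G'(2))
qed

lemma c1_cotangent_atlas: "c1_atlas (cotangent_atlas A)"
proof
  fix C D assume C: "C \<in> cotangent_atlas A" then obtain c where c: "c \<in> A" "C = cotangent_chart A c"
    by (auto simp: cotangent_atlas_def)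
  show "inj_on (snd C) (fst C)" using inj_cotangent_chart c by simp
  assume "D \<in> cotangent_atlas A" then obtain d where d: "d \<in> A" "D = cotangent_chart A d"
    by (auto simp: cotangent_atlas_def)
  show "open (snd C ` (fst C \<inter> fst D))"
    using c d open_overlap by (simp add: image_cotangent_chart_overlap open_Times)
  fix z assume "z \<in> fst C" "z \<in> fst D"
  then show "transition C D differentiable (at (snd C z))"
    using cotangent_transition_has_derivative[of c d "fst z" "snd (snd C z)"] c d
    by (cases z) (metis differentiableI fst_conv mem_cotangent_chart snd_conv snd_cotangent_chart)
qed

end

section \<open>Tangent maps of bundle maps\<close>

context c1_atlas
begin

text \<open>One computation for the three maps sharp, \<open>r\<close> and \<open>dual A r\<close>.
  Here \<open>S\<close> and \<open>T\<close> produce the induced charts of the source and target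
  bundles, \<open>\<sigma>\<close> inverts the fibre coordinate of \<open>S c\<close>, and
  \<open>f\<close> is the coordinate expression of \<open>F\<close>.\<close>

lemma bundle_map_tangent_map:
  fixes S :: "('a, 'e) chart \<Rightarrow> ('a \<times> 'v, 'e \<times> 'k::real_normed_vector) chart"
    and T :: "('a, 'e) chart \<Rightarrow> ('a \<times> 'w, 'e \<times> 'l::real_normed_vector) chart"
  assumes S: "c1_atlas (S ` A)" "\<And>c. c \<in> A \<Longrightarrow> fst (S c) = Sigma (fst c) V"
    and inv_S: "\<And>q k. q \<in> fst c \<Longrightarrow> chart_inv (S c) (snd c q, k) = (q, \<sigma> q k)"
      "\<And>q k. q \<in> fst c \<Longrightarrow> \<sigma> q k \<in> V q"
    and T: "c1_atlas (T ` A)" "\<And>c. c \<in> A \<Longrightarrow> fst (T c) = Sigma (fst c) W"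
    and F: "\<And>q v. q \<in> fst c \<Longrightarrow> v \<in> V q \<Longrightarrow> F q v \<in> W q"
    and f: "\<And>q k. q \<in> fst c \<Longrightarrow> snd (T c) (q, F q (\<sigma> q k)) = (snd c q, f (snd c q) k)"
    and frame: "finite_frame I \<phi> (b :: 'i \<Rightarrow> 'k)"
    and lin: "\<And>q. q \<in> fst c \<Longrightarrow> linear (f (snd c q))"
    and diff: "\<And>k. (\<lambda>x. f x k) differentiable (at (snd c p))"
    and p: "c \<in> A" "p \<in> fst c" "v \<in> V p"
    and v: "snd (S c) (p, v) = (snd c p, k)"
    and u: "u \<in> tangent_space (S ` A) (p, v)" "u (S c) = (h, k')"
  shows "snd (tangent_map (S ` A) (T ` A) (bundle_map F) ((p, v), u)) \<in> tangent_space (T ` A) (p,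
    F p v)"
    and "snd (tangent_map (S ` A) (T ` A) (bundle_map F) ((p, v), u)) (T c)
      = (h, frechet_derivative (\<lambda>x. f x k) (at (snd c p)) h + f (snd c p) k')"
proof -
  let ?D = "\<lambda>z. (fst z, frechet_derivative (\<lambda>x. f x k) (at (snd c p)) (fst z) + f
    (snd c p) (snd z))"
  have "((\<lambda>z. f (fst z) (snd z)) has_derivative
     (\<lambda>z. frechet_derivative (\<lambda>x. f x (snd (snd c p, k))) (at (fst (snd c p, k))) (fst z)
        + f (fst (snd c p, k)) (snd z))) (at (snd c p, k))"
    by (rule has_derivative_fibrewise_linear[OF frame open_chart_image[OF p(1)]])
      (use p lin diff in \<open>auto intro: has_derivative_fst has_derivative_snd has_derivative_ident\<close>)
  then have "((\<lambda>z. (fst z, f (fst z) (snd z))) has_derivative ?D) (at (snd c p, k))"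
    by (intro has_derivative_Pair has_derivative_fst[OF has_derivative_ident]) simp
  then have D: "((\<lambda>z. snd (T c) (bundle_map F (chart_inv (S c) z))) has_derivative ?D)
    (at (snd (S c) (p, v)))"
    unfolding v
    by (rule has_derivative_transform_within_open[where s = "chart_image c \<times> UNIV"])
      (use p open_chart_image[OF p(1)] in \<open>auto simp: bundle_map_def inv_S f intro: open_Times\<close>)
  have Sc: "S c \<in> S ` A" "(p, v) \<in> fst (S c)" and Tc: "T c \<in> T ` A" "bundle_map F (p, v) \<in> fst
    (T c)"
    using p F S(2)[OF p(1)] T(2)[OF p(1)] by (simp_all add: bundle_map_def)
  show "snd (tangent_map (S ` A) (T ` A) (bundle_map F) ((p, v), u)) (T c)
      = (h, frechet_derivative (\<lambda>x. f x k) (at (snd c p)) h + f (snd c p) k')"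
    using c1_atlas.tangent_map_apply[where f = "bundle_map F", OF S(1) Sc u(1) Tc D] u(2) by simp
  \<comment> \<open>Bundle maps here cover the identity, so base points over the overlap of
    \<open>c\<close> and \<open>d\<close> remain in both target charts.\<close>
  have "\<exists>N. open N \<and> snd (S c) (p, v) \<in> N \<and> (\<forall>x\<in>N. bundle_map F (chart_inv (S c) x) \<in> fst e \<inter> fst
    (T c))"
    if e: "e \<in> T ` A" "bundle_map F (p, v) \<in> fst e" for e
  proof -
    obtain d where d: "d \<in> A" "e = T d" using e by blast
    have pd: "p \<in> fst d" using e d(2) T(2)[OF d(1)] by (simp add: bundle_map_def)
    show ?thesis
    proof (intro exI conjI ballI)
      show "open (snd c ` (fst c \<inter> fst d) \<times> (UNIV :: 'k set))"
        using open_overlap[OF p(1) d(1)] by (intro open_Times) auto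
      show "snd (S c) (p, v) \<in> snd c ` (fst c \<inter> fst d) \<times> UNIV" using v p pd by auto
      fix x assume "x \<in> snd c ` (fst c \<inter> fst d) \<times> (UNIV :: 'k set)"
      then obtain q l where "q \<in> fst c" "q \<in> fst d" "x = (snd c q, l)" by auto
      then show "bundle_map F (chart_inv (S c) x) \<in> fst e \<inter> fst (T c)"
        using d(2) T(2)[OF d(1)] T(2)[OF p(1)] by (simp add: bundle_map_def inv_S F)
    qed
  qed
  from c1_atlas.tangent_map_in[where f = "bundle_map F", OF S(1) T(1) Sc u(1) Tc D this]
  show "snd (tangent_map (S ` A) (T ` A) (bundle_map F) ((p, v), u)) \<in> tangent_space (T ` A) (p,
    F p v)"
    by (simp add: bundle_map_def)
qed

end

section \<open>The canonical symplectic form in coordinates\<close>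

context c2_atlas
begin

lemma tautological_form_coords:
  assumes c: "c \<in> A" "p \<in> fst c" and \<alpha>: "\<alpha> \<in> cotangent_space A p"
    and w: "w \<in> tangent_space (cotangent_atlas A) (p, \<alpha>)"
  shows "tautological_form A (p, \<alpha>) w
    = blinfun_apply (covec_coords A c p \<alpha>) (fst (w (cotangent_chart A c)))"
proof -
  let ?C = "cotangent_chart A c" and ?w = "snd (tangent_map (cotangent_atlas A) A fst ((p, \<alpha>), w))"
  have C: "?C \<in> cotangent_atlas A" "(p, \<alpha>) \<in> fst ?C"
    using c \<alpha> by (auto simp: cotangent_atlas_def)
  have c': "c \<in> A" "fst (p, \<alpha>) \<in> fst c" using c by auto
  have D: "((\<lambda>x. snd c (fst (chart_inv ?C x))) has_derivative fst) (at (snd ?C (p, \<alpha>)))"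
    by (rule has_derivative_transform_within_open[where s = "chart_image c \<times> UNIV",
          OF has_derivative_fst[OF has_derivative_ident]])
      (use c open_chart_image[of c] in \<open>auto intro: open_Times\<close>)
  have "\<exists>N. open N \<and> snd ?C (p, \<alpha>) \<in> N \<and> (\<forall>x\<in>N. fst (chart_inv ?C x) \<in> fst e \<inter> fst c)"
    if e: "e \<in> A" "fst (p, \<alpha>) \<in> fst e" for e
    using e c open_overlap[of c e]
    by (intro exI[of _ "snd c ` (fst c \<inter> fst e) \<times> UNIV"]) (auto intro: open_Times)
  from c1_atlas.tangent_map_in[where f = fst, OF c1_cotangent_atlas c1_atlas_axioms C w c' D this]
  have "?w \<in> tangent_space A p" by simp
  moreover have "?w c = fst (w ?C)"
    by (rule c1_atlas.tangent_map_apply[where f = fst, OF c1_cotangent_atlas C w c' D])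
  ultimately show ?thesis
    using w cotangent_apply[OF \<alpha> c, of ?w] by (simp add: tautological_form_def del:
      covec_coords_apply)
qed

text \<open>The chart of the cotangent bundle selected by the definition is induced by some chart of
  \<open>A\<close> around \<open>p\<close>, about which nothing more is known.\<close>

lemma canonical_symplectic_chart_at:
  assumes "p \<in> carrier A" "\<alpha> \<in> cotangent_space A p"
  obtains c where "c \<in> A" "p \<in> fst c"
    "\<And>u v. canonical_symplectic A (p, \<alpha>) u v
       = blinfun_apply (snd (v (cotangent_chart A c))) (fst (u (cotangent_chart A c)))
       - blinfun_apply (snd (u (cotangent_chart A c))) (fst (v (cotangent_chart A c)))"
proof -
  define C where "C = chart_at (cotangent_atlas A) (p, \<alpha>)"
  have "(p, \<alpha>) \<in> carrier (cotangent_atlas A)"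
    using assms chart_at_in[OF assms(1)] by (intro carrierI[of "cotangent_chart A (chart_at A p)"])
      (auto simp: cotangent_atlas_def)
  from chart_at_in[OF this] have Cin: "C \<in> cotangent_atlas A" "(p, \<alpha>) \<in> fst C"
    by (simp_all add: C_def)
  then obtain c where c: "c \<in> A" "C = cotangent_chart A c"
    unfolding cotangent_atlas_def by blast
  then have p: "p \<in> fst c" using Cin(2) by simp
  note c = c p
  let ?w = "\<lambda>e x. tautological_form A (chart_inv C x) (coord_vec (cotangent_atlas A) C (chart_inv C
    x) e)"
  \<comment> \<open>The component of the tautological form in the constant direction
    \<open>e\<close> is the fibre coordinate applied to \<open>fst e\<close>, hence a bounded linear
    function of the point and its own derivative.\<close>
  have w: "frechet_derivative (?w e) (at (snd C (p, \<alpha>))) h = blinfun_apply (snd h) (fst e)" for e h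
  proof -
    have "((\<lambda>x. blinfun_apply (snd x) (fst e)) has_derivative (\<lambda>h. blinfun_apply (snd h) (fst e)))
      (at (snd C (p, \<alpha>)))"
      by (intro bounded_linear_imp_has_derivative bounded_linear_intros)
    then have "(?w e has_derivative (\<lambda>h. blinfun_apply (snd h) (fst e))) (at (snd C (p, \<alpha>)))"
    proof (rule has_derivative_transform_within_open[where s = "chart_image c \<times> UNIV"])
      show "open (chart_image c \<times> (UNIV :: ('e \<Rightarrow>\<^sub>L real) set))" using open_chart_image[OF c(1)]
        by (intro open_Times) auto
      show "snd C (p, \<alpha>) \<in> chart_image c \<times> UNIV" using c by simp
      fix x assume "x \<in> chart_image c \<times> (UNIV :: ('e \<Rightarrow>\<^sub>L real) set)"
      then obtain q a where q: "q \<in> fst c" "x = (snd c q, a)" by auto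
      then have z: "chart_inv C x = (q, coord_covec A c q a)" using c by simp
      have zC: "(q, coord_covec A c q a) \<in> fst C" using c q by simp
      have "?w e x = blinfun_apply (covec_coords A c q (coord_covec A c q a))
          (fst (coord_vec (cotangent_atlas A) C (q, coord_covec A c q a) e (cotangent_chart A c)))"
        unfolding z
        by (rule tautological_form_coords)
          (use c q zC c1_atlas.coord_vec_in[OF c1_cotangent_atlas Cin(1)] in simp_all)
      then show "blinfun_apply (snd x) (fst e) = ?w e x"
        using c q c1_atlas.coord_vec_same[OF c1_cotangent_atlas Cin(1) zC] by simp
    qed
    then show ?thesis by (simp flip: frechet_derivative_at)
  qed
  show thesis
    by (rule that[OF c(1,3)])
      (simp add: canonical_symplectic_def ext_deriv_def Let_def w flip: C_def c(2))
qed

text \<open>The definition uses one unspecified chart. Under a change of chart the correction terms are second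
  derivatives of the transition map, which cancel by symmetry.\<close>

lemma canonical_symplectic_coords:
  assumes c: "c \<in> A" "p \<in> fst c" and \<alpha>: "\<alpha> \<in> cotangent_space A p"
    and u: "u \<in> tangent_space (cotangent_atlas A) (p, \<alpha>)"
    and v: "v \<in> tangent_space (cotangent_atlas A) (p, \<alpha>)"
  shows "canonical_symplectic A (p, \<alpha>) u v
    = blinfun_apply (snd (v (cotangent_chart A c))) (fst (u (cotangent_chart A c)))
    - blinfun_apply (snd (u (cotangent_chart A c))) (fst (v (cotangent_chart A c)))"
proof -
  obtain d where d: "d \<in> A" "p \<in> fst d"
    and \<omega>: "\<And>u v. canonical_symplectic A (p, \<alpha>) u v
       = blinfun_apply (snd (v (cotangent_chart A d))) (fst (u (cotangent_chart A d)))
       - blinfun_apply (snd (u (cotangent_chart A d))) (fst (v (cotangent_chart A d)))"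
    using canonical_symplectic_chart_at[OF carrierI[OF c] \<alpha>] by blast
  let ?C = "cotangent_chart A c" and ?D = "cotangent_chart A d" and ?a = "covec_coords A c p \<alpha>"
  obtain J where J: "(transition ?C ?D has_derivative J) (at (snd c p, ?a))"
    and J1: "\<And>h k. fst (J (h, k)) = jacobian c d p h"
    and J2: "\<And>h k e. blinfun_apply (snd (J (h, k))) e
       = blinfun_apply ?a (hessian d c p e (jacobian c d p h)) + blinfun_apply k (jacobian d c p e)"
    using cotangent_transition_has_derivative[OF c(1) d(1) c(2) d(2)] by blast
  have "jacobian ?C ?D (p, \<alpha>) = J"
    unfolding jacobian_def using frechet_derivative_at[OF J] by simp
  then have tr: "w ?D = J (w ?C)" if "w \<in> tangent_space (cotangent_atlas A) (p, \<alpha>)" for w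
    using c1_atlas.tangent_space_transform[OF c1_cotangent_atlas that, of ?C ?D] c d \<alpha>
    by (simp add: cotangent_atlas_def)
  have inv: "jacobian d c p (jacobian c d p h) = h" for h
    using jacobian_cocycle[OF c(1) d(1) c(1) c(2) d(2) c(2)] c by simp
  obtain hu ku hv kv where "u ?C = (hu, ku)" "v ?C = (hv, kv)" by (metis surj_pair)
  then show ?thesis
    using hessian_symmetric[OF d(1) c(1) d(2) c(2), of "jacobian c d p hu" "jacobian c d p hv"]
    by (simp add: \<omega> tr[OF u] tr[OF v] J1 J2 inv)
qed

end

section \<open>Bivector fields and endomorphism fields in coordinates\<close>

locale tensor_pair = c2_atlas A E for A :: "('a, 'e::real_inner) chart set" and E +
  fixes \<pi> :: "'a \<Rightarrow> ('a, 'e) cotvec \<Rightarrow> ('a, 'e) cotvec \<Rightarrow> real"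
    and r :: "'a \<Rightarrow> ('a, 'e) tvec \<Rightarrow> ('a, 'e) tvec"
  assumes bivector_linear: "p \<in> carrier A \<Longrightarrow> \<alpha> \<in> cotangent_space A p \<Longrightarrow>
      linear_between (cotangent_space A p) UNIV (\<pi> p \<alpha>)"
    and bivector_skew: "p \<in> carrier A \<Longrightarrow> \<alpha> \<in> cotangent_space A p \<Longrightarrow> \<beta> \<in> cotangent_space A p \<Longrightarrow>
      \<pi> p \<alpha> \<beta> = - \<pi> p \<beta> \<alpha>"
    and bivector_differentiable: "c \<in> A \<Longrightarrow> p \<in> fst c \<Longrightarrow>
      (\<lambda>x. \<pi> (chart_inv c x) (coord_covec A c (chart_inv c x) a) (coord_covec A c (chart_inv c x)
        b))
        differentiable (at (snd c p))"
    and endo_linear: "p \<in> carrier A \<Longrightarrow> linear_between (tangent_space A p) (tangent_space A p) (r p)"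
    and endo_differentiable: "c \<in> A \<Longrightarrow> p \<in> fst c \<Longrightarrow>
      (\<lambda>x. r (chart_inv c x) (coord_vec A c (chart_inv c x) e) c) differentiable (at (snd c p))"
begin

definition R :: "('a, 'e) chart \<Rightarrow> 'e \<Rightarrow> 'e \<Rightarrow> 'e" where
  "R c x e = r (chart_inv c x) (coord_vec A c (chart_inv c x) e) c"

definition P :: "('a, 'e) chart \<Rightarrow> 'e \<Rightarrow> ('e \<Rightarrow>\<^sub>L real) \<Rightarrow> 'e" where
  "P c x a = sharp A \<pi> (chart_inv c x) (coord_covec A c (chart_inv c x) a) c"

definition DR :: "('a, 'e) chart \<Rightarrow> 'a \<Rightarrow> 'e \<Rightarrow> 'e \<Rightarrow> 'e" where
  "DR c p e = frechet_derivative (\<lambda>x. R c x e) (at (snd c p))"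

definition DP :: "('a, 'e) chart \<Rightarrow> 'a \<Rightarrow> ('e \<Rightarrow>\<^sub>L real) \<Rightarrow> 'e \<Rightarrow> 'e" where
  "DP c p a = frechet_derivative (\<lambda>x. P c x a) (at (snd c p))"

lemma R_snd: "c \<in> A \<Longrightarrow> p \<in> fst c \<Longrightarrow> R c (snd c p) e = r p (coord_vec A c p e) c"
  by (simp add: R_def)

lemma P_snd: "c \<in> A \<Longrightarrow> p \<in> fst c \<Longrightarrow> P c (snd c p) a = sharp A \<pi> p (coord_covec A c p a) c"
  by (simp add: P_def)

lemma endo_in: "c \<in> A \<Longrightarrow> p \<in> fst c \<Longrightarrow> v \<in> tangent_space A p \<Longrightarrow> r p v \<in> tangent_space A p"
  using endo_linear[OF carrierI] unfolding linear_between_def by blast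

lemma endo_coords: "c \<in> A \<Longrightarrow> p \<in> fst c \<Longrightarrow> v \<in> tangent_space A p \<Longrightarrow> r p v c = R c (snd c p) (v c)"
  by (simp add: R_snd)

lemma linear_R:
  assumes "c \<in> A" "p \<in> fst c"
  shows "linear (R c (snd c p))"
proof
  have lin: "r p (s *\<^sub>R v + t *\<^sub>R w) = s *\<^sub>R r p v + t *\<^sub>R r p w"
    if "v \<in> tangent_space A p" "w \<in> tangent_space A p" for s t v w
    using endo_linear[OF carrierI[OF assms]] that unfolding linear_between_def by blast
  show "R c (snd c p) (x + y) = R c (snd c p) x + R c (snd c p) y" for x y
    using lin[of "coord_vec A c p x" "coord_vec A c p y" 1 1] coord_vec_linear[of c p 1 x 1 y] assms
    by (simp add: R_snd)
  show "R c (snd c p) (t *\<^sub>R x) = t *\<^sub>R R c (snd c p) x" for t x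
    using lin[of "coord_vec A c p x" "coord_vec A c p x" t 0] coord_vec_linear[of c p t x 0 x] assms
    by (simp add: R_snd)
qed

lemma R_has_derivative:
  assumes "c \<in> A" "p \<in> fst c"
  shows "((\<lambda>x. R c x e) has_derivative DR c p e) (at (snd c p))"
  using endo_differentiable[OF assms] frechet_derivative_works unfolding DR_def R_def by blast

lemma coord_covec_linear:
  "coord_covec A c p (s *\<^sub>R a + t *\<^sub>R b) = s *\<^sub>R coord_covec A c p a + t *\<^sub>R coord_covec A c p b"
  by (simp add: coord_covec_def fun_eq_iff blinfun.add_left blinfun.scaleR_left)

lemma linear_bivector_coords:
  assumes "c \<in> A" "p \<in> fst c" "\<alpha> \<in> cotangent_space A p"
  shows "linear (\<lambda>a. \<pi> p \<alpha> (coord_covec A c p a))"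
proof
  have lin: "\<pi> p \<alpha> (s *\<^sub>R \<beta> + t *\<^sub>R \<gamma>) = s * \<pi> p \<alpha> \<beta> + t * \<pi> p \<alpha> \<gamma>"
    if "\<beta> \<in> cotangent_space A p" "\<gamma> \<in> cotangent_space A p" for s t \<beta> \<gamma>
    using bivector_linear[OF carrierI[OF assms(1,2)] assms(3)] that unfolding linear_between_def
      by simp
  show "\<pi> p \<alpha> (coord_covec A c p (x + y)) = \<pi> p \<alpha> (coord_covec A c p x)
    + \<pi> p \<alpha> (coord_covec A c p y)" for x y
    using lin[of "coord_covec A c p x" "coord_covec A c p y" 1 1] coord_covec_linear[of c p 1 x 1 y]
      assms
    by simp
  show "\<pi> p \<alpha> (coord_covec A c p (t *\<^sub>R x)) = t *\<^sub>R \<pi> p \<alpha> (coord_covec A c p x)" for t x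
    using lin[of "coord_covec A c p x" "coord_covec A c p x" t 0] coord_covec_linear[of c p t x 0 x]
      assms
    by simp
qed

text \<open>Supplies the witness for the definite description: its components along the orthonormal
  set \<open>E\<close> are the values of \<open>\<pi> p \<alpha>\<close> on the dual frame.
  Uniqueness follows by testing against the covectors given by inner products.\<close>

lemma sharp_eqI:
  assumes c: "c \<in> A" "p \<in> fst c" and \<alpha>: "\<alpha> \<in> cotangent_space A p"
  defines "v \<equiv> coord_vec A c p (\<Sum>b\<in>E. \<pi> p \<alpha> (coord_covec A c p (blinfun_inner_left b)) *\<^sub>R b)"
  shows "sharp A \<pi> p \<alpha> = v"
  unfolding sharp_def
proof (rule the_equality, intro conjI ballI)
  show v: "v \<in> tangent_space A p" using c by (simp add: v_def)
  show pairing: "\<beta> v = \<pi> p \<alpha> \<beta>" if \<beta>: "\<beta> \<in> cotangent_space A p" for \<beta>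
  proof -
    let ?a = "covec_coords A c p \<beta>"
    note lin = linear_bivector_coords[OF c \<alpha>]
    have "\<pi> p \<alpha> \<beta> = \<pi> p \<alpha> (coord_covec A c p (\<Sum>b\<in>E. blinfun_apply ?a b *\<^sub>R blinfun_inner_left b))"
      unfolding finite_frameD(3)[OF finite_frame_blinfun[OF frame]] using \<beta> c by simp
    also have "\<dots> = (\<Sum>b\<in>E. blinfun_apply ?a b * \<pi> p \<alpha> (coord_covec A c p (blinfun_inner_left b)))"
      by (simp add: linear_sum[OF lin] linear_scale[OF lin] del: covec_coords_apply)
    also have "\<dots> = blinfun_apply ?a (v c)"
      using c by (simp add: v_def blinfun.sum_right blinfun.scaleR_right mult.commute del:
        covec_coords_apply)
    finally show ?thesis using cotangent_apply[OF \<beta> c v] by simp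
  qed
  fix w assume w: "w \<in> tangent_space A p \<and> (\<forall>\<beta>\<in>cotangent_space A p. \<beta> w = \<pi> p \<alpha> \<beta>)"
  have "w c \<bullet> y = v c \<bullet> y" for y
    using w pairing[of "coord_covec A c p (blinfun_inner_left y)"] v c
      coord_covec_apply[of w p c "blinfun_inner_left y"] coord_covec_apply[of v p c
        "blinfun_inner_left y"]
    by (simp add: inner_commute)
  then have "w c = v c" using vector_eq_rdot by blast
  then show "w = v" using w v c tangent_space_eqI by blast
qed

lemma sharp_in: "c \<in> A \<Longrightarrow> p \<in> fst c \<Longrightarrow> \<alpha> \<in> cotangent_space A p \<Longrightarrow> sharp A \<pi> p \<alpha> \<in> tangent_space A p"
  by (simp add: sharp_eqI)

lemma sharp_coords:
  "c \<in> A \<Longrightarrow> p \<in> fst c \<Longrightarrow> \<alpha> \<in> cotangent_space A p \<Longrightarrow>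
    sharp A \<pi> p \<alpha> c = P c (snd c p) (covec_coords A c p \<alpha>)"
  by (simp add: P_snd)

lemma P_expand:
  assumes "c \<in> A" "p \<in> fst c"
  shows "P c (snd c p) a
    = (\<Sum>b\<in>E. \<pi> p (coord_covec A c p a) (coord_covec A c p (blinfun_inner_left b)) *\<^sub>R b)"
  using assms by (simp add: P_snd sharp_eqI)

text \<open>Linearity of \<open>\<pi>\<close> is given in its second argument; skew-symmetry moves
  the covector there.\<close>

lemma linear_P:
  assumes c: "c \<in> A" "p \<in> fst c"
  shows "linear (P c (snd c p))"
proof -
  have "linear (\<lambda>a. \<Sum>b\<in>E. (- \<pi> p (coord_covec A c p (blinfun_inner_left b)) (coord_covec A c p a))
    *\<^sub>R b)"
  proof (rule linear_compose_sum, rule ballI)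
    fix b
    note lin = linear_bivector_coords[OF c coord_covec_in[OF c], of "blinfun_inner_left b"]
    show "linear (\<lambda>a. (- \<pi> p (coord_covec A c p (blinfun_inner_left b)) (coord_covec A c p a)) *\<^sub>R
      b)"
      by (rule linearI) (simp_all add: linear_add[OF lin] linear_scale[OF lin] scaleR_left.add
        scaleR_left_diff_distrib)
  qed
  moreover have "P c (snd c p) = (\<lambda>a. \<Sum>b\<in>E. (- \<pi> p (coord_covec A c p (blinfun_inner_left b))
    (coord_covec A c p a)) *\<^sub>R b)"
    by (rule ext) (simp only: P_expand[OF c] bivector_skew[OF carrierI[OF c] coord_covec_in[OF c]
      coord_covec_in[OF c], symmetric])
  ultimately show ?thesis by simp
qed

lemma P_has_derivative:
  assumes c: "c \<in> A" "p \<in> fst c"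
  shows "((\<lambda>x. P c x a) has_derivative DP c p a) (at (snd c p))"
proof -
  let ?g = "\<lambda>b x. \<pi> (chart_inv c x) (coord_covec A c (chart_inv c x) a)
      (coord_covec A c (chart_inv c x) (blinfun_inner_left b))"
  have "((\<lambda>x. \<Sum>b\<in>E. ?g b x *\<^sub>R b) has_derivative
      (\<lambda>h. \<Sum>b\<in>E. frechet_derivative (?g b) (at (snd c p)) h *\<^sub>R b)) (at (snd c p))"
    using bivector_differentiable[OF c] frechet_derivative_works
    by (intro has_derivative_sum has_derivative_scaleR_left) blast
  then have "((\<lambda>x. P c x a) has_derivative
      (\<lambda>h. \<Sum>b\<in>E. frechet_derivative (?g b) (at (snd c p)) h *\<^sub>R b)) (at (snd c p))"
    by (rule has_derivative_transform_within_open[OF _ open_chart_image[OF c(1)]])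
      (use c P_expand[OF c(1)] in auto)
  then show ?thesis unfolding DP_def using differentiableI frechet_derivative_works by blast
qed

text \<open>Linearity in the vector to which \<open>R\<close> is applied, inherited from each
  \<open>R c x\<close> by uniqueness of derivatives; linearity in the direction of differentiation
  is \<open>linear_DR2\<close>.\<close>

lemma linear_DR:
  assumes c: "c \<in> A" "p \<in> fst c"
  shows "linear (\<lambda>e. DR c p e h)"
proof
  fix x y and t :: real
  have "((\<lambda>z. R c z x + R c z y) has_derivative (\<lambda>h. DR c p x h + DR c p y h)) (at (snd c p))"
    by (intro has_derivative_add R_has_derivative c)
  then have "((\<lambda>z. R c z (x + y)) has_derivative (\<lambda>h. DR c p x h + DR c p y h)) (at (snd c p))"
    by (rule has_derivative_transform_within_open[OF _ open_chart_image[OF c(1)]])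
      (use c linear_add[OF linear_R[OF c(1)]] in auto)
  from has_derivative_unique[OF this R_has_derivative[OF c]]
  show "DR c p (x + y) h = DR c p x h + DR c p y h" by (simp add: fun_eq_iff)
  have "((\<lambda>z. t *\<^sub>R R c z x) has_derivative (\<lambda>h. t *\<^sub>R DR c p x h)) (at (snd c p))"
    by (intro has_derivative_scaleR_right R_has_derivative c)
  then have "((\<lambda>z. R c z (t *\<^sub>R x)) has_derivative (\<lambda>h. t *\<^sub>R DR c p x h)) (at (snd c p))"
    by (rule has_derivative_transform_within_open[OF _ open_chart_image[OF c(1)]])
      (use c linear_scale[OF linear_R[OF c(1)]] in auto)
  from has_derivative_unique[OF this R_has_derivative[OF c]]
  show "DR c p (t *\<^sub>R x) h = t *\<^sub>R DR c p x h" by (simp add: fun_eq_iff)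
qed

lemma linear_DR2: "c \<in> A \<Longrightarrow> p \<in> fst c \<Longrightarrow> linear (DR c p e)"
  using R_has_derivative has_derivative_linear by blast

definition R_blinfun :: "('a, 'e) chart \<Rightarrow> 'e \<Rightarrow> 'e \<Rightarrow>\<^sub>L 'e" where
  "R_blinfun c x = Blinfun (R c x)"

lemma R_blinfun_apply [simp]: "c \<in> A \<Longrightarrow> p \<in> fst c \<Longrightarrow> blinfun_apply (R_blinfun c (snd c p)) e = R c
  (snd c p) e"
  unfolding R_blinfun_def
  by (simp add: bounded_linear_Blinfun_apply bounded_linear_frame linear_R)

lemma dual_in:
  assumes c: "c \<in> A" "p \<in> fst c" and \<alpha>: "\<alpha> \<in> cotangent_space A p"
  shows "dual A r p \<alpha> \<in> cotangent_space A p"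
proof (rule cotangent_spaceI[OF c])
  show "linear (\<lambda>e. blinfun_apply (covec_coords A c p \<alpha>) (R c (snd c p) e))"
    using linear_compose[OF linear_R[OF c] bounded_linear.linear[OF blinfun.bounded_linear_right]]
    by (simp only: o_def)
  show "dual A r p \<alpha> v = blinfun_apply (covec_coords A c p \<alpha>) (R c (snd c p) (v c))"
    if "v \<in> tangent_space A p" for v
    using that cotangent_apply[OF \<alpha> c, of "r p v"] endo_in[OF c] endo_coords[OF c]
    by (simp add: dual_def del: covec_coords_apply)
qed (simp add: dual_def)

lemma dual_coords:
  assumes c: "c \<in> A" "p \<in> fst c" and \<alpha>: "\<alpha> \<in> cotangent_space A p"
  shows "covec_coords A c p (dual A r p \<alpha>) = covec_coords A c p \<alpha> o\<^sub>L R_blinfun c (snd c p)"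
proof (rule blinfun_eqI)
  fix e
  show "blinfun_apply (covec_coords A c p (dual A r p \<alpha>)) e
      = blinfun_apply (covec_coords A c p \<alpha> o\<^sub>L R_blinfun c (snd c p)) e"
    using cotangent_apply[OF \<alpha> c, of "r p (coord_vec A c p e)"] endo_in[OF c] dual_in[OF c \<alpha>] c
    by (simp add: R_snd) (simp add: dual_def)
qed

lemma has_derivative_dual_coords:
  fixes a :: "'e \<Rightarrow>\<^sub>L real"
  assumes c: "c \<in> A" "p \<in> fst c"
  shows "(\<lambda>x. a o\<^sub>L R_blinfun c x) differentiable (at (snd c p))"
    and "blinfun_apply (frechet_derivative (\<lambda>x. a o\<^sub>L R_blinfun c x) (at (snd c p)) h) e
      = blinfun_apply a (DR c p e h)"
proof -
  have "((\<lambda>x. blinfun_apply (a o\<^sub>L R_blinfun c x) e)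
    has_derivative (\<lambda>h. blinfun_apply a (DR c p e h))) (at (snd c p))" for e
  proof (rule has_derivative_transform_within_open[OF _ open_chart_image[OF c(1)]])
    show "((\<lambda>x. blinfun_apply a (R c x e)) has_derivative (\<lambda>h. blinfun_apply a (DR c p e h)))
      (at (snd c p))"
      by (rule bounded_linear.has_derivative[OF blinfun.bounded_linear_right R_has_derivative[OF
        c]])
  qed (use c in auto)
  from has_derivative_blinfunI[OF frame this]
  obtain G where G: "((\<lambda>x. a o\<^sub>L R_blinfun c x) has_derivative G) (at (snd c p))"
    "\<And>h e. blinfun_apply (G h) e = blinfun_apply a (DR c p e h)"
    by blast
  then show "(\<lambda>x. a o\<^sub>L R_blinfun c x) differentiable (at (snd c p))"
    by (auto intro: differentiableI)
  show "blinfun_apply (frechet_derivative (\<lambda>x. a o\<^sub>L R_blinfun c x) (at (snd c p)) h) e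
      = blinfun_apply a (DR c p e h)"
    using G(2) frechet_derivative_at[OF G(1)] by simp
qed

section \<open>The tangent maps and the lifts in coordinates\<close>

lemma fst_tangent_chart_Sigma: "fst (tangent_chart A c) = Sigma (fst c) (tangent_space A)"
  by (auto simp: tangent_chart_def)

lemma fst_cotangent_chart_Sigma: "fst (cotangent_chart A c) = Sigma (fst c) (cotangent_space A)"
  by (auto simp: cotangent_chart_def)

lemmas c1_tangent_atlas' = c1_tangent_atlas[unfolded tangent_atlas_def]
lemmas c1_cotangent_atlas' = c1_cotangent_atlas[unfolded cotangent_atlas_def]

lemma tangent_map_sharp:
  assumes c: "c \<in> A" "p \<in> fst c" and \<alpha>: "\<alpha> \<in> cotangent_space A p"
    and u: "u \<in> tangent_space (cotangent_atlas A) (p, \<alpha>)" "u (cotangent_chart A c) = (h, k)"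
  defines "w \<equiv> snd (tangent_map (cotangent_atlas A) (tangent_atlas A) (bundle_map (sharp A \<pi>))
    ((p, \<alpha>), u))"
  shows "w \<in> tangent_space (tangent_atlas A) (p, sharp A \<pi> p \<alpha>)"
    and "w (tangent_chart A c) = (h, DP c p (covec_coords A c p \<alpha>) h + P c (snd c p) k)"
proof -
  have P: "(\<lambda>x. P c x k) differentiable (at (snd c p))" for k
    using P_has_derivative[OF c] by (rule differentiableI)
  note * = bundle_map_tangent_map[where S = "cotangent_chart A" and T = "tangent_chart A"
      and V = "cotangent_space A" and W = "tangent_space A" and \<sigma> = "coord_covec A c" and f = "P c"
      and F = "sharp A \<pi>" and v = \<alpha> and k = "covec_coords A c p \<alpha>" and c = c and p = p and u
        = u and h = h and k' = k,
      OF c1_cotangent_atlas' fst_cotangent_chart_Sigma _ _ c1_tangent_atlas' fst_tangent_chart_Sigma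
        _ _
        finite_frame_blinfun[OF frame] linear_P[OF c(1)] P c \<alpha> _ u[unfolded cotangent_atlas_def]]
  show "w \<in> tangent_space (tangent_atlas A) (p, sharp A \<pi> p \<alpha>)"
    unfolding w_def tangent_atlas_def cotangent_atlas_def
    by (rule *(1)) (use c in \<open>simp_all add: sharp_in P_snd\<close>)
  show "w (tangent_chart A c) = (h, DP c p (covec_coords A c p \<alpha>) h + P c (snd c p) k)"
    unfolding w_def tangent_atlas_def cotangent_atlas_def DP_def
    by (rule *(2)) (use c in \<open>simp_all add: sharp_in P_snd\<close>)
qed

lemma tangent_map_endo:
  assumes c: "c \<in> A" "p \<in> fst c" and v: "v \<in> tangent_space A p"
    and u: "u \<in> tangent_space (tangent_atlas A) (p, v)" "u (tangent_chart A c) = (h, k)"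
  shows "snd (tangent_map (tangent_atlas A) (tangent_atlas A) (bundle_map r) ((p, v), u))
    (tangent_chart A c)
      = (h, DR c p (v c) h + R c (snd c p) k)"
proof -
  have R: "(\<lambda>x. R c x k) differentiable (at (snd c p))" for k
    using R_has_derivative[OF c] by (rule differentiableI)
  show ?thesis
    unfolding tangent_atlas_def DR_def
    by (rule bundle_map_tangent_map(2)[where S = "tangent_chart A" and T = "tangent_chart A"
      and V = "tangent_space A" and W = "tangent_space A" and \<sigma> = "coord_vec A c" and f = "R c"
      and F = r and v = v and k = "v c" and c = c and p = p and u = u and h = h and k' = k,
      OF c1_tangent_atlas' fst_tangent_chart_Sigma _ _ c1_tangent_atlas' fst_tangent_chart_Sigma _ _
        frame linear_R[OF c(1)] R c v _ u[unfolded tangent_atlas_def]])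
      (use c in \<open>simp_all add: endo_in R_snd\<close>)
qed

lemma tangent_map_dual:
  assumes c: "c \<in> A" "p \<in> fst c" and \<alpha>: "\<alpha> \<in> cotangent_space A p"
    and u: "u \<in> tangent_space (cotangent_atlas A) (p, \<alpha>)" "u (cotangent_chart A c) = (h, k)"
  defines "w \<equiv> snd (tangent_map (cotangent_atlas A) (cotangent_atlas A) (bundle_map (dual A r))
    ((p, \<alpha>), u))"
  shows "w \<in> tangent_space (cotangent_atlas A) (p, dual A r p \<alpha>)"
    and "fst (w (cotangent_chart A c)) = h"
    and "blinfun_apply (snd (w (cotangent_chart A c))) e
      = blinfun_apply (covec_coords A c p \<alpha>) (DR c p e h) + blinfun_apply k (R c (snd c p) e)"
proof -
  let ?f = "\<lambda>x a. a o\<^sub>L R_blinfun c x"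
  have lin: "linear (?f x)" for x
    by (intro bounded_linear.linear bounded_bilinear.bounded_linear_left[OF
      bounded_bilinear_blinfun_compose])
  note * = bundle_map_tangent_map[where S = "cotangent_chart A" and T = "cotangent_chart A"
      and V = "cotangent_space A" and W = "cotangent_space A" and \<sigma> = "coord_covec A c" and f = ?f
      and F = "dual A r" and v = \<alpha> and k = "covec_coords A c p \<alpha>" and c = c and p = p and u
        = u and h = h and k' = k,
      OF c1_cotangent_atlas' fst_cotangent_chart_Sigma _ _ c1_cotangent_atlas'
        fst_cotangent_chart_Sigma _ _
        finite_frame_blinfun[OF frame] lin has_derivative_dual_coords(1)[OF c] c \<alpha> _
          u[unfolded cotangent_atlas_def]]
  show "w \<in> tangent_space (cotangent_atlas A) (p, dual A r p \<alpha>)"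
    unfolding w_def cotangent_atlas_def
    by (rule *(1)) (use c in \<open>simp_all add: dual_in dual_coords\<close>)
  have "w (cotangent_chart A c) = (h, frechet_derivative (\<lambda>x. ?f x (covec_coords A c p \<alpha>))
    (at (snd c p)) h + ?f (snd c p) k)"
    unfolding w_def cotangent_atlas_def
    by (rule *(2)) (use c in \<open>simp_all add: dual_in dual_coords\<close>)
  then show "fst (w (cotangent_chart A c)) = h"
    "blinfun_apply (snd (w (cotangent_chart A c))) e
      = blinfun_apply (covec_coords A c p \<alpha>) (DR c p e h) + blinfun_apply k (R c (snd c p) e)"
    using c by (simp_all add: blinfun.add_left has_derivative_dual_coords(2)[OF c] del:
      covec_coords_apply)
qed

end

section \<open>Coordinate formulas for the cotangent and tangent lifts, and their comparison\<close>

context tensor_pair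
begin

text \<open>In the chart \<open>c\<close> this is the contraction with \<open>h\<close> of the
  exterior derivative of \<open>dual A r\<close> applied to the 1-form with constant coefficients
  \<open>a\<close>. No connection is involved.\<close>

definition torsion_form :: "('a, 'e) chart \<Rightarrow> 'a \<Rightarrow> ('e \<Rightarrow>\<^sub>L real) \<Rightarrow> 'e \<Rightarrow> 'e \<Rightarrow>\<^sub>L real" where
  "torsion_form c p a h = Blinfun (\<lambda>e. blinfun_apply a (DR c p e h) - blinfun_apply a (DR c p h e))"

lemma torsion_form_apply:
  assumes c: "c \<in> A" "p \<in> fst c"
  shows "blinfun_apply (torsion_form c p a h) e = blinfun_apply a (DR c p e h)
    - blinfun_apply a (DR c p h e)"
proof -
  have "linear (\<lambda>e. blinfun_apply a (DR c p e h) - blinfun_apply a (DR c p h e))"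
    by (rule linearI)
      (simp_all add: linear_add[OF linear_DR[OF c]] linear_scale[OF linear_DR[OF c]]
        linear_add[OF linear_DR2[OF c]] linear_scale[OF linear_DR2[OF c]]
        blinfun.add_right blinfun.scaleR_right right_diff_distrib)
  then show ?thesis
    by (simp add: torsion_form_def bounded_linear_Blinfun_apply bounded_linear_frame)
qed

text \<open>Against a test vector \<open>(y, l)\<close> the canonical form of \<open>w\<close> is
  \<open>l (fst w) - snd w y\<close>, while the pulled back form also contains the derivatives of
  \<open>R\<close> in the directions \<open>h\<close> and \<open>y\<close>. Comparing the
  coefficients of \<open>l\<close> and \<open>y\<close> determines both components. The two forms
  live at \<open>\<alpha>\<close> and at its image under \<open>dual A r\<close>, and both are
  evaluated in \<open>c\<close>.\<close>

lemma cotangent_lift_coords: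
  assumes c: "c \<in> A" "p \<in> fst c" and \<alpha>: "\<alpha> \<in> cotangent_space A p"
    and u: "u \<in> tangent_space (cotangent_atlas A) (p, \<alpha>)" "u (cotangent_chart A c) = (h, k)"
  shows "cotangent_lift A r ((p, \<alpha>), u) = ((p, \<alpha>), coord_vec (cotangent_atlas A) (cotangent_chart A
    c) (p, \<alpha>)
     (R c (snd c p) h, torsion_form c p (covec_coords A c p \<alpha>) h + (k o\<^sub>L R_blinfun c (snd c p))))"
proof -
  let ?C = "cotangent_chart A c" and ?a = "covec_coords A c p \<alpha>" and ?T
    = "tangent_space (cotangent_atlas A) (p, \<alpha>)"
  let ?b = "torsion_form c p ?a h + (k o\<^sub>L R_blinfun c (snd c p))"
  let ?w = "coord_vec (cotangent_atlas A) ?C (p, \<alpha>) (R c (snd c p) h, ?b)"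
  let ?\<rho> = "pullback_2form (cotangent_atlas A) (cotangent_atlas A) (bundle_map (dual A r))
    (canonical_symplectic A) (p, \<alpha>) u"
  have C: "?C \<in> cotangent_atlas A" "(p, \<alpha>) \<in> fst ?C"
    using c \<alpha> by (auto simp: cotangent_atlas_def)
  note coord_in = c1_atlas.coord_vec_in[OF c1_cotangent_atlas C]
    and coord_same = c1_atlas.coord_vec_same[OF c1_cotangent_atlas C]
  have \<rho>: "?\<rho> v = blinfun_apply (snd (v ?C)) (R c (snd c p) h) - blinfun_apply ?b (fst (v ?C))"
    if v: "v \<in> ?T" for v
  proof -
    obtain y l where yl: "v ?C = (y, l)" by fastforce
    note U = tangent_map_dual[OF c \<alpha> u] and V = tangent_map_dual[OF c \<alpha> v yl]
    have bm: "bundle_map (dual A r) (p, \<alpha>) = (p, dual A r p \<alpha>)" by (simp add: bundle_map_def)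
    show ?thesis
      unfolding pullback_2form_def bm canonical_symplectic_coords[OF c dual_in[OF c \<alpha>] U(1) V(1)]
      using c by (simp add: yl U(2,3) V(2,3) torsion_form_apply[OF c] blinfun.add_left
          del: covec_coords_apply)
  qed
  have \<omega>: "canonical_symplectic A (p, \<alpha>) w v = blinfun_apply (snd (v ?C)) (fst (w ?C))
    - blinfun_apply (snd (w ?C)) (fst (v ?C))"
    if "w \<in> ?T" "v \<in> ?T" for w v
    by (rule canonical_symplectic_coords[OF c \<alpha> that])
  have "(THE w. w \<in> ?T \<and> (\<forall>v\<in>?T. canonical_symplectic A (p, \<alpha>) w v = ?\<rho> v)) = ?w"
  proof (rule the_equality, intro conjI ballI)
    show "?w \<in> ?T" by (rule coord_in)
    then show "canonical_symplectic A (p, \<alpha>) ?w v = ?\<rho> v" if "v \<in> ?T" for v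
      using that by (simp add: \<omega> \<rho> coord_same)
    fix w assume w: "w \<in> ?T \<and> (\<forall>v\<in>?T. canonical_symplectic A (p, \<alpha>) w v = ?\<rho> v)"
    have eq: "blinfun_apply l (fst (w ?C)) - blinfun_apply (snd (w ?C)) y
        = blinfun_apply l (R c (snd c p) h) - blinfun_apply ?b y" for y l
      using w \<omega>[of w "coord_vec (cotangent_atlas A) ?C (p, \<alpha>) (y, l)"]
        \<rho>[of "coord_vec (cotangent_atlas A) ?C (p, \<alpha>) (y, l)"]
      by (simp add: coord_in coord_same)
    \<comment> \<open>Test vectors with \<open>y = 0\<close> recover the base component through
      inner products; those with \<open>l = 0\<close> below recover the covector.\<close>
    have "fst (w ?C) \<bullet> y = R c (snd c p) h \<bullet> y" for y
      using eq[of "blinfun_inner_left y" 0] by (simp add: inner_commute)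
    then have "fst (w ?C) = R c (snd c p) h" using vector_eq_rdot by blast
    moreover have "snd (w ?C) = ?b"
      using eq[of 0] by (intro blinfun_eqI) simp
    ultimately show "w = ?w"
      using c1_atlas.tangent_space_eqI[OF c1_cotangent_atlas _ coord_in C, of w] w
      by (simp add: coord_same prod_eq_iff)
  qed
  then show ?thesis by (simp add: cotangent_lift_def)
qed

lemma canonical_involution_coords:
  assumes c: "p \<in> carrier A" "c = chart_at A p" and v: "v \<in> tangent_space A p"
    and u: "u (tangent_chart A c) = (h, k)"
  shows "canonical_involution A ((p, v), u)
    = ((p, coord_vec A c p h), coord_vec (tangent_atlas A) (tangent_chart A c) (p, coord_vec A c p
      h) (v c, k))"
proof -
  have c': "c \<in> A" "p \<in> fst c" using chart_at_in[OF c(1)] c(2) by auto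
  let ?C = "tangent_chart A c"
  have C: "?C \<in> tangent_atlas A" "(p, coord_vec A c p h) \<in> fst ?C"
    using c' by (auto simp: tangent_atlas_def)
  show ?thesis
    using c1_atlas.chart_inv_tangent_chart[OF c1_tangent_atlas C, of "(v c, k)"] c'
    by (simp add: canonical_involution_def Let_def c(2)[symmetric] u c1_atlas.snd_tangent_chart[OF
      c1_tangent_atlas])
qed

text \<open>The first involution exchanges \<open>v\<close> and \<open>h\<close>, so
  \<open>R\<close> is differentiated at the fibre coordinate \<open>h\<close> in the direction
  \<open>v c\<close>; the second one exchanges back and restores the base point
  \<open>(p, v)\<close>. Both involutions use \<open>chart_at A p\<close>, since the point
  \<open>p\<close> of the manifold never changes.\<close>

lemma tangent_lift_coords:
  assumes c: "p \<in> carrier A" "c = chart_at A p" and v: "v \<in> tangent_space A p"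
    and u: "u (tangent_chart A c) = (h, k)"
  shows "tangent_lift A r ((p, v), u)
    = ((p, v), coord_vec (tangent_atlas A) (tangent_chart A c) (p, v)
        (R c (snd c p) h, DR c p h (v c) + R c (snd c p) k))"
proof -
  have c': "c \<in> A" "p \<in> fst c" using chart_at_in[OF c(1)] c(2) by auto
  let ?C = "tangent_chart A c" and ?v = "coord_vec A c p h"
  let ?u = "coord_vec (tangent_atlas A) ?C (p, ?v) (v c, k)"
  have C: "?C \<in> tangent_atlas A" "(p, ?v) \<in> fst ?C"
    using c' by (auto simp: tangent_atlas_def)
  let ?w = "snd (tangent_map (tangent_atlas A) (tangent_atlas A) (bundle_map r) ((p, ?v), ?u))"
  have w: "?w ?C = (v c, DR c p h (v c) + R c (snd c p) k)"
    using tangent_map_endo[OF c' coord_vec_in[OF c'] c1_atlas.coord_vec_in[OF c1_tangent_atlas C]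
        c1_atlas.coord_vec_same[OF c1_tangent_atlas C]] c' by simp
  have t: "tangent_map (tangent_atlas A) (tangent_atlas A) (bundle_map r) ((p, ?v), ?u)
    = ((p, r p ?v), ?w)"
    by (simp add: tangent_map_def bundle_map_def Let_def)
  show ?thesis
    unfolding tangent_lift_def comp_apply canonical_involution_coords[where u = u, OF c v u]
    by (subst t, subst canonical_involution_coords[where u
      = ?w, OF c endo_in[OF c' coord_vec_in[OF c']] w])
      (use v c' in \<open>simp add: R_snd\<close>)
qed

text \<open>Both composites are tangent vectors at the same point of the tangent bundle, so one
  chart decides equality. There the base components are both \<open>R c (snd c p) h\<close>, and the
  fibre components give the equation.\<close>

lemma lifts_commute_at_iff:
  assumes c: "p \<in> carrier A" "c = chart_at A p" and \<alpha>: "\<alpha> \<in> cotangent_space A p"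
    and u: "u \<in> tangent_space (cotangent_atlas A) (p, \<alpha>)" "u (cotangent_chart A c) = (h, k)"
  defines "a \<equiv> covec_coords A c p \<alpha>"
  shows "(tangent_map (cotangent_atlas A) (tangent_atlas A) (bundle_map (sharp A \<pi>))
          \<circ> cotangent_lift A r) ((p, \<alpha>), u) =
       (tangent_lift A r
          \<circ> tangent_map (cotangent_atlas A) (tangent_atlas A) (bundle_map (sharp A \<pi>))) ((p, \<alpha>), u)
    \<longleftrightarrow> DP c p a (R c (snd c p) h) + P c (snd c p) (torsion_form c p a h + (k o\<^sub>L R_blinfun c
      (snd c p)))
       = DR c p h (P c (snd c p) a) + R c (snd c p) (DP c p a h + P c (snd c p) k)"
proof -
  have c': "c \<in> A" "p \<in> fst c" using chart_at_in[OF c(1)] c(2) by auto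
  let ?C = "cotangent_chart A c" and ?D = "tangent_chart A c"
  let ?T = "tangent_map (cotangent_atlas A) (tangent_atlas A) (bundle_map (sharp A \<pi>))"
  let ?b = "torsion_form c p a h + (k o\<^sub>L R_blinfun c (snd c p))"
  let ?w = "coord_vec (cotangent_atlas A) ?C (p, \<alpha>) (R c (snd c p) h, ?b)"
  have C: "?C \<in> cotangent_atlas A" "(p, \<alpha>) \<in> fst ?C"
    using c' \<alpha> by (auto simp: cotangent_atlas_def)
  have D: "?D \<in> tangent_atlas A" "(p, sharp A \<pi> p \<alpha>) \<in> fst ?D"
    using c' \<alpha> sharp_in[OF c'] by (auto simp: tangent_atlas_def)
  have T: "?T ((p, \<alpha>), x) = ((p, sharp A \<pi> p \<alpha>), snd (?T ((p, \<alpha>), x)))" for x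
    by (simp add: tangent_map_def bundle_map_def Let_def)
  note W = tangent_map_sharp[OF c' \<alpha> c1_atlas.coord_vec_in[OF c1_cotangent_atlas C]
      c1_atlas.coord_vec_same[OF c1_cotangent_atlas C], folded a_def]
  note U = tangent_map_sharp[OF c' \<alpha> u, folded a_def]
  let ?rhs = "coord_vec (tangent_atlas A) ?D (p, sharp A \<pi> p \<alpha>)
      (R c (snd c p) h, DR c p h (sharp A \<pi> p \<alpha> c) + R c (snd c p) (DP c p a h + P c (snd c p) k))"
  have l: "(?T \<circ> cotangent_lift A r) ((p, \<alpha>), u) = ((p, sharp A \<pi> p \<alpha>), snd (?T ((p, \<alpha>), ?w)))"
    using cotangent_lift_coords[OF c' \<alpha> u] T by (simp add: a_def)
  have rr: "(tangent_lift A r \<circ> ?T) ((p, \<alpha>), u) = ((p, sharp A \<pi> p \<alpha>), ?rhs)"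
    using tangent_lift_coords[where u = "snd (?T ((p, \<alpha>), u))", OF c sharp_in[OF c' \<alpha>] U(2)] T[of u]
      by simp
  have "snd (?T ((p, \<alpha>), ?w)) = ?rhs \<longleftrightarrow> snd (?T ((p, \<alpha>), ?w)) ?D = ?rhs ?D"
    using c1_atlas.tangent_space_eqI[OF c1_tangent_atlas W(1) c1_atlas.coord_vec_in[OF
      c1_tangent_atlas D] D]
    by metis
  also have "\<dots> \<longleftrightarrow> DP c p a (R c (snd c p) h) + P c (snd c p) ?b
      = DR c p h (P c (snd c p) a) + R c (snd c p) (DP c p a h + P c (snd c p) k)"
    using W(2) c1_atlas.coord_vec_same[OF c1_tangent_atlas D] sharp_coords[OF c' \<alpha>]
    by (simp add: a_def)
  finally show ?thesis using l rr by simp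
qed

text \<open>Setting \<open>a\<close> and \<open>h\<close> to 0 isolates the terms in
  \<open>k\<close>, setting \<open>k\<close> to 0 the others, and additivity of \<open>P\<close> and
  \<open>R\<close> puts them together again. All triples \<open>a\<close>, \<open>h\<close>,
  \<open>k\<close> occur because the induced charts map onto entire fibres.\<close>

lemma lifts_commute_iff:
  "(\<forall>U \<in> carrier (tangent_atlas (cotangent_atlas A)).
       (tangent_map (cotangent_atlas A) (tangent_atlas A) (bundle_map (sharp A \<pi>))
          \<circ> cotangent_lift A r) U =
       (tangent_lift A r
          \<circ> tangent_map (cotangent_atlas A) (tangent_atlas A) (bundle_map (sharp A \<pi>))) U)
   \<longleftrightarrow> (\<forall>p\<in>carrier A. let c = chart_at A p; x = snd c p in
       (\<forall>k. P c x (k o\<^sub>L R_blinfun c x) = R c x (P c x k)) \<and>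
       (\<forall>a h. DP c p a (R c x h) + P c x (torsion_form c p a h) = DR c p h (P c x a)
         + R c x (DP c p a h)))"
  (is "?L \<longleftrightarrow> ?M")
proof
  have split: "P c (snd c p) (torsion_form c p a h + k) = P c (snd c p) (torsion_form c p a h) + P c
    (snd c p) k"
      "R c (snd c p) (e + f) = R c (snd c p) e + R c (snd c p) f"
    if "c \<in> A" "p \<in> fst c" for c p a h k e f
    using linear_add[OF linear_P[OF that]] linear_add[OF linear_R[OF that]] by auto
  {
    assume L: ?L
    show ?M
    proof (unfold Let_def, rule ballI)
      fix p assume p: "p \<in> carrier A"
      define c where "c = chart_at A p"
      have c: "c \<in> A" "p \<in> fst c" using chart_at_in[OF p] by (auto simp: c_def)
      let ?x = "snd c p"
      have eq: "DP c p a (R c ?x h) + P c ?x (torsion_form c p a h + (k o\<^sub>L R_blinfun c ?x))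
         = DR c p h (P c ?x a) + R c ?x (DP c p a h + P c ?x k)" for a h k
      proof -
        let ?\<alpha> = "coord_covec A c p a" and ?C = "cotangent_chart A c"
        let ?u = "coord_vec (cotangent_atlas A) ?C (p, ?\<alpha>) (h, k)"
        have C: "?C \<in> cotangent_atlas A" "(p, ?\<alpha>) \<in> fst ?C"
          using c by (auto simp: cotangent_atlas_def)
        have u: "?u \<in> tangent_space (cotangent_atlas A) (p, ?\<alpha>)" "?u ?C = (h, k)"
          using c1_atlas.coord_vec_in[OF c1_cotangent_atlas C] c1_atlas.coord_vec_same[OF
            c1_cotangent_atlas C]
          by auto
        have "((p, ?\<alpha>), ?u) \<in> fst (tangent_chart (cotangent_atlas A) ?C)"
          using u(1) C by (simp add: tangent_chart_def)
        then have "((p, ?\<alpha>), ?u) \<in> carrier (tangent_atlas (cotangent_atlas A))"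
          using C(1) by (auto simp: tangent_atlas_def intro: carrierI)
        from L[rule_format, OF this] show ?thesis
          unfolding lifts_commute_at_iff[OF p c_def coord_covec_in[OF c] u] using c by simp
      qed
      have z: "torsion_form c p 0 0 = 0" by (rule blinfun_eqI) (simp add: torsion_form_apply[OF c])
      have "DP c p a 0 = 0" for a using linear_0[OF
        has_derivative_linear[OF P_has_derivative[OF c]]] .
      then have E1: "P c ?x (k o\<^sub>L R_blinfun c ?x) = R c ?x (P c ?x k)" for k
        using eq[of 0 0 k] linear_0[OF linear_R[OF c]] linear_0[OF linear_P[OF c]] linear_0[OF
          linear_DR2[OF c]]
        by (simp add: z)
      moreover have "DP c p a (R c ?x h) + P c ?x (torsion_form c p a h) = DR c p h (P c ?x a)
        + R c ?x (DP c p a h)" for a h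
        using eq[of a h 0] linear_0[OF linear_P[OF c]] by simp
      ultimately show "(\<forall>k. P (chart_at A p) (snd (chart_at A p) p) (k o\<^sub>L R_blinfun (chart_at A p)
        (snd (chart_at A p) p))
           = R (chart_at A p) (snd (chart_at A p) p) (P (chart_at A p) (snd (chart_at A p) p) k)) \<and>
         (\<forall>a h. DP (chart_at A p) p a (R (chart_at A p) (snd (chart_at A p) p) h)
             + P (chart_at A p) (snd (chart_at A p) p) (torsion_form (chart_at A p) p a h)
           = DR (chart_at A p) p h (P (chart_at A p) (snd (chart_at A p) p) a)
             + R (chart_at A p) (snd (chart_at A p) p) (DP (chart_at A p) p a h))"
        unfolding c_def by blast
    qed
  }
  assume M: ?M
  show ?L
  proof
    fix U assume "U \<in> carrier (tangent_atlas (cotangent_atlas A))"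
    then obtain d where d: "d \<in> A" "U \<in> fst (tangent_chart (cotangent_atlas A) (cotangent_chart A
      d))"
      unfolding carrier_def tangent_atlas_def cotangent_atlas_def by blast
    obtain p \<alpha> u where U: "U = ((p, \<alpha>), u)" by (metis surj_pair)
    have in': "p \<in> fst d" "\<alpha> \<in> cotangent_space A p" "u \<in> tangent_space (cotangent_atlas A) (p, \<alpha>)"
      using d(2) unfolding U tangent_chart_def by auto
    have p: "p \<in> carrier A" using d(1) in'(1) by (rule carrierI)
    define c where "c = chart_at A p"
    have c: "c \<in> A" "p \<in> fst c" using chart_at_in[OF p] by (auto simp: c_def)
    obtain h k where hk: "u (cotangent_chart A c) = (h, k)" by fastforce
    from M[rule_format, OF p, unfolded Let_def, folded c_def]
    show "(tangent_map (cotangent_atlas A) (tangent_atlas A) (bundle_map (sharp A \<pi>))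
          \<circ> cotangent_lift A r) U =
       (tangent_lift A r
          \<circ> tangent_map (cotangent_atlas A) (tangent_atlas A) (bundle_map (sharp A \<pi>))) U"
      unfolding U lifts_commute_at_iff[OF p c_def in'(2,3) hk]
      by (simp add: split[OF c] flip: add.assoc)
  qed
qed

end

section \<open>Lie brackets and Lie derivatives in coordinates\<close>

context c2_atlas
begin

text \<open>The Lie derivatives are also applied to fields built from \<open>r\<close> and sharp.
  Differentiability passes to these by the fibrewise product rule and is all that the coordinate
  formulas use.\<close>

definition C1_field :: "('a \<Rightarrow> ('a, 'e) tvec) \<Rightarrow> bool" where
  "C1_field X \<longleftrightarrow> (\<forall>p\<in>carrier A. X p \<in> tangent_space A p) \<and>
     (\<forall>c\<in>A. \<forall>p\<in>fst c. (\<lambda>x. X (chart_inv c x) c) differentiable (at (snd c p)))"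

definition field_deriv :: "('a \<Rightarrow> ('a, 'e) tvec) \<Rightarrow> ('a, 'e) chart \<Rightarrow> 'a \<Rightarrow> 'e \<Rightarrow> 'e" where
  "field_deriv X c p = frechet_derivative (\<lambda>x. X (chart_inv c x) c) (at (snd c p))"

definition C1_form :: "('a \<Rightarrow> ('a, 'e) cotvec) \<Rightarrow> bool" where
  "C1_form \<alpha> \<longleftrightarrow> (\<forall>p\<in>carrier A. \<alpha> p \<in> cotangent_space A p) \<and>
     (\<forall>c\<in>A. \<forall>p\<in>fst c. \<forall>e. (\<lambda>x. \<alpha> (chart_inv c x) (coord_vec A c (chart_inv c x) e))
        differentiable (at (snd c p)))"

definition form_deriv :: "('a \<Rightarrow> ('a, 'e) cotvec) \<Rightarrow> ('a, 'e) chart \<Rightarrow> 'a \<Rightarrow> 'e \<Rightarrow> 'e \<Rightarrow>\<^sub>L real" where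
  "form_deriv \<alpha> c p =
     frechet_derivative (\<lambda>x. covec_coords A c (chart_inv c x) (\<alpha> (chart_inv c x))) (at (snd c p))"

lemma C1_field_in: "C1_field X \<Longrightarrow> c \<in> A \<Longrightarrow> p \<in> fst c \<Longrightarrow> X p \<in> tangent_space A p"
  using carrierI[of c A p] by (simp add: C1_field_def)

lemma C1_form_in: "C1_form \<alpha> \<Longrightarrow> c \<in> A \<Longrightarrow> p \<in> fst c \<Longrightarrow> \<alpha> p \<in> cotangent_space A p"
  using carrierI[of c A p] by (simp add: C1_form_def)

lemma field_has_derivative:
  assumes "C1_field X" "c \<in> A" "p \<in> fst c"
  shows "((\<lambda>x. X (chart_inv c x) c) has_derivative field_deriv X c p) (at (snd c p))"
  unfolding field_deriv_def frechet_derivative_works[symmetric]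
  using assms by (simp add: C1_field_def)

lemma form_has_derivative:
  assumes \<alpha>: "C1_form \<alpha>" and c: "c \<in> A" "p \<in> fst c"
  shows "((\<lambda>x. covec_coords A c (chart_inv c x) (\<alpha> (chart_inv c x))) has_derivative
    form_deriv \<alpha> c p) (at (snd c p))"
    and "((\<lambda>x. \<alpha> (chart_inv c x) (coord_vec A c (chart_inv c x) e)) has_derivative
      (\<lambda>h. blinfun_apply (form_deriv \<alpha> c p h) e)) (at (snd c p))"
proof -
  let ?a = "\<lambda>x. covec_coords A c (chart_inv c x) (\<alpha> (chart_inv c x))"
  let ?g = "\<lambda>e x. \<alpha> (chart_inv c x) (coord_vec A c (chart_inv c x) e)"
  have eq: "?g e x = blinfun_apply (?a x) e" if "x \<in> chart_image c" for e x
    using that C1_form_in[OF \<alpha> c(1)] c by auto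
  have g: "(?g e has_derivative frechet_derivative (?g e) (at (snd c p))) (at (snd c p))" for e
    unfolding frechet_derivative_works[symmetric] using \<alpha> c by (simp add: C1_form_def)
  then have "((\<lambda>x. blinfun_apply (?a x) e) has_derivative frechet_derivative (?g e) (at (snd c p)))
    (at (snd c p))" for e
    by (rule has_derivative_transform_within_open[OF _ open_chart_image[OF c(1)]])
      (use c eq in auto)
  from has_derivative_blinfunI[OF frame this] obtain G where G: "(?a has_derivative G)
    (at (snd c p))"
    "\<And>h e. blinfun_apply (G h) e = frechet_derivative (?g e) (at (snd c p)) h"
    by blast
  have "form_deriv \<alpha> c p = G"
    using frechet_derivative_at[OF G(1)] by (simp add: form_deriv_def)
  then show "(?a has_derivative form_deriv \<alpha> c p) (at (snd c p))"
    "(?g e has_derivative (\<lambda>h. blinfun_apply (form_deriv \<alpha> c p h) e)) (at (snd c p))"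
    using G g by simp_all
qed

text \<open>Differentiates the transformation rule of \<open>X\<close>, read as an identity of
  functions on the overlap, once by the chain rule and once by the fibrewise product rule.\<close>

lemma field_deriv_transform:
  assumes X: "C1_field X" and c: "c \<in> A" "p \<in> fst c" and d: "d \<in> A" "p \<in> fst d"
  shows "field_deriv X d p (jacobian c d p h)
    = hessian c d p (X p c) h + jacobian c d p (field_deriv X c p h)"
proof -
  let ?O = "snd c ` (fst c \<inter> fst d)" and ?Xc = "\<lambda>x. X (chart_inv c x) c" and ?Xd
    = "\<lambda>x. X (chart_inv d x) d"
  have O: "open ?O" "snd c p \<in> ?O" using open_overlap[OF c(1) d(1)] c d by auto
  have eq: "frechet_derivative (transition c d) (at x) (?Xc x) = ?Xd (transition c d x)" if "x \<in> ?O"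
    for x
  proof -
    obtain q where q: "q \<in> fst c" "q \<in> fst d" "x = snd c q" using \<open>x \<in> ?O\<close> by blast
    show ?thesis
      using tangent_space_transform[OF C1_field_in[OF X c(1) q(1)] c(1) d(1) q(1,2)] c d q
      by (simp add: jacobian_def)
  qed
  have 1: "((\<lambda>x. ?Xd (transition c d x)) has_derivative (\<lambda>h. field_deriv X d p (jacobian c d p h)))
    (at (snd c p))"
    by (rule has_derivative_compose[OF transition_has_derivative])
      (use c d field_has_derivative[OF X d] in simp_all)
  have "((\<lambda>x. frechet_derivative (transition c d) (at x) (?Xc x)) has_derivative
     (\<lambda>k. frechet_derivative (\<lambda>x. frechet_derivative (transition c d) (at x) (?Xc (snd c p)))
       (at (snd c p)) k
        + frechet_derivative (transition c d) (at (snd c p)) (field_deriv X c p k))) (at (snd c p))"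
    by (rule has_derivative_fibrewise_linear[OF frame, where f = "\<lambda>x. x" and f' = "\<lambda>x. x", OF O])
      (use c d jacobian_differentiable[of c d] linear_jacobian[unfolded jacobian_def, of c d]
        field_has_derivative[OF X c] in \<open>auto elim!: overlapE\<close>)
  then have "((\<lambda>x. frechet_derivative (transition c d) (at x) (?Xc x)) has_derivative
     (\<lambda>k. hessian c d p (X p c) k + jacobian c d p (field_deriv X c p k))) (at (snd c p))"
    using c by (simp add: hessian_def jacobian_def)
  then have "((\<lambda>x. ?Xd (transition c d x)) has_derivative
     (\<lambda>k. hessian c d p (X p c) k + jacobian c d p (field_deriv X c p k))) (at (snd c p))"
    by (rule has_derivative_transform_within_open[OF _ O]) (rule eq)
  from has_derivative_unique[OF 1 this] show ?thesis by (rule fun_cong)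
qed

lemma lie_bracket_coords:
  "c \<in> A \<Longrightarrow> p \<in> fst c \<Longrightarrow>
    lie_bracket A X Y p c = field_deriv Y c p (X p c) - field_deriv X c p (Y p c)"
  by (simp add: lie_bracket_def field_deriv_def)

text \<open>The inhomogeneous terms of the transformation rule cancel by symmetry of the second
  derivative.\<close>

lemma lie_bracket_in:
  assumes X: "C1_field X" and Y: "C1_field Y" and c: "c \<in> A" "p \<in> fst c"
  shows "lie_bracket A X Y p \<in> tangent_space A p"
proof (rule tangent_spaceI[OF c])
  fix d assume d: "d \<in> A" "p \<in> fst d"
  note X' = tangent_space_transform[OF C1_field_in[OF X c] c(1) d(1) c(2) d(2)]
    and Y' = tangent_space_transform[OF C1_field_in[OF Y c] c(1) d(1) c(2) d(2)]
  show "lie_bracket A X Y p d = jacobian c d p (lie_bracket A X Y p c)"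
    unfolding lie_bracket_coords[OF c] lie_bracket_coords[OF d] X' Y'
      field_deriv_transform[OF X c d] field_deriv_transform[OF Y c d]
    using hessian_symmetric[OF c(1) d(1) c(2) d(2), of "X p c" "Y p c"]
    by (simp add: linear_diff[OF linear_jacobian[OF c(1) d(1) c(2) d(2)]])
next
  fix d assume "\<not> (d \<in> A \<and> p \<in> fst d)"
  then show "lie_bracket A X Y p d = 0" by (auto simp: lie_bracket_def)
qed

text \<open>In Cartan's formula the derivative of \<open>\<alpha>\<close> along the test vector,
  paired with \<open>X\<close>, occurs in both summands with opposite signs and cancels. The chart
  is \<open>chart_at A p\<close> because \<open>ext_deriv\<close> and \<open>differential\<close>
  are computed in it.\<close>

lemma lie_deriv_form_coords:
  assumes X: "C1_field X" and \<alpha>: "C1_form \<alpha>" and p: "p \<in> carrier A" "c = chart_at A p"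
  shows "lie_deriv_form A X \<alpha> p \<in> cotangent_space A p"
    and "blinfun_apply (covec_coords A c p (lie_deriv_form A X \<alpha> p)) e
      = blinfun_apply (form_deriv \<alpha> c p (X p c)) e + blinfun_apply (covec_coords A c p (\<alpha> p))
        (field_deriv X c p e)"
proof -
  have c: "c \<in> A" "p \<in> fst c" using chart_at_in[OF p(1)] p(2) by auto
  let ?a = "\<lambda>x. covec_coords A c (chart_inv c x) (\<alpha> (chart_inv c x))"
  let ?f = "\<lambda>e. blinfun_apply (form_deriv \<alpha> c p (X p c)) e
    + blinfun_apply (covec_coords A c p (\<alpha> p)) (field_deriv X c p e)"
  have D1: "frechet_derivative (\<lambda>x. \<alpha> (chart_inv c x) (coord_vec A c (chart_inv c x) e))
    (at (snd c p))
      = (\<lambda>h. blinfun_apply (form_deriv \<alpha> c p h) e)" for e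
    using frechet_derivative_at[OF form_has_derivative(2)[OF \<alpha> c]] by simp
  have "((\<lambda>x. blinfun_apply (?a x) (X (chart_inv c x) c)) has_derivative
    (\<lambda>h. blinfun_apply (?a (snd c p)) (field_deriv X c p h) + blinfun_apply (form_deriv \<alpha> c p h)
      (X (chart_inv c (snd c p)) c)))
    (at (snd c p))"
    by (rule blinfun.FDERIV[OF form_has_derivative(1)[OF \<alpha> c] field_has_derivative[OF X c]])
  then have "(((\<lambda>q. \<alpha> q (X q)) \<circ> chart_inv c) has_derivative
    (\<lambda>h. blinfun_apply (covec_coords A c p (\<alpha> p)) (field_deriv X c p h)
      + blinfun_apply (form_deriv \<alpha> c p h) (X p c)))
    (at (snd c p))"
  proof (rule has_derivative_transform_within_open[OF has_derivative_eq_rhs open_chart_image[OF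
    c(1)]])
    fix x assume "x \<in> chart_image c"
    then obtain q where q: "q \<in> fst c" "x = snd c q" by blast
    show "blinfun_apply (?a x) (X (chart_inv c x) c) = ((\<lambda>q. \<alpha> q (X q)) \<circ> chart_inv c) x"
      using cotangent_apply[OF C1_form_in[OF \<alpha> c(1) q(1)] c(1) q(1) C1_field_in[OF X c(1) q(1)]] c q
      by (simp del: covec_coords_apply)
  qed (use c in \<open>simp_all del: covec_coords_apply\<close>)
  from frechet_derivative_at[OF this, symmetric]
  have ap: "lie_deriv_form A X \<alpha> p v = ?f (v c)" if "v \<in> tangent_space A p" for v
    using that by (simp add: lie_deriv_form_def ext_deriv_def differential_def Let_def
      p(2)[symmetric] D1
        del: covec_coords_apply)
  show in': "lie_deriv_form A X \<alpha> p \<in> cotangent_space A p"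
  proof (rule cotangent_spaceI[OF c ap])
    note l = has_derivative_linear[OF field_has_derivative[OF X c]]
    show "linear ?f"
      by (rule linearI) (simp_all add: linear_add[OF l] linear_scale[OF l] blinfun.add_right
        blinfun.scaleR_right
          distrib_left del: covec_coords_apply)
  qed (simp_all add: lie_deriv_form_def)
  show "blinfun_apply (covec_coords A c p (lie_deriv_form A X \<alpha> p)) e = ?f e"
    unfolding covec_coords_apply[OF in' c] using ap[OF coord_vec_in[OF c], of e] c
    by (simp del: covec_coords_apply)
qed

end

section \<open>Derivatives of the sections built from \<open>r\<close> and sharp, and the second
  compatibility condition at a point\<close>

context tensor_pair
begin

lemma endo_field:
  assumes X: "C1_field X"
  shows "C1_field (\<lambda>q. r q (X q))"
    and "c \<in> A \<Longrightarrow> p \<in> fst c \<Longrightarrow> field_deriv (\<lambda>q. r q (X q)) c p h = DR c p (X p c) h + R c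
      (snd c p) (field_deriv X c p h)"
proof -
  have D: "((\<lambda>x. r (chart_inv c x) (X (chart_inv c x)) c) has_derivative
    (\<lambda>h. DR c p (X p c) h + R c (snd c p) (field_deriv X c p h))) (at (snd c p))"
    if c: "c \<in> A" "p \<in> fst c" for c p
  proof -
    have "((\<lambda>x. R c x (X (chart_inv c x) c)) has_derivative
      (\<lambda>h. frechet_derivative (\<lambda>x. R c x (X (chart_inv c (snd c p)) c)) (at (snd c p)) h + R c
        (snd c p) (field_deriv X c p h))) (at (snd c p))"
      by (rule has_derivative_fibrewise_linear[OF frame open_chart_image[OF c(1)], where f
        = "\<lambda>x. x" and f' = "\<lambda>x. x"])
        (use c linear_R[OF c(1)] R_has_derivative[OF c] field_has_derivative[OF X c] in \<open>auto
          intro: differentiableI\<close>)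
    then have "((\<lambda>x. R c x (X (chart_inv c x) c)) has_derivative
      (\<lambda>h. DR c p (X p c) h + R c (snd c p) (field_deriv X c p h))) (at (snd c p))"
      using c by (simp add: DR_def)
    then show ?thesis
      by (rule has_derivative_transform_within_open[OF _ open_chart_image[OF c(1)]])
        (use c endo_coords[OF c(1)] C1_field_in[OF X c(1)] in auto)
  qed
  show C1: "C1_field (\<lambda>q. r q (X q))"
    unfolding C1_field_def
  proof (intro conjI ballI)
    fix p assume "p \<in> carrier A"
    from chart_at_in[OF this] show "r p (X p) \<in> tangent_space A p"
      using endo_in C1_field_in[OF X] by blast
  qed (use D differentiableI in blast)
  show "field_deriv (\<lambda>q. r q (X q)) c p h = DR c p (X p c) h + R c (snd c p) (field_deriv X c p h)"
    if "c \<in> A" "p \<in> fst c"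
    using has_derivative_unique[OF field_has_derivative[OF C1 that] D[OF that]] by (rule fun_cong)
qed

lemma sharp_field:
  assumes \<alpha>: "C1_form \<alpha>"
  shows "C1_field (\<lambda>q. sharp A \<pi> q (\<alpha> q))"
    and "c \<in> A \<Longrightarrow> p \<in> fst c \<Longrightarrow> field_deriv (\<lambda>q. sharp A \<pi> q (\<alpha> q)) c p h
      = DP c p (covec_coords A c p (\<alpha> p)) h + P c (snd c p) (form_deriv \<alpha> c p h)"
proof -
  have D: "((\<lambda>x. sharp A \<pi> (chart_inv c x) (\<alpha> (chart_inv c x)) c) has_derivative
    (\<lambda>h. DP c p (covec_coords A c p (\<alpha> p)) h + P c (snd c p) (form_deriv \<alpha> c p h))) (at (snd c p))"
    if c: "c \<in> A" "p \<in> fst c" for c p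
  proof -
    let ?a = "\<lambda>x. covec_coords A c (chart_inv c x) (\<alpha> (chart_inv c x))"
    have "((\<lambda>x. P c x (?a x)) has_derivative
      (\<lambda>h. frechet_derivative (\<lambda>x. P c x (?a (snd c p))) (at (snd c p)) h + P c
        (snd c p) (form_deriv \<alpha> c p h))) (at (snd c p))"
      by (rule has_derivative_fibrewise_linear[OF finite_frame_blinfun[OF frame] open_chart_image[OF
        c(1)], where f = "\<lambda>x. x" and f' = "\<lambda>x. x"])
        (use c linear_P[OF c(1)] P_has_derivative[OF c] form_has_derivative(1)[OF \<alpha> c] in \<open>auto
          intro: differentiableI\<close>)
    then have "((\<lambda>x. P c x (?a x)) has_derivative
      (\<lambda>h. DP c p (covec_coords A c p (\<alpha> p)) h + P c (snd c p) (form_deriv \<alpha> c p h)))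
        (at (snd c p))"
      using c by (simp add: DP_def)
    then show ?thesis
      by (rule has_derivative_transform_within_open[OF _ open_chart_image[OF c(1)]])
        (use c sharp_coords[OF c(1)] C1_form_in[OF \<alpha> c(1)] in auto)
  qed
  show C1: "C1_field (\<lambda>q. sharp A \<pi> q (\<alpha> q))"
    unfolding C1_field_def
  proof (intro conjI ballI)
    fix p assume "p \<in> carrier A"
    from chart_at_in[OF this] show "sharp A \<pi> p (\<alpha> p) \<in> tangent_space A p"
      using sharp_in C1_form_in[OF \<alpha>] by blast
  qed (use D differentiableI in blast)
  show "field_deriv (\<lambda>q. sharp A \<pi> q (\<alpha> q)) c p h
      = DP c p (covec_coords A c p (\<alpha> p)) h + P c (snd c p) (form_deriv \<alpha> c p h)"
    if "c \<in> A" "p \<in> fst c"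
    using has_derivative_unique[OF field_has_derivative[OF C1 that] D[OF that]] by (rule fun_cong)
qed

lemma dual_form:
  assumes \<alpha>: "C1_form \<alpha>"
  shows "C1_form (\<lambda>q. dual A r q (\<alpha> q))"
    and "c \<in> A \<Longrightarrow> p \<in> fst c \<Longrightarrow> blinfun_apply (form_deriv (\<lambda>q. dual A r q (\<alpha> q)) c p h) e
      = blinfun_apply (form_deriv \<alpha> c p h) (R c (snd c p) e)
        + blinfun_apply (covec_coords A c p (\<alpha> p)) (DR c p e h)"
proof -
  have D: "((\<lambda>x. dual A r (chart_inv c x) (\<alpha> (chart_inv c x)) (coord_vec A c (chart_inv c x) e))
    has_derivative
    (\<lambda>h. blinfun_apply (form_deriv \<alpha> c p h) (R c (snd c p) e)
      + blinfun_apply (covec_coords A c p (\<alpha> p)) (DR c p e h))) (at (snd c p))"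
    if c: "c \<in> A" "p \<in> fst c" for c p e
  proof -
    let ?a = "\<lambda>x. covec_coords A c (chart_inv c x) (\<alpha> (chart_inv c x))"
    have "((\<lambda>x. blinfun_apply (?a x) (R c x e)) has_derivative
      (\<lambda>h. blinfun_apply (?a (snd c p)) (DR c p e h) + blinfun_apply (form_deriv \<alpha> c p h) (R c
        (snd c p) e))) (at (snd c p))"
      by (rule blinfun.FDERIV[OF form_has_derivative(1)[OF \<alpha> c] R_has_derivative[OF c]])
    then show ?thesis
    proof (rule has_derivative_transform_within_open[OF has_derivative_eq_rhs open_chart_image[OF
      c(1)]])
      fix x assume "x \<in> chart_image c"
      then obtain q where q: "q \<in> fst c" "x = snd c q" by blast
      note \<alpha>q = C1_form_in[OF \<alpha> c(1) q(1)]
      have "dual A r q (\<alpha> q) (coord_vec A c q e)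
        = blinfun_apply (covec_coords A c q (dual A r q (\<alpha> q))) e"
        using covec_coords_apply[OF dual_in[OF c(1) q(1) \<alpha>q] c(1) q(1)] by simp
      then show "blinfun_apply (?a x) (R c x e)
         = dual A r (chart_inv c x) (\<alpha> (chart_inv c x)) (coord_vec A c (chart_inv c x) e)"
        using c q dual_coords[OF c(1) q(1) \<alpha>q] by (simp del: covec_coords_apply)
    qed (use c in \<open>simp_all add: add.commute del: covec_coords_apply\<close>)
  qed
  show C1: "C1_form (\<lambda>q. dual A r q (\<alpha> q))"
    unfolding C1_form_def
  proof (intro conjI ballI allI)
    fix p assume "p \<in> carrier A"
    from chart_at_in[OF this] show "dual A r p (\<alpha> p) \<in> cotangent_space A p"
      using dual_in C1_form_in[OF \<alpha>] by blast
  qed (use D differentiableI in blast)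
  show "blinfun_apply (form_deriv (\<lambda>q. dual A r q (\<alpha> q)) c p h) e
      = blinfun_apply (form_deriv \<alpha> c p h) (R c (snd c p) e)
        + blinfun_apply (covec_coords A c p (\<alpha> p)) (DR c p e h)"
    if "c \<in> A" "p \<in> fst c"
    using has_derivative_unique[OF form_has_derivative(2)[OF C1 that] D[OF that]] by (rule fun_cong)
qed

lemma cotangent_space_diff:
  "\<alpha> \<in> cotangent_space A p \<Longrightarrow> \<beta> \<in> cotangent_space A p \<Longrightarrow> \<alpha> - \<beta> \<in> cotangent_space A p"
  unfolding cotangent_space_def linear_between_def by (simp add: algebra_simps)

text \<open>The derivatives of \<open>X\<close> cancel within the difference of Lie derivatives of
  forms and again within \<open>lie_deriv_endo\<close>. Of the derivatives of
  \<open>\<alpha>\<close>, the one along \<open>R h\<close> cancels between the two expressions; the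
  one along \<open>h\<close> occurs as \<open>P (G h o R)\<close> in the first and as
  \<open>R (P (G h))\<close> in the second, with \<open>G\<close> the derivative of
  \<open>\<alpha>\<close>, and these agree by \<open>E1\<close>.\<close>

lemma compatible_at_iff:
  assumes X: "C1_field X" and \<alpha>: "C1_form \<alpha>" and p: "p \<in> carrier A" "c = chart_at A p"
    and E1: "\<And>k. P c (snd c p) (k o\<^sub>L R_blinfun c (snd c p)) = R c (snd c p) (P c (snd c p) k)"
  defines "a \<equiv> covec_coords A c p (\<alpha> p)" and "h \<equiv> X p c"
  shows "sharp A \<pi> p (lie_deriv_form A X (\<lambda>q. dual A r q (\<alpha> q)) p
                        - lie_deriv_form A (\<lambda>q. r q (X q)) \<alpha> p)
           - lie_deriv_endo A (\<lambda>q. sharp A \<pi> q (\<alpha> q)) r X p = 0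
     \<longleftrightarrow> DP c p a (R c (snd c p) h) + P c (snd c p) (torsion_form c p a h)
       = DR c p h (P c (snd c p) a) + R c (snd c p) (DP c p a h)"
proof -
  have c: "c \<in> A" "p \<in> fst c" using chart_at_in[OF p(1)] p(2) by auto
  let ?P = "P c (snd c p)" and ?R = "R c (snd c p)" and ?G = "form_deriv \<alpha> c p" and ?DX
    = "field_deriv X c p"
  let ?L1 = "lie_deriv_form A X (\<lambda>q. dual A r q (\<alpha> q)) p" and ?L2
    = "lie_deriv_form A (\<lambda>q. r q (X q)) \<alpha> p"
  let ?Y = "\<lambda>q. sharp A \<pi> q (\<alpha> q)" and ?rX = "\<lambda>q. r q (X q)"
  note Xp = C1_field_in[OF X c] and \<alpha>p = C1_form_in[OF \<alpha> c]
  note Y = sharp_field[OF \<alpha>] and rX = endo_field[OF X] and da = dual_form[OF \<alpha>]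
  note L1 = lie_deriv_form_coords[OF X da(1) p] and L2 = lie_deriv_form_coords[OF rX(1) \<alpha> p]
  have L: "?L1 - ?L2 \<in> cotangent_space A p" by (rule cotangent_space_diff[OF L1(1) L2(1)])
  have "covec_coords A c p (?L1 - ?L2) = covec_coords A c p ?L1 - covec_coords A c p ?L2"
    using L L1(1) L2(1) c by (intro blinfun_eqI) (simp add: blinfun.diff_left)
  \<comment> \<open>The term \<open>a\<close> applied to \<open>R\<close> of the derivative of
    \<open>X\<close> along \<open>e\<close> occurs in both Lie derivatives. The two derivatives of
    \<open>R\<close> that remain, with arguments exchanged, make up
    \<open>torsion_form\<close>.\<close>
  also have "\<dots> = (?G h o\<^sub>L R_blinfun c (snd c p)) + torsion_form c p a h - ?G (?R h)"
  proof (rule blinfun_eqI)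
    fix e
    have "blinfun_apply (covec_coords A c p (dual A r p (\<alpha> p))) (?DX e)
      = blinfun_apply a (?R (?DX e))"
      unfolding dual_coords[OF c \<alpha>p] a_def using c by (simp del: covec_coords_apply)
    then show "blinfun_apply (covec_coords A c p ?L1 - covec_coords A c p ?L2) e
       = blinfun_apply ((?G h o\<^sub>L R_blinfun c (snd c p)) + torsion_form c p a h - ?G (?R h)) e"
      using c unfolding blinfun.diff_left blinfun.add_left L1(2) L2(2) da(2)[OF c] rX(2)[OF c]
      by (simp add: torsion_form_apply[OF c] endo_coords[OF c Xp] blinfun.add_right h_def flip:
        a_def
          del: covec_coords_apply)
  qed
  finally have sc: "sharp A \<pi> p (?L1 - ?L2) c = ?P ((?G h o\<^sub>L R_blinfun c (snd c p))
    + torsion_form c p a h - ?G (?R h))"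
    using sharp_coords[OF c L] by simp
  have br: "lie_bracket A ?Y X p \<in> tangent_space A p" "lie_bracket A ?Y ?rX p \<in> tangent_space A p"
    by (rule lie_bracket_in[OF Y(1) X c], rule lie_bracket_in[OF Y(1) rX(1) c])
  have ec: "lie_deriv_endo A ?Y r X p c = DR c p h (?P a) + ?R (?DX (?P a)) - (DP c p a (?R h)
    + ?P (?G (?R h)))
      - ?R (?DX (?P a) - (DP c p a h + ?P (?G h)))"
    using endo_coords[OF c br(1)]
    by (simp add: lie_deriv_endo_def lie_bracket_coords[OF c] Y(2)[OF c] rX(2)[OF c] endo_coords[OF
      c Xp]
        sharp_coords[OF c \<alpha>p] h_def flip: a_def del: covec_coords_apply)
  have in': "sharp A \<pi> p (?L1 - ?L2) - lie_deriv_endo A ?Y r X p \<in> tangent_space A p"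
    unfolding lie_deriv_endo_def
    by (intro tangent_space_diff sharp_in[OF c L] endo_in[OF c] br)
  have z: "0 \<in> tangent_space A p"
    using tangent_space_diff[OF Xp Xp] by simp
  have "sharp A \<pi> p (?L1 - ?L2) - lie_deriv_endo A ?Y r X p = 0
     \<longleftrightarrow> sharp A \<pi> p (?L1 - ?L2) c - lie_deriv_endo A ?Y r X p c = 0"
    using tangent_space_eqI[OF in' z c] by auto
  also have "\<dots> \<longleftrightarrow> DP c p a (?R h) + ?P (torsion_form c p a h) = DR c p h (?P a) + ?R (DP c p a h)"
    unfolding sc ec
    by (simp add: linear_add[OF linear_P[OF c]] linear_diff[OF linear_P[OF c]] E1
        linear_add[OF linear_R[OF c]] linear_diff[OF linear_R[OF c]] algebra_simps)
  finally show ?thesis .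
qed

end

section \<open>Smooth manifolds\<close>

lemma smooth_on_Ck: "smooth_on S f \<Longrightarrow> Ck_on k S f"
  by (simp add: smooth_on_def)

lemma smooth_on_differentiable: "smooth_on S f \<Longrightarrow> x \<in> S \<Longrightarrow> f differentiable (at x)"
  using smooth_on_Ck[of S f 1] by simp

lemma smooth_manifoldD:
  assumes "smooth_manifold T A"
  shows "\<exists>B::'e::real_inner set. finite B \<and> span B = UNIV" "Hausdorff_space T" "topspace T
    = carrier A"
    and "c \<in> A \<Longrightarrow> openin T (fst c)" "c \<in> A \<Longrightarrow> open (chart_image c)"
    and "c \<in> A \<Longrightarrow> homeomorphic_map (subtopology T (fst c)) (top_of_set (chart_image c)) (snd c)"
    and "c \<in> A \<Longrightarrow> d \<in> A \<Longrightarrow> smooth_on (snd c ` (fst c \<inter> fst d)) (transition c (d :: ('a, 'e) chart))"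
  using assms unfolding smooth_manifold_def transition_def by blast+

section \<open>Vector fields and 1-forms with prescribed value at a point\<close>

context
  fixes T :: "'a topology" and A :: "('a, 'e::real_inner) chart set"
  assumes M: "smooth_manifold T A"
begin

lemma chart_inj:
  assumes c: "c \<in> A"
  shows "inj_on (snd c) (fst c)"
proof -
  have "topspace (subtopology T (fst c)) = fst c"
    using openin_subset[OF smooth_manifoldD(4)[OF M c]] by auto
  with homeomorphic_imp_injective_map[OF smooth_manifoldD(6)[OF M c]] show ?thesis by simp
qed

lemma open_chart_map:
  assumes c: "c \<in> A" and U: "openin T U" "U \<subseteq> fst c"
  shows "open (snd c ` U)"
proof -
  have "openin (subtopology T (fst c)) U"
    using U openin_subtopology_Int[of T U "fst c"] by (simp add: Int_absorb2)
  then have "openin (top_of_set (chart_image c)) (snd c ` U)"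
    using homeomorphic_imp_open_map[OF smooth_manifoldD(6)[OF M c]] unfolding open_map_def by blast
  then show ?thesis
    using openin_open_trans[OF _ smooth_manifoldD(5)[OF M c]] by blast
qed

lemma smooth_manifold_c2_atlas:
  assumes "finite_frame E (\<lambda>b v. v \<bullet> b) (\<lambda>b. b :: 'e)"
  shows "c2_atlas A E"
proof
  fix c assume c: "c \<in> A"
  show "inj_on (snd c) (fst c)" using c by (rule chart_inj)
  fix d assume d: "d \<in> A"
  show "open (snd c ` (fst c \<inter> fst d))"
    using c d smooth_manifoldD(4)[OF M c] smooth_manifoldD(4)[OF M d]
    by (intro open_chart_map openin_Int) auto
  fix p v assume "p \<in> fst c" "p \<in> fst d"
  then have p: "snd c p \<in> snd c ` (fst c \<inter> fst d)" by blast
  note s = smooth_manifoldD(7)[OF M c d]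
  show "transition c d differentiable (at (snd c p))"
    using s p by (rule smooth_on_differentiable)
  show "(\<lambda>x. frechet_derivative (transition c d) (at x) v) differentiable (at (snd c p))"
    using smooth_on_Ck[OF s, of 2] p unfolding numeral_2_eq_2 Ck_on.simps by blast
qed (rule assms)

text \<open>A compact set in the chart image has compact preimage in the manifold, which is closed
  by the Hausdorff property. Without closedness a function extended by 0 could fail to be continuous
  outside the chart.\<close>

lemma closedin_chart_compact:
  assumes c: "c \<in> A" and K: "compact K" "K \<subseteq> chart_image c"
  shows "closedin T (chart_inv c ` K)"
proof -
  obtain g where g: "homeomorphic_maps (subtopology T (fst c)) (top_of_set (chart_image c)) (snd c)
    g"
    using smooth_manifoldD(6)[OF M c] homeomorphic_map_maps by blast
  have "g x = chart_inv c x" if "x \<in> chart_image c" for x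
  proof -
    have "g x \<in> fst c" "snd c (g x) = x"
      using g that unfolding homeomorphic_maps_def by (auto simp: continuous_map_def)
    then show ?thesis using inv_into_f_f[OF chart_inj[OF c]] by metis
  qed
  then have eq: "chart_inv c ` K = g ` K" using K(2) by (auto intro!: image_cong)
  have "compactin (top_of_set (chart_image c)) K"
    using K by (simp add: compactin_subtopology)
  moreover have "continuous_map (top_of_set (chart_image c)) (subtopology T (fst c)) g"
    using g unfolding homeomorphic_maps_def by blast
  ultimately have "compactin (subtopology T (fst c)) (g ` K)" by (rule image_compactin)
  then have "compactin T (g ` K)" by (simp add: compactin_subtopology)
  then show ?thesis
    unfolding eq by (rule compactin_imp_closedin[OF smooth_manifoldD(2)[OF M]])
qed

text \<open>The image of \<open>d\<close> is covered by two open sets: the overlap with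
  \<open>c\<close>, where \<open>f\<close> is \<open>g\<close>, and the part off the preimage of
  \<open>K\<close>, where \<open>f\<close> is 0. Openness of the second one uses
  \<open>closedin_chart_compact\<close>.\<close>

lemma smooth_on_chart_image_split:
  assumes c: "c \<in> A" and d: "d \<in> A" and K: "compact K" "K \<subseteq> chart_image c"
    and g: "\<And>k. Ck_on k (snd d ` (fst d \<inter> fst c)) g"
    and f: "\<And>q. q \<in> fst d \<Longrightarrow> q \<in> fst c \<Longrightarrow> f (snd d q) = g (snd d q)"
    and f0: "\<And>q. q \<in> fst d \<Longrightarrow> q \<notin> chart_inv c ` K \<Longrightarrow> f (snd d q) = 0"
  shows "smooth_on (chart_image d) f"
proof -
  let ?S = "snd d ` (fst d \<inter> fst c)" and ?S' = "snd d ` (fst d - chart_inv c ` K)"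
  have o: "open ?S" "open ?S'"
    using c d smooth_manifoldD(4)[OF M c] smooth_manifoldD(4)[OF M d] closedin_chart_compact[OF c K]
    by (auto intro!: open_chart_map openin_diff openin_Int)
  have "chart_inv c ` K \<subseteq> fst c" using K(2) inv_into_into[of _ "snd c" "fst c"] by blast
  then have un: "chart_image d = ?S \<union> ?S'" by blast
  have "Ck_on k ?S f" for k
    by (rule Ck_on_cong[OF o(1) _ g]) (use f in auto)
  moreover have "Ck_on k ?S' f" for k
    by (rule Ck_on_cong[OF o(2) _ Ck_on_const[where c = 0]]) (use f0 in auto)
  ultimately show ?thesis
    unfolding smooth_on_def un using Ck_on_Un[OF o] by blast
qed

lemma smooth_bump:
  assumes c: "c \<in> A" "p \<in> fst c"
  obtains \<rho> K where "\<And>k. Ck_on k UNIV (\<rho> :: 'e \<Rightarrow> real)" "\<rho> (snd c p) = 1"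
    "compact K" "K \<subseteq> chart_image c" "\<And>q. q \<in> fst c \<Longrightarrow> q \<notin> chart_inv c ` K \<Longrightarrow> \<rho> (snd c q) = 0"
proof -
  obtain B :: "'e set" where "finite B" "span B = UNIV" using smooth_manifoldD(1)[OF M] by blast
  then obtain E :: "'e set" where E: "finite_frame E (\<lambda>b v. v \<bullet> b) (\<lambda>b. b)"
    by (rule finite_frame_exists)
  obtain \<epsilon> where \<epsilon>: "\<epsilon> > 0" "cball (snd c p) \<epsilon> \<subseteq> chart_image c"
    using smooth_manifoldD(5)[OF M c(1)] c(2) open_contains_cball by blast
  obtain \<rho> :: "'e \<Rightarrow> real" where \<rho>: "\<And>k. Ck_on k UNIV \<rho>" "\<rho> (snd c p) = 1"
      "\<And>x. x \<notin> cball (snd c p) \<epsilon> \<Longrightarrow> \<rho> x = 0"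
    using bump_function[OF \<epsilon>(1)] by blast
  have "\<rho> (snd c q) = 0" if "q \<in> fst c" "q \<notin> chart_inv c ` cball (snd c p) \<epsilon>" for q
    using that \<rho>(3) inv_into_f_f[OF chart_inj[OF c(1)]] by (metis imageI)
  then show thesis
    by (rule that[OF \<rho>(1,2) finite_frame_compact_cball[OF E] \<epsilon>(2)])
qed

lemma Ck_on_transition:
  assumes "c \<in> A" "d \<in> A"
  shows "Ck_on k (snd c ` (fst c \<inter> fst d)) (transition c d)"
    and "Ck_on k (snd c ` (fst c \<inter> fst d)) (\<lambda>x. frechet_derivative (transition c d) (at x) v)"
  using smooth_on_Ck[OF smooth_manifoldD(7)[OF M assms]] Ck_on_SucD(2) by blast+

text \<open>A constant coordinate field cut off by a bump function and extended by 0.\<close>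

lemma vector_field_extension:
  assumes c: "c \<in> A" "p \<in> fst c"
  obtains X where "vector_field A X" "X p c = e"
proof -
  obtain B :: "'e set" where "finite B" "span B = UNIV" using smooth_manifoldD(1)[OF M] by blast
  then obtain E :: "'e set" where E: "finite_frame E (\<lambda>b v. v \<bullet> b) (\<lambda>b. b)"
    by (rule finite_frame_exists)
  interpret c2_atlas A E by (rule smooth_manifold_c2_atlas[OF E])
  obtain \<rho> K where \<rho>: "\<And>k. Ck_on k UNIV (\<rho> :: 'e \<Rightarrow> real)" "\<rho> (snd c p) = 1"
    "compact K" "K \<subseteq> chart_image c" "\<And>q. q \<in> fst c \<Longrightarrow> q \<notin> chart_inv c ` K \<Longrightarrow> \<rho> (snd c q) = 0"
    using smooth_bump[OF c] by blast
  define X where "X q = (if q \<in> fst c then coord_vec A c q (\<rho> (snd c q) *\<^sub>R e) else 0)" for q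
  have zero: "0 \<in> tangent_space A q" if "q \<in> fst d" "d \<in> A" for q d
    using coord_vec_in[OF that(2,1)] tangent_space_diff[of "coord_vec A d q 0" q "coord_vec A d q
      0"] by auto
  show thesis
  proof (rule that)
    show "X p c = e" using c \<rho>(2) by (simp add: X_def)
    show "vector_field A X"
      unfolding vector_field_def
    proof (intro conjI ballI)
      fix q assume "q \<in> carrier A"
      then show "X q \<in> tangent_space A q"
        using c zero chart_at_in[of q A] by (cases "q \<in> fst c") (simp_all add: X_def)
    next
      fix d assume d: "d \<in> A"
      let ?S = "snd d ` (fst d \<inter> fst c)"
      \<comment> \<open>The component in \<open>d\<close> is the Jacobian of
        \<open>transition c d\<close> applied to the cut-off vector. It is evaluated in the
        coordinates of \<open>c\<close>, so its smoothness in those of \<open>d\<close> needs a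
        further composition with \<open>transition d c\<close>.\<close>
      let ?g = "\<lambda>x. \<rho> (transition d c x) *\<^sub>R frechet_derivative (transition c d)
        (at (transition d c x)) e"
      have S: "open ?S" by (rule open_overlap[OF d c(1)])
      have im: "transition d c ` ?S \<subseteq> snd c ` (fst c \<inter> fst d)" using d by auto
      show "smooth_on (chart_image d) (\<lambda>x. X (chart_inv d x) d)"
      proof (rule smooth_on_chart_image_split[OF c(1) d \<rho>(3,4), where g = ?g])
        fix k
        have "Ck_on k ?S (\<lambda>x. \<rho> (transition d c x))"
          by (rule Ck_on_compose[OF frame S subset_UNIV Ck_on_transition(1)[OF d c(1)] \<rho>(1)])
        moreover have "Ck_on k ?S (\<lambda>x. frechet_derivative (transition c d)
          (at (transition d c x)) e)"
          by (rule Ck_on_compose[OF frame S im Ck_on_transition(1)[OF d c(1)] Ck_on_transition(2)[OF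
            c(1) d]])
        ultimately show "Ck_on k ?S ?g"
          by (rule Ck_on_bilinear[OF bounded_bilinear_scaleR S])
      next
        fix q assume q: "q \<in> fst d" "q \<in> fst c"
        then show "X (chart_inv d (snd d q)) d = ?g (snd d q)"
          using c d linear_scale[OF linear_jacobian[OF c(1) d q(2,1)]]
          by (simp add: X_def coord_vec_apply jacobian_def)
      next
        fix q assume q: "q \<in> fst d" "q \<notin> chart_inv c ` K"
        then show "X (chart_inv d (snd d q)) d = 0"
          using c d \<rho>(5) linear_0[OF linear_jacobian[OF c(1) d _ q(1)]]
          by (cases "q \<in> fst c") (simp_all add: X_def coord_vec_apply)
      qed
    qed
  qed
qed

lemma one_form_extension:
  assumes c: "c \<in> A" "p \<in> fst c"
  obtains \<alpha> where "one_form A \<alpha>" "\<alpha> p = coord_covec A c p a"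
proof -
  obtain B :: "'e set" where "finite B" "span B = UNIV" using smooth_manifoldD(1)[OF M] by blast
  then obtain E :: "'e set" where E: "finite_frame E (\<lambda>b v. v \<bullet> b) (\<lambda>b. b)"
    by (rule finite_frame_exists)
  interpret c2_atlas A E by (rule smooth_manifold_c2_atlas[OF E])
  obtain \<rho> K where \<rho>: "\<And>k. Ck_on k UNIV (\<rho> :: 'e \<Rightarrow> real)" "\<rho> (snd c p) = 1"
    "compact K" "K \<subseteq> chart_image c" "\<And>q. q \<in> fst c \<Longrightarrow> q \<notin> chart_inv c ` K \<Longrightarrow> \<rho> (snd c q) = 0"
    using smooth_bump[OF c] by blast
  \<comment> \<open>The coefficient is 0 outside the domain of \<open>c\<close>, where
    \<open>coord_covec\<close> with respect to \<open>c\<close> would otherwise give no meaningful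
    covector; with coefficient 0 it is the zero functional.\<close>
  define \<alpha> where "\<alpha> q = coord_covec A c q ((if q \<in> fst c then \<rho> (snd c q) else 0) *\<^sub>R a)" for q
  have zero: "coord_covec A c q 0 \<in> cotangent_space A q" for q
    unfolding cotangent_space_def linear_between_def coord_covec_def by simp
  show thesis
  proof (rule that)
    show "\<alpha> p = coord_covec A c p a" using c \<rho>(2) by (simp add: \<alpha>_def)
    show "one_form A \<alpha>"
      unfolding one_form_def
    proof (intro conjI ballI allI)
      fix q
      show "\<alpha> q \<in> cotangent_space A q"
        using c zero by (cases "q \<in> fst c") (simp_all add: \<alpha>_def)
    next
      fix d e assume d: "d \<in> A"
      let ?S = "snd d ` (fst d \<inter> fst c)"
      \<comment> \<open>Evaluating a covector of \<open>c\<close> on a coordinate vector of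
        \<open>d\<close> involves the Jacobian of \<open>transition d c\<close> at \<open>x\<close>
        itself, so only the bump function is composed with a transition map.\<close>
      let ?g = "\<lambda>x. \<rho> (transition d c x) * blinfun_apply a (frechet_derivative (transition d c)
        (at x) e)"
      have S: "open ?S" by (rule open_overlap[OF d c(1)])
      show "smooth_on (chart_image d) (\<lambda>x. \<alpha> (chart_inv d x) (coord_vec A d (chart_inv d x) e))"
      proof (rule smooth_on_chart_image_split[OF c(1) d \<rho>(3,4), where g = ?g])
        fix k
        have "Ck_on k ?S (\<lambda>x. \<rho> (transition d c x))"
          by (rule Ck_on_compose[OF frame S subset_UNIV Ck_on_transition(1)[OF d c(1)] \<rho>(1)])
        moreover have "Ck_on k ?S (\<lambda>x. blinfun_apply a (frechet_derivative (transition d c)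
          (at x) e))"
          by (rule Ck_on_bounded_linear_compose[OF blinfun.bounded_linear_right S
            Ck_on_transition(2)[OF d c(1)]])
        ultimately show "Ck_on k ?S ?g"
          by (rule Ck_on_bilinear[OF bounded_bilinear_mult S])
      next
        fix q assume q: "q \<in> fst d" "q \<in> fst c"
        then show "\<alpha> (chart_inv d (snd d q)) (coord_vec A d (chart_inv d (snd d q)) e)
          = ?g (snd d q)"
          using c d by (simp add: \<alpha>_def coord_covec_apply coord_vec_apply jacobian_def
            blinfun.scaleR_left)
      next
        fix q assume q: "q \<in> fst d" "q \<notin> chart_inv c ` K"
        then show "\<alpha> (chart_inv d (snd d q)) (coord_vec A d (chart_inv d (snd d q)) e) = 0"
          using d \<rho>(5) by (cases "q \<in> fst c") (simp_all add: \<alpha>_def coord_covec_apply)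
      qed
    qed
  qed
qed

end

section \<open>The characterisation of compatibility\<close>

lemma (in c2_atlas) vector_field_C1: "vector_field A X \<Longrightarrow> C1_field X"
  unfolding vector_field_def C1_field_def
  by (auto intro: smooth_on_differentiable)

lemma (in c2_atlas) one_form_C1: "one_form A \<alpha> \<Longrightarrow> C1_form \<alpha>"
  unfolding one_form_def C1_form_def
  by (auto intro: smooth_on_differentiable)

lemma (in tensor_pair) sharp_dual_eq_iff:
  assumes c: "c \<in> A" "p \<in> fst c"
  shows "(\<forall>\<alpha>\<in>cotangent_space A p. sharp A \<pi> p (dual A r p \<alpha>) = r p (sharp A \<pi> p \<alpha>))
    \<longleftrightarrow> (\<forall>k. P c (snd c p) (k o\<^sub>L R_blinfun c (snd c p)) = R c (snd c p) (P c (snd c p) k))"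
proof -
  have "sharp A \<pi> p (dual A r p \<alpha>) = r p (sharp A \<pi> p \<alpha>) \<longleftrightarrow>
      P c (snd c p) (covec_coords A c p \<alpha> o\<^sub>L R_blinfun c (snd c p)) = R c (snd c p) (P c
        (snd c p) (covec_coords A c p \<alpha>))"
    if \<alpha>: "\<alpha> \<in> cotangent_space A p" for \<alpha>
  proof -
    have "sharp A \<pi> p (dual A r p \<alpha>) c = P c (snd c p) (covec_coords A c p \<alpha> o\<^sub>L R_blinfun c
      (snd c p))"
      using sharp_coords[OF c dual_in[OF c \<alpha>]] dual_coords[OF c \<alpha>] by simp
    moreover have "r p (sharp A \<pi> p \<alpha>) c = R c (snd c p) (P c (snd c p) (covec_coords A c p \<alpha>))"
      using endo_coords[OF c sharp_in[OF c \<alpha>]] sharp_coords[OF c \<alpha>] by simp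
    ultimately show ?thesis
      using tangent_space_eqI[OF sharp_in[OF c dual_in[OF c \<alpha>]] endo_in[OF c sharp_in[OF c \<alpha>]] c]
        by auto
  qed
  then show ?thesis
    using coord_covec_in[OF c] covec_coords_coord_covec[OF c] by metis
qed

theorem proposition3p3:
  fixes T :: "'a topology"
    and A :: "('a, 'e::real_inner) chart set"
    and \<pi> :: "'a \<Rightarrow> ('a, 'e) cotvec \<Rightarrow> ('a, 'e) cotvec \<Rightarrow> real"
    and r :: "'a \<Rightarrow> ('a, 'e) tvec \<Rightarrow> ('a, 'e) tvec"
  assumes "smooth_manifold T A"
    and "bivector_field A \<pi>"
    and "tensor_field_1_1 A r"
  shows "compatible A \<pi> r \<longleftrightarrow>
    (\<forall>U \<in> carrier (tangent_atlas (cotangent_atlas A)).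
       (tangent_map (cotangent_atlas A) (tangent_atlas A) (bundle_map (sharp A \<pi>))
          \<circ> cotangent_lift A r) U =
       (tangent_lift A r
          \<circ> tangent_map (cotangent_atlas A) (tangent_atlas A) (bundle_map (sharp A \<pi>))) U)"
proof -
  obtain B :: "'e set" where "finite B" "span B = UNIV" using smooth_manifoldD(1)[OF assms(1)]
    by blast
  then obtain E :: "'e set" where E: "finite_frame E (\<lambda>b v. v \<bullet> b) (\<lambda>b. b)"
    by (rule finite_frame_exists)
  interpret c2_atlas A E by (rule smooth_manifold_c2_atlas[OF assms(1) E])
  interpret tensor_pair A E \<pi> r
  proof
    show "(\<lambda>x. \<pi> (chart_inv c x) (coord_covec A c (chart_inv c x) a) (coord_covec A c (chart_inv c
      x) b))
        differentiable (at (snd c p))" if "c \<in> A" "p \<in> fst c" for c p a b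
      using assms(2) that by (intro smooth_on_differentiable[of "chart_image c"]) (auto simp:
        bivector_field_def)
    show "(\<lambda>x. r (chart_inv c x) (coord_vec A c (chart_inv c x) e) c) differentiable (at (snd c p))"
      if "c \<in> A" "p \<in> fst c" for c p e
      using assms(3) that by (intro smooth_on_differentiable[of "chart_image c"]) (auto simp:
        tensor_field_1_1_def)
  next
    fix p \<alpha> \<beta> assume p: "p \<in> carrier A"
    show "linear_between (tangent_space A p) (tangent_space A p) (r p)"
      using assms(3) p unfolding tensor_field_1_1_def by blast
    assume \<alpha>: "\<alpha> \<in> cotangent_space A p"
    show "linear_between (cotangent_space A p) UNIV (\<pi> p \<alpha>)"
      using assms(2) p \<alpha> unfolding bivector_field_def by blast
    assume "\<beta> \<in> cotangent_space A p"
    then show "\<pi> p \<alpha> \<beta> = - \<pi> p \<beta> \<alpha>"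
      using assms(2) p \<alpha> unfolding bivector_field_def by blast
  qed
  let ?E1 = "\<lambda>p. let c = chart_at A p; x = snd c p in
       \<forall>k. P c x (k o\<^sub>L R_blinfun c x) = R c x (P c x k)"
  let ?E2 = "\<lambda>p a h. let c = chart_at A p; x = snd c p in
       DP c p a (R c x h) + P c x (torsion_form c p a h) = DR c p h (P c x a) + R c x (DP c p a h)"
  let ?C = "\<lambda>X \<alpha> p. sharp A \<pi> p (lie_deriv_form A X (\<lambda>q. dual A r q (\<alpha> q)) p
                        - lie_deriv_form A (\<lambda>q. r q (X q)) \<alpha> p)
           - lie_deriv_endo A (\<lambda>q. sharp A \<pi> q (\<alpha> q)) r X p = 0"
  have E1: "(\<forall>\<alpha>\<in>cotangent_space A p. sharp A \<pi> p (dual A r p \<alpha>) = r p (sharp A \<pi> p \<alpha>)) \<longleftrightarrow> ?E1 p"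
    if "p \<in> carrier A" for p
    unfolding Let_def by (rule sharp_dual_eq_iff[OF chart_at_in[OF that]])
  \<comment> \<open>At a fixed point the condition depends on \<open>X\<close> and
    \<open>\<alpha>\<close> only through their values there.\<close>
  have C: "?C X \<alpha> p \<longleftrightarrow> ?E2 p (covec_coords A (chart_at A p) p (\<alpha> p)) (X p (chart_at A p))"
    if "vector_field A X" "one_form A \<alpha>" "p \<in> carrier A" "?E1 p" for X \<alpha> p
    unfolding Let_def
    by (rule compatible_at_iff[OF vector_field_C1[OF that(1)] one_form_C1[OF that(2)] that(3) refl])
      (use that(4) in \<open>simp add: Let_def\<close>)
  \<comment> \<open>The extensions realise every pair \<open>a\<close>, \<open>h\<close> at
    \<open>p\<close> by global smooth fields. The first condition is required only at the same
    point, so the whole equivalence can be assembled pointwise.\<close>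
  have E2: "(\<forall>X \<alpha>. vector_field A X \<longrightarrow> one_form A \<alpha> \<longrightarrow> ?C X \<alpha> p) \<longleftrightarrow> (\<forall>a h. ?E2 p a h)"
    if p: "p \<in> carrier A" "?E1 p" for p
  proof (intro iffI allI)
    fix a h assume L: "\<forall>X \<alpha>. vector_field A X \<longrightarrow> one_form A \<alpha> \<longrightarrow> ?C X \<alpha> p"
    note c = chart_at_in[OF p(1)]
    obtain X where X: "vector_field A X" "X p (chart_at A p) = h"
      using vector_field_extension[OF assms(1) c] by blast
    obtain \<alpha> where \<alpha>: "one_form A \<alpha>" "\<alpha> p = coord_covec A (chart_at A p) p a"
      using one_form_extension[OF assms(1) c] by blast
    have "?C X \<alpha> p" using L X(1) \<alpha>(1) by blast
    then have "?E2 p (covec_coords A (chart_at A p) p (\<alpha> p)) (X p (chart_at A p))"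
      by (rule C[OF X(1) \<alpha>(1) p, THEN iffD1])
    then show "?E2 p a h" unfolding X(2) \<alpha>(2) covec_coords_coord_covec[OF c] .
  qed (use C p in blast)
  have "compatible A \<pi> r \<longleftrightarrow> (\<forall>p\<in>carrier A. ?E1 p) \<and> (\<forall>p\<in>carrier A. \<forall>X \<alpha>. vector_field A X \<longrightarrow> one_form
    A \<alpha> \<longrightarrow> ?C X \<alpha> p)"
    unfolding compatible_def using E1 by blast
  also have "\<dots> \<longleftrightarrow> (\<forall>p\<in>carrier A. ?E1 p \<and> (\<forall>a h. ?E2 p a h))"
    using E2 by blast
  finally show ?thesis
    unfolding lifts_commute_iff by (simp add: Let_def)
qed

end
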